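(* There exists a neighbourhood $\mathcal{U}$ of the identity in $\mathrm{Ham}_c(\mathbb{D},\omega_0)$ with respect to the $C^1$-topology such that the following holds. Let $\psi\in\mathcal{U}$, and suppose that all fixed points of $\psi$ have non-negative action. Then $\psi$ can be generated by a non-negative (time-dependent) Hamiltonian $H$ with support contained in $\mathrm{int}(\mathbb{D})$.
   Context: $\mathbb{D}\subset\mathbb{C}$ is the closed unit disk with $\omega_0=dx\wedge dy$. $\mathrm{Ham}_c(\mathbb{D},\omega_0)$ is the group of Hamiltonian diffeomorphisms of $(\mathbb{D},\omega_0)$ compactly supported in $\mathrm{int}(\mathbb{D})$. A time-dependent Hamiltonian $H_t$, $t\in[0,1]$, supported in $\mathrm{int}(\mathbb{D})$ generates $\psi$ if $\psi=\phi_H^1$, where $\phi_H^t$ is the flow of $X_{H_t}$ defined by $\iota_{X_{H_t}}\omega_0=dH_t$. The action: given a primitive $\lambda$ of $\omega_0$, let $\sigma_{\psi,\lambda}:\mathbb{D}\to\mathbb{R}$ be the unique smooth function with $\psi^*\lambda-\lambda=d\sigma_{\psi,\lambda}$ and $\sigma_{\psi,\lambda}=0$ on $\partial\mathbb{D}$. The action of a fixed point $p$ of $\psi$ is $\sigma_\psi(p)=\sigma_{\psi,\lambda}(p)$, which does not depend on $\lambda$. *)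

theory Defs
  imports "HOL-Analysis.Analysis"
begin

abbreviation disk :: "complex set" where
  "disk \<equiv> cball 0 1"

section \<open>Smoothness\<close>

text \<open>
  Derivatives are taken within \<open>S\<close>, so the definition is meant for sets on which they are unique:
  open sets, and convex sets with non-empty interior such as \<open>disk\<close> and \<open>{0..1} \<times> disk\<close>
  (where at boundary points they are the one-sided derivatives).
  The directional derivatives \<open>x \<mapsto> Df(x) v\<close>, for all fixed \<open>v\<close>, replace \<open>Df\<close>
  in the recursion to keep the type of \<open>f\<close>.
\<close>

primrec Ck_on :: "nat \<Rightarrow> 'a::real_normed_vector set \<Rightarrow> ('a \<Rightarrow> 'b::real_normed_vector) \<Rightarrow> bool" where
  "Ck_on 0 S f \<longleftrightarrow> continuous_on S f"
| "Ck_on (Suc k) S f \<longleftrightarrow>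
     f differentiable_on S \<and> (\<forall>v. Ck_on k S (\<lambda>x. frechet_derivative f (at x within S) v))"

definition smooth_on :: "'a::real_normed_vector set \<Rightarrow> ('a \<Rightarrow> 'b::real_normed_vector) \<Rightarrow> bool" where
  "smooth_on S f \<longleftrightarrow> (\<forall>k. Ck_on k S f)"

lemma has_derivative_unique_within_convex:
  fixes f :: "'a::euclidean_space \<Rightarrow> 'b::real_normed_vector"
  assumes S: "convex S" "interior S \<noteq> {}" and x: "x \<in> S"
    and f': "(f has_derivative f') (at x within S)" and f'': "(f has_derivative f'') (at x within S)"
  shows "f' = f''"
proof -
  have eq: "f' (y - x) = f'' (y - x)" if y: "y \<in> S" for y
  proof -
    let ?g = "\<lambda>t::real. x + t *\<^sub>R (y - x)"
    have g: "?g ` cbox 0 1 \<subseteq> S"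
    proof
      fix w assume "w \<in> ?g ` cbox 0 1"
      then obtain t where "0 \<le> t" "t \<le> 1" "w = (1 - t) *\<^sub>R x + t *\<^sub>R y"
        by (auto simp: algebra_simps)
      then show "w \<in> S" using S(1) x y by (simp add: convexD_alt)
    qed
    have dg: "(?g has_vector_derivative (y - x)) (at 0 within cbox 0 1)"
      by (auto intro!: derivative_eq_intros simp: has_vector_derivative_def)
    have "((f \<circ> ?g) has_vector_derivative D (y - x)) (at 0 within cbox 0 1)"
      if "(f has_derivative D) (at x within S)" for D
      by (rule vector_derivative_diff_chain_within[OF dg])
         (use has_derivative_subset[OF that g] in simp)
    from this[OF f'] this[OF f''] show ?thesis
      using vector_derivative_unique_within_closed_interval[of 0 1 0 "f \<circ> ?g"] by auto
  qed
  obtain y e where e: "e > 0" "ball y e \<subseteq> S"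
    using S(2) by (meson ex_in_conv mem_interior)
  have lin: "linear f'" "linear f''"
    using f' f'' by (auto simp: has_derivative_def bounded_linear.linear)
  show ?thesis
  proof
    fix v :: 'a
    define c where "c = e / 2 / (norm v + 1)"
    have n: "norm v + 1 > 0" by (simp add: add_nonneg_pos)
    have c: "c > 0" using e(1) n by (simp add: c_def)
    have "c * norm v \<le> c * (norm v + 1)" using c by simp
    also have "\<dots> = e / 2"
      using nonzero_eq_divide_eq[of "norm v + 1" c "e / 2"] n c_def by linarith
    also have "\<dots> < e" using e(1) by simp
    finally have "y + c *\<^sub>R v \<in> S" using e c by (auto simp: dist_norm subset_eq)
    moreover have "y \<in> S" using e by auto
    ultimately have "f' (y + c *\<^sub>R v - x) - f' (y - x) = f'' (y + c *\<^sub>R v - x) - f'' (y - x)"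
      by (simp add: eq)
    then have "f' (c *\<^sub>R v) = f'' (c *\<^sub>R v)"
      by (simp add: linear_diff[OF lin(1), symmetric] linear_diff[OF lin(2), symmetric])
    then show "f' v = f'' v"
      using c by (simp add: linear_scale[OF lin(1)] linear_scale[OF lin(2)])
  qed
qed

lemma frechet_derivative_within_convex:
  fixes f :: "'a::euclidean_space \<Rightarrow> 'b::real_normed_vector"
  assumes "convex S" "interior S \<noteq> {}" "(f has_derivative f') (at x within S)" "x \<in> S"
  shows "frechet_derivative f (at x within S) = f'"
proof -
  have "(f has_derivative frechet_derivative f (at x within S)) (at x within S)"
    using assms(3) differentiable_def frechet_derivative_works by blast
  then show ?thesis
    using has_derivative_unique_within_convex[OF assms(1,2,4) _ assms(3)] by blast
qed

lemma Ck_on_cong: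
  assumes "\<And>x. x \<in> S \<Longrightarrow> f x = g x" shows "Ck_on k S f \<longleftrightarrow> Ck_on k S g"
  using assms
proof (induction k arbitrary: f g)
  case 0
  then show ?case using continuous_on_cong by auto
next
  case (Suc k)
  have "(f has_derivative D) (at x within S) \<longleftrightarrow> (g has_derivative D) (at x within S)"
    if "x \<in> S" for D x
    using has_derivative_transform[OF that] Suc.prems by metis
  then have D: "f differentiable_on S \<longleftrightarrow> g differentiable_on S"
    "\<And>x. x \<in> S \<Longrightarrow> frechet_derivative f (at x within S) = frechet_derivative g (at x within S)"
    by (auto simp: differentiable_on_def differentiable_def frechet_derivative_def)
  have "Ck_on k S (\<lambda>x. frechet_derivative f (at x within S) v) \<longleftrightarrow>
        Ck_on k S (\<lambda>x. frechet_derivative g (at x within S) v)" for v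
    by (rule Suc.IH) (simp add: D(2))
  with D(1) show ?case by simp
qed

lemma smooth_on_linear:
  fixes f :: "'a::euclidean_space \<Rightarrow> 'b::real_normed_vector"
  assumes S: "convex S" "interior S \<noteq> {}" and f: "bounded_linear f"
  shows "smooth_on S f"
proof -
  have const: "Ck_on k S (\<lambda>x. c)" for k and c :: 'b
  proof (induction k arbitrary: c)
    case (Suc k)
    have "Ck_on k S (\<lambda>x. frechet_derivative (\<lambda>x. c) (at x within S) v) \<longleftrightarrow> Ck_on k S (\<lambda>x. 0 :: 'b)" for v
      by (rule Ck_on_cong) (simp add: frechet_derivative_within_convex[OF S has_derivative_const])
    with Suc show ?case by simp
  qed simp
  have "Ck_on k S f" for k
  proof (cases k)
    case 0
    then show ?thesis using f by (simp add: linear_continuous_on)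
  next
    case (Suc j)
    have der: "(f has_derivative f) (at x within S)" for x
      by (rule bounded_linear_imp_has_derivative[OF f])
    have "Ck_on j S (\<lambda>x. frechet_derivative f (at x within S) v) \<longleftrightarrow> Ck_on j S (\<lambda>x. f v)" for v
      by (rule Ck_on_cong) (simp add: frechet_derivative_within_convex[OF S der])
    then show ?thesis
      using Suc const differentiableI[OF der] by (simp add: differentiable_on_def)
  qed
  then show ?thesis by (simp add: smooth_on_def)
qed

abbreviation disk_deriv :: "(complex \<Rightarrow> 'b::real_normed_vector) \<Rightarrow> complex \<Rightarrow> complex \<Rightarrow> 'b" where
  "disk_deriv f z \<equiv> frechet_derivative f (at z within disk)"


section \<open>Hamiltonians, flows and the group of Hamiltonian diffeomorphisms\<close>

text \<open>The area form \<open>dx \<and> dy\<close>, the same at every point.\<close>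

definition \<omega>0 :: "complex \<Rightarrow> complex \<Rightarrow> real" where
  "\<omega>0 u v = Re u * Im v - Im u * Re v"

text \<open>
  Time-dependent Hamiltonians on \<open>disk\<close>, with \<open>t \<in> [0,1]\<close>, whose support is contained in the open
  disk.  Values outside \<open>{0..1} \<times> disk\<close> play no role.
\<close>

definition supported_Hamiltonian :: "(real \<Rightarrow> complex \<Rightarrow> real) \<Rightarrow> bool" where
  "supported_Hamiltonian H \<longleftrightarrow>
     smooth_on ({0..1} \<times> disk) (\<lambda>(t, z). H t z) \<and>
     closure {(t, z). t \<in> {0..1} \<and> z \<in> disk \<and> H t z \<noteq> 0} \<subseteq> {0..1} \<times> ball 0 1"

text \<open>The vector field determined by \<open>\<iota>\<^sub>X \<omega>0 = dh\<close>.\<close>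

definition Ham_vector_field :: "(complex \<Rightarrow> real) \<Rightarrow> complex \<Rightarrow> complex" where
  "Ham_vector_field h z = (THE X. \<forall>v. \<omega>0 X v = disk_deriv h z v)"

definition is_Ham_flow :: "(real \<Rightarrow> complex \<Rightarrow> real) \<Rightarrow> (real \<Rightarrow> complex \<Rightarrow> complex) \<Rightarrow> bool" where
  "is_Ham_flow H \<phi> \<longleftrightarrow>
     (\<forall>z\<in>disk. \<phi> 0 z = z \<and>
       (\<forall>t\<in>{0..1}. \<phi> t z \<in> disk \<and>
         ((\<lambda>s. \<phi> s z) has_vector_derivative Ham_vector_field (H t) (\<phi> t z)) (at t within {0..1})))"

definition generates :: "(real \<Rightarrow> complex \<Rightarrow> real) \<Rightarrow> (complex \<Rightarrow> complex) \<Rightarrow> bool" where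
  "generates H \<psi> \<longleftrightarrow> (\<exists>\<phi>. is_Ham_flow H \<phi> \<and> (\<forall>z\<in>disk. \<psi> z = \<phi> 1 z))"

text \<open>
  A diffeomorphism of \<open>disk\<close> is represented by its extension to the plane by the identity,
  so that representatives are unique.
\<close>

definition Ham_c :: "(complex \<Rightarrow> complex) set" where
  "Ham_c = {\<psi>. (\<forall>z. z \<notin> disk \<longrightarrow> \<psi> z = z) \<and> (\<exists>H. supported_Hamiltonian H \<and> generates H \<psi>)}"


section \<open>The \<open>C\<^sup>1\<close>-topology\<close>

definition C1_ball :: "(complex \<Rightarrow> complex) \<Rightarrow> real \<Rightarrow> (complex \<Rightarrow> complex) set" where
  "C1_ball \<psi> \<epsilon> = {\<phi> \<in> Ham_c. \<forall>z\<in>disk.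
      dist (\<phi> z) (\<psi> z) < \<epsilon> \<and> onorm (\<lambda>v. disk_deriv \<phi> z v - disk_deriv \<psi> z v) < \<epsilon>}"

definition C1_topology :: "(complex \<Rightarrow> complex) topology" where
  "C1_topology = topology (\<lambda>U. U \<subseteq> Ham_c \<and> (\<forall>\<psi>\<in>U. \<exists>\<epsilon>>0. C1_ball \<psi> \<epsilon> \<subseteq> U))"

lemma openin_C1_topology:
  "openin C1_topology U \<longleftrightarrow> U \<subseteq> Ham_c \<and> (\<forall>\<psi>\<in>U. \<exists>\<epsilon>>0. C1_ball \<psi> \<epsilon> \<subseteq> U)"
proof -
  have "istopology (\<lambda>U. U \<subseteq> Ham_c \<and> (\<forall>\<psi>\<in>U. \<exists>\<epsilon>>0. C1_ball \<psi> \<epsilon> \<subseteq> U))"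
    unfolding istopology_def
  proof (intro conjI allI impI; (elim conjE)?)
    fix S T
    assume S: "\<forall>\<psi>\<in>S. \<exists>\<epsilon>>0. C1_ball \<psi> \<epsilon> \<subseteq> S" and T: "\<forall>\<psi>\<in>T. \<exists>\<epsilon>>0. C1_ball \<psi> \<epsilon> \<subseteq> T"
    show "\<forall>\<psi>\<in>S \<inter> T. \<exists>\<epsilon>>0. C1_ball \<psi> \<epsilon> \<subseteq> S \<inter> T"
    proof
      fix \<psi> assume "\<psi> \<in> S \<inter> T"
      then obtain a b where "a > 0" "C1_ball \<psi> a \<subseteq> S" "b > 0" "C1_ball \<psi> b \<subseteq> T"
        using S T by blast
      moreover have "C1_ball \<psi> (min a b) \<subseteq> C1_ball \<psi> a \<inter> C1_ball \<psi> b"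
        unfolding C1_ball_def by auto
      ultimately show "\<exists>\<epsilon>>0. C1_ball \<psi> \<epsilon> \<subseteq> S \<inter> T"
        by (intro exI[of _ "min a b"]) auto
    qed
  next
    fix K
    assume K: "\<forall>S\<in>K. S \<subseteq> Ham_c \<and> (\<forall>\<psi>\<in>S. \<exists>\<epsilon>>0. C1_ball \<psi> \<epsilon> \<subseteq> S)"
    then show "\<Union>K \<subseteq> Ham_c" by blast
    from K show "\<forall>\<psi>\<in>\<Union>K. \<exists>\<epsilon>>0. C1_ball \<psi> \<epsilon> \<subseteq> \<Union>K"
      by (meson UnionE Union_upper subset_trans)
  qed auto
  then show ?thesis
    unfolding C1_topology_def by (simp add: topology_inverse')
qed

lemma topspace_C1_topology: "topspace C1_topology = Ham_c"
proof -
  have "openin C1_topology Ham_c"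
    unfolding openin_C1_topology C1_ball_def by (auto intro!: exI[of _ 1])
  moreover have "U \<subseteq> Ham_c" if "openin C1_topology U" for U
    using that by (simp add: openin_C1_topology)
  ultimately show ?thesis
    unfolding topspace_def by blast
qed


section \<open>Primitives of the area form and the action\<close>

text \<open>A 1-form \<open>\<alpha>\<close> on \<open>disk\<close> has value \<open>\<alpha> z v\<close> on the tangent vector \<open>v\<close> at \<open>z\<close>.\<close>

definition one_form :: "(complex \<Rightarrow> complex \<Rightarrow> real) \<Rightarrow> bool" where
  "one_form \<alpha> \<longleftrightarrow> (\<forall>z\<in>disk. linear (\<alpha> z)) \<and> (\<forall>v. smooth_on disk (\<lambda>z. \<alpha> z v))"

text \<open>\<open>d\<alpha>(u, v) = u(\<alpha>(v)) - v(\<alpha>(u))\<close> for constant vector fields \<open>u\<close>, \<open>v\<close>.\<close>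

definition ext_deriv ::
    "(complex \<Rightarrow> complex \<Rightarrow> real) \<Rightarrow> complex \<Rightarrow> complex \<Rightarrow> complex \<Rightarrow> real" where
  "ext_deriv \<alpha> z u v = disk_deriv (\<lambda>x. \<alpha> x v) z u - disk_deriv (\<lambda>x. \<alpha> x u) z v"

definition primitive_of_\<omega>0 :: "(complex \<Rightarrow> complex \<Rightarrow> real) \<Rightarrow> bool" where
  "primitive_of_\<omega>0 \<alpha> \<longleftrightarrow> one_form \<alpha> \<and> (\<forall>z\<in>disk. \<forall>u v. ext_deriv \<alpha> z u v = \<omega>0 u v)"

definition pullback ::
    "(complex \<Rightarrow> complex) \<Rightarrow> (complex \<Rightarrow> complex \<Rightarrow> real) \<Rightarrow> complex \<Rightarrow> complex \<Rightarrow> real" where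
  "pullback \<psi> \<alpha> z v = \<alpha> (\<psi> z) (disk_deriv \<psi> z v)"

definition is_action_function ::
    "(complex \<Rightarrow> complex) \<Rightarrow> (complex \<Rightarrow> complex \<Rightarrow> real) \<Rightarrow> (complex \<Rightarrow> real) \<Rightarrow> bool" where
  "is_action_function \<psi> \<alpha> \<sigma> \<longleftrightarrow>
     smooth_on disk \<sigma> \<and>
     (\<forall>z\<in>disk. \<forall>v. pullback \<psi> \<alpha> z v - \<alpha> z v = disk_deriv \<sigma> z v) \<and>
     (\<forall>z\<in>sphere 0 1. \<sigma> z = 0)"

text \<open>The value at \<open>p \<in> disk\<close> of the unique function \<open>\<sigma>\<close> with \<open>is_action_function \<psi> \<alpha> \<sigma>\<close>.\<close>

definition action ::
    "(complex \<Rightarrow> complex) \<Rightarrow> (complex \<Rightarrow> complex \<Rightarrow> real) \<Rightarrow> complex \<Rightarrow> real" where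
  "action \<psi> \<alpha> p = (THE s. \<exists>\<sigma>. is_action_function \<psi> \<alpha> \<sigma> \<and> s = \<sigma> p)"


section \<open>Consistency of the definitions\<close>

lemma \<omega>0_representation:
  assumes "linear f" shows "(\<forall>v. \<omega>0 X v = f v) \<longleftrightarrow> X = Complex (f \<i>) (- f 1)"
proof
  assume X: "\<forall>v. \<omega>0 X v = f v"
  from X[rule_format, of 1] X[rule_format, of \<i>]
  show "X = Complex (f \<i>) (- f 1)" by (simp add: \<omega>0_def complex_eq_iff)
next
  assume X: "X = Complex (f \<i>) (- f 1)"
  show "\<forall>v. \<omega>0 X v = f v"
  proof
    fix v
    have "v = Re v *\<^sub>R 1 + Im v *\<^sub>R \<i>" by (simp add: complex_eq_iff)
    then have "f v = f (Re v *\<^sub>R 1 + Im v *\<^sub>R \<i>)" by (rule arg_cong)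
    also have "\<dots> = Re v * f 1 + Im v * f \<i>"
      by (simp only: linear_add[OF assms] linear_scale[OF assms] real_scaleR_def)
    finally show "\<omega>0 X v = f v" by (simp add: \<omega>0_def X algebra_simps)
  qed
qed

lemma Ham_vector_field_eq:
  assumes "h differentiable (at z within disk)"
  shows "Ham_vector_field h z = Complex (disk_deriv h z \<i>) (- disk_deriv h z 1)"
  using \<omega>0_representation[OF linear_frechet_derivative[OF assms]]
  unfolding Ham_vector_field_def by simp

lemma action_eq:
  assumes \<sigma>: "is_action_function \<psi> \<alpha> \<sigma>" and p: "p \<in> disk"
  shows "action \<psi> \<alpha> p = \<sigma> p"
  unfolding action_def
proof (rule the_equality)
  fix s assume "\<exists>\<tau>. is_action_function \<psi> \<alpha> \<tau> \<and> s = \<tau> p"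
  then obtain \<tau> where \<tau>: "is_action_function \<psi> \<alpha> \<tau>" and s: "s = \<tau> p" by blast
  have der: "(\<rho> has_derivative (\<lambda>v. pullback \<psi> \<alpha> z v - \<alpha> z v)) (at z within disk)"
    if "is_action_function \<psi> \<alpha> \<rho>" "z \<in> disk" for \<rho> z
  proof -
    have "Ck_on (Suc 0) disk \<rho>" using that by (simp add: is_action_function_def smooth_on_def)
    then have "(\<rho> has_derivative disk_deriv \<rho> z) (at z within disk)"
      using that(2) by (simp add: differentiable_on_def frechet_derivative_works)
    moreover have "disk_deriv \<rho> z = (\<lambda>v. pullback \<psi> \<alpha> z v - \<alpha> z v)"
      using that by (auto simp: is_action_function_def)
    ultimately show ?thesis by simp
  qed
  have "((\<lambda>z. \<tau> z - \<sigma> z) has_derivative (\<lambda>h. 0)) (at z within disk)" if "z \<in> disk" for z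
    using has_derivative_diff[OF der[OF \<tau> that] der[OF \<sigma> that]] by simp
  then obtain c where c: "\<And>z. z \<in> disk \<Longrightarrow> \<tau> z - \<sigma> z = c"
    using has_derivative_zero_constant[of disk "\<lambda>z. \<tau> z - \<sigma> z"] by auto
  have "\<tau> 1 = 0" "\<sigma> 1 = 0" using \<sigma> \<tau> by (auto simp: is_action_function_def)
  with c[of 1] have "c = 0" by simp
  with c[OF p] s show "s = \<sigma> p" by simp
qed (use \<sigma> in blast)

lemma id_in_Ham_c: "id \<in> Ham_c"
proof -
  have fd: "frechet_derivative (\<lambda>x. 0::real) (at x within S) = (\<lambda>v. 0)"
    if "convex S" "interior S \<noteq> {}" "x \<in> S" for x :: "'a::euclidean_space" and S
    using frechet_derivative_within_convex[OF that(1,2) has_derivative_const that(3)] .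
  have "supported_Hamiltonian (\<lambda>t z. 0)"
  proof -
    have "(\<lambda>(t, z). 0) = (\<lambda>p::real \<times> complex. 0::real)" by auto
    moreover have "smooth_on ({0..1} \<times> disk) (\<lambda>p::real \<times> complex. 0::real)"
      by (rule smooth_on_linear)
        (simp_all add: interior_Times convex_Times)
    ultimately show ?thesis by (simp add: supported_Hamiltonian_def)
  qed
  moreover have "generates (\<lambda>t z. 0) id"
    unfolding generates_def is_Ham_flow_def
  proof (intro exI[of _ "\<lambda>t z. z"] conjI ballI)
    fix t :: real and z :: complex assume z: "z \<in> disk"
    have "Ham_vector_field (\<lambda>z. 0) z = 0"
      using z by (subst Ham_vector_field_eq) (simp_all add: fd zero_complex.code)
    then show "((\<lambda>s. z) has_vector_derivative Ham_vector_field (\<lambda>z. 0) z) (at t within {0..1})"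
      by simp
  qed auto
  ultimately show ?thesis unfolding Ham_c_def by auto
qed

lemma standard_primitive: "primitive_of_\<omega>0 (\<lambda>z v. \<omega>0 z v / 2)"
proof -
  have bl: "bounded_linear (\<lambda>z. \<omega>0 z v / 2)" for v
    unfolding linear_conv_bounded_linear[symmetric]
    by (rule linearI) (simp_all add: \<omega>0_def algebra_simps add_divide_distrib diff_divide_distrib)
  have "linear (\<lambda>v. \<omega>0 z v / 2)" for z
    by (rule linearI) (simp_all add: \<omega>0_def algebra_simps add_divide_distrib diff_divide_distrib)
  moreover have "smooth_on disk (\<lambda>z. \<omega>0 z v / 2)" for v
    by (rule smooth_on_linear) (simp_all add: bl)
  moreover have "disk_deriv (\<lambda>z. \<omega>0 z v / 2) z = (\<lambda>u. \<omega>0 u v / 2)" if "z \<in> disk" for z v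
    using that by (intro frechet_derivative_within_convex bounded_linear_imp_has_derivative bl) auto
  ultimately show ?thesis
    by (simp add: primitive_of_\<omega>0_def one_form_def ext_deriv_def \<omega>0_def field_simps)
qed

end

theory Submission
  imports Defs
begin

text \<open>
  A diffeomorphism \<open>\<psi> = (X, Y)\<close> of the plane that is \<open>C\<^sup>1\<close>-close to the identity can be described in
  the mixed coordinates \<open>(X, y)\<close>: the map \<open>(x, y) \<mapsto> (X(x, y), y)\<close> is a perturbation of the identity,
  hence invertible.  If \<open>\<sigma>\<close> denotes the action function of \<open>\<psi>\<close> for the primitive \<open>x dy\<close>, so that
  \<open>d\<sigma> = X dY - x dy\<close>, then the function \<open>W = \<sigma> - X (Y - y)\<close>, read in the coordinates \<open>(X, y)\<close>, satisfies
  \<open>dW = (X - x) dy - (Y - y) dX\<close>.  It is a generating function of \<open>\<psi>\<close>.  Its critical points are exactly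
  the fixed points of \<open>\<psi>\<close>, its critical values are their actions, and it vanishes near the boundary.
  If all actions are non-negative, then the minimum of \<open>W\<close> over the disk is attained either where \<open>W\<close>
  vanishes or at a critical point, and so \<open>W \<ge> 0\<close> (\<open>W_nonneg\<close>).

  The functions \<open>t W\<close> with \<open>t \<in> [0,1]\<close> generate a path \<open>\<Phi>\<^sub>t\<close> from the identity to \<open>\<psi>\<close>, and the
  Hamilton-Jacobi equation says that \<open>\<Phi>\<^sub>t\<close> is the flow of the Hamiltonian \<open>H\<^sub>t\<close> whose value at the point
  \<open>\<Phi>\<^sub>t(x, y) = (X, Y)\<close> is \<open>W(X, y)\<close> (\<open>H_flow\<close>).  So \<open>H\<close> takes only values of \<open>W\<close>, and \<open>H \<ge> 0\<close>.
  Each change of variables in this construction solves for one real unknown that is the fixed point of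
  a contraction depending smoothly on parameters; such fixed points are smooth
  (\<open>parametrized_fixed_point_Cdiff\<close>).

  Two facts about an arbitrary element \<open>\<psi>\<close> of the group have to be derived from its definition as the
  time-1 map of some flow.  It is smooth, because solutions of ordinary differential equations depend
  smoothly on the initial value (\<open>ode_Cdiff_dependence\<close>).  And it has an action function: for the primitive
  \<open>x dy\<close> this is an integral along the flow (\<open>\<sigma>_derivative\<close>); any other primitive differs from \<open>x dy\<close> by an
  exact form \<open>df\<close> (\<open>Poincare_lemma\<close>), which changes the action function by \<open>f \<circ> \<psi> - f\<close> and thus leaves the
  actions of fixed points unchanged (\<open>action_at_fixed_point\<close>).
\<close>

section \<open>Differentiability of finite order on arbitrary sets\<close>

text \<open>
  In contrast to \<open>Ck_on\<close>, the derivative is any witness and not the one chosen by \<open>frechet_derivative\<close>.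
  Hence closure under sums, products and composition holds on every set, without uniqueness of derivatives; on convex
  sets with interior points the two notions agree (\<open>smooth_on_iff_Cdiff\<close>).  Smoothness is expressed by
  \<open>Cdiff k S f\<close> for all \<open>k\<close>.
\<close>

primrec Cdiff :: "nat \<Rightarrow> 'a::real_normed_vector set \<Rightarrow> ('a \<Rightarrow> 'b::real_normed_vector) \<Rightarrow> bool" where
  "Cdiff 0 S f \<longleftrightarrow> continuous_on S f"
| "Cdiff (Suc k) S f \<longleftrightarrow>
     (\<exists>f'. (\<forall>x\<in>S. (f has_derivative f' x) (at x within S)) \<and> (\<forall>v. Cdiff k S (\<lambda>x. f' x v)))"

lemma Cdiff_SucI:
  assumes "\<And>x. x \<in> S \<Longrightarrow> (f has_derivative f' x) (at x within S)" "\<And>v. Cdiff k S (\<lambda>x. f' x v)"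
  shows "Cdiff (Suc k) S f"
  using assms by auto

lemma Cdiff_SucE:
  assumes "Cdiff (Suc k) S f"
  obtains f' where "\<And>x. x \<in> S \<Longrightarrow> (f has_derivative f' x) (at x within S)" "\<And>v. Cdiff k S (\<lambda>x. f' x v)"
  using assms by auto

lemma Cdiff_cong:
  assumes "\<And>x. x \<in> S \<Longrightarrow> f x = g x" and f: "Cdiff k S f"
  shows "Cdiff k S g"
proof (cases k)
  case 0
  then show ?thesis using assms continuous_on_cong[of S S f g] by auto
next
  case (Suc j)
  obtain f' where f': "\<And>x. x \<in> S \<Longrightarrow> (f has_derivative f' x) (at x within S)" "\<And>v. Cdiff j S (\<lambda>x. f' x v)"
    using Cdiff_SucE f Suc by blast
  have "(g has_derivative f' x) (at x within S)" if "x \<in> S" for x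
    using has_derivative_transform[OF that _ f'(1)[OF that], of g] assms(1) by simp
  then show ?thesis using f'(2) Suc by auto
qed

lemma Cdiff_subset:
  assumes "Cdiff k T f" "S \<subseteq> T"
  shows "Cdiff k S f"
  using assms
proof (induction k arbitrary: f)
  case 0
  then show ?case using continuous_on_subset by auto
next
  case (Suc k)
  then obtain f' where f': "\<And>x. x \<in> T \<Longrightarrow> (f has_derivative f' x) (at x within T)" "\<And>v. Cdiff k T (\<lambda>x. f' x v)"
    using Cdiff_SucE by blast
  then show ?case
    using Suc.IH Suc.prems(2) has_derivative_subset[OF f'(1) Suc.prems(2)]
    by (intro Cdiff_SucI[of _ _ f']) auto
qed

lemma Cdiff_Suc_imp: "Cdiff (Suc k) S f \<Longrightarrow> Cdiff k S f"
proof (induction k arbitrary: f)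
  case 0
  then show ?case using has_derivative_continuous_on by auto
next
  case (Suc k)
  then obtain f' where f': "\<And>x. x \<in> S \<Longrightarrow> (f has_derivative f' x) (at x within S)" "\<And>v. Cdiff (Suc k) S (\<lambda>x. f' x v)"
    using Cdiff_SucE by blast
  then show ?case using Suc.IH by (intro Cdiff_SucI[of _ _ f']) auto
qed

lemma Cdiff_continuous_on: "Cdiff k S f \<Longrightarrow> continuous_on S f"
proof (induction k)
  case (Suc k)
  then show ?case using Cdiff_Suc_imp by blast
qed simp

lemma Cdiff_const: "Cdiff k S (\<lambda>x. c)"
  by (induction k arbitrary: c) (auto intro!: exI[of _ "\<lambda>x v. 0"])

lemma Cdiff_linear: 
  assumes "bounded_linear f" shows "Cdiff k S f"
proof (cases k)
  case 0
  then show ?thesis using assms by (simp add: linear_continuous_on)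
next
  case (Suc j)
  show ?thesis unfolding Suc
    by (rule Cdiff_SucI[of _ _ "\<lambda>x. f"]) (auto intro: bounded_linear_imp_has_derivative[OF assms] Cdiff_const)
qed

lemma Cdiff_linear_comp:
  assumes L: "bounded_linear L" and "Cdiff k S f" shows "Cdiff k S (\<lambda>x. L (f x))"
  using assms(2)
proof (induction k arbitrary: f)
  case 0
  then show ?case using bounded_linear.continuous_on[OF L] by auto
next
  case (Suc k)
  then obtain f' where f': "\<And>x. x \<in> S \<Longrightarrow> (f has_derivative f' x) (at x within S)" "\<And>v. Cdiff k S (\<lambda>x. f' x v)"
    using Cdiff_SucE by blast
  show ?case
    by (rule Cdiff_SucI[of _ _ "\<lambda>x v. L (f' x v)"])
      (auto intro: bounded_linear.has_derivative[OF L f'(1)] Suc.IH[OF f'(2)])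
qed

lemma Cdiff_add:
  assumes "Cdiff k S f" "Cdiff k S g" shows "Cdiff k S (\<lambda>x. f x + g x)"
  using assms
proof (induction k arbitrary: f g)
  case 0
  then show ?case by (auto intro: continuous_intros)
next
  case (Suc k)
  obtain f' where f': "\<And>x. x \<in> S \<Longrightarrow> (f has_derivative f' x) (at x within S)" "\<And>v. Cdiff k S (\<lambda>x. f' x v)"
    using Cdiff_SucE Suc.prems by blast
  obtain g' where g': "\<And>x. x \<in> S \<Longrightarrow> (g has_derivative g' x) (at x within S)" "\<And>v. Cdiff k S (\<lambda>x. g' x v)"
    using Cdiff_SucE Suc.prems by blast
  show ?case
    by (rule Cdiff_SucI[of _ _ "\<lambda>x v. f' x v + g' x v"])
      (auto intro: has_derivative_add f' g' Suc.IH)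
qed

lemma Cdiff_minus: "Cdiff k S f \<Longrightarrow> Cdiff k S (\<lambda>x. - f x)"
  by (rule Cdiff_linear_comp[OF bounded_linear_minus[OF bounded_linear_ident]])

lemma Cdiff_diff:
  assumes "Cdiff k S f" "Cdiff k S g" shows "Cdiff k S (\<lambda>x. f x - g x)"
  using Cdiff_add[OF assms(1) Cdiff_minus[OF assms(2)]] by simp

lemma Cdiff_sum:
  "(\<And>i. i \<in> I \<Longrightarrow> Cdiff k S (f i)) \<Longrightarrow> Cdiff k S (\<lambda>x. \<Sum>i\<in>I. f i x)"
proof (induction I rule: infinite_finite_induct)
  case (insert i I)
  then show ?case by (simp add: Cdiff_add del: Cdiff.simps)
qed (simp_all add: Cdiff_const del: Cdiff.simps)

lemma Cdiff_bilinear: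
  assumes B: "bounded_bilinear B" and "Cdiff k S f" "Cdiff k S g"
  shows "Cdiff k S (\<lambda>x. B (f x) (g x))"
  using assms(2,3)
proof (induction k arbitrary: f g)
  case 0
  then show ?case using bounded_bilinear.continuous_on[OF B] by auto
next
  case (Suc k)
  obtain f' where f': "\<And>x. x \<in> S \<Longrightarrow> (f has_derivative f' x) (at x within S)" "\<And>v. Cdiff k S (\<lambda>x. f' x v)"
    using Cdiff_SucE Suc.prems by blast
  obtain g' where g': "\<And>x. x \<in> S \<Longrightarrow> (g has_derivative g' x) (at x within S)" "\<And>v. Cdiff k S (\<lambda>x. g' x v)"
    using Cdiff_SucE Suc.prems by blast
  show ?case
    by (rule Cdiff_SucI[of _ _ "\<lambda>x v. B (f x) (g' x v) + B (f' x v) (g x)"])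
      (intro bounded_bilinear.FDERIV[OF B] f' g' Suc.IH Cdiff_add Suc.prems[THEN Cdiff_Suc_imp]; assumption)+
qed

lemmas Cdiff_scaleR = Cdiff_bilinear[OF bounded_bilinear_scaleR]
lemmas Cdiff_mult = Cdiff_bilinear[OF bounded_bilinear_mult]

lemma Cdiff_Pair:
  assumes "Cdiff k S f" "Cdiff k S g" shows "Cdiff k S (\<lambda>x. (f x, g x))"
proof -
  have "Cdiff k S (\<lambda>x. (f x, 0) + (0, g x))"
    by (intro Cdiff_add Cdiff_linear_comp[of "\<lambda>a. (a, 0)"] Cdiff_linear_comp[of "\<lambda>a. (0, a)"] assms
      bounded_linear_Pair bounded_linear_ident bounded_linear_zero)
  then show ?thesis by simp
qed

lemma Cdiff_fst: "Cdiff k S f \<Longrightarrow> Cdiff k S (\<lambda>x. fst (f x))"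
  and Cdiff_snd: "Cdiff k S f \<Longrightarrow> Cdiff k S (\<lambda>x. snd (f x))"
  by (rule Cdiff_linear_comp[OF bounded_linear_fst] Cdiff_linear_comp[OF bounded_linear_snd]; assumption)+

lemma Cdiff_ident: "Cdiff k S (\<lambda>x. x)"
  by (rule Cdiff_linear[OF bounded_linear_ident])

lemma linear_eq_sum_Basis:
  fixes f :: "'a::euclidean_space \<Rightarrow> 'b::real_vector"
  assumes "linear f"
  shows "f v = (\<Sum>b\<in>Basis. (v \<bullet> b) *\<^sub>R f b)"
proof -
  have "f v = f (\<Sum>b\<in>Basis. (v \<bullet> b) *\<^sub>R b)" by (simp add: euclidean_representation)
  also have "\<dots> = (\<Sum>b\<in>Basis. (v \<bullet> b) *\<^sub>R f b)"
    by (simp add: linear_sum[OF assms] linear_scale[OF assms])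
  finally show ?thesis .
qed

text \<open>
  The value \<open>A x (w x)\<close> is a finite sum of products once \<open>w x\<close> is expanded in a basis, so regularity of
  \<open>A\<close> in each fixed direction suffices.  This is the form in which derivatives occur in \<open>Cdiff\<close>.
\<close>

lemma Cdiff_linear_application:
  fixes A :: "'p::real_normed_vector \<Rightarrow> 'a::euclidean_space \<Rightarrow> 'b::real_normed_vector"
  assumes "\<And>x. x \<in> S \<Longrightarrow> linear (A x)" "\<And>b. Cdiff k S (\<lambda>x. A x b)" "Cdiff k S w"
  shows "Cdiff k S (\<lambda>x. A x (w x))"
proof (rule Cdiff_cong)
  show "Cdiff k S (\<lambda>x. \<Sum>b\<in>Basis. (w x \<bullet> b) *\<^sub>R A x b)"
    by (intro Cdiff_sum Cdiff_scaleR Cdiff_linear_comp[OF bounded_linear_inner_left] assms)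
qed (use linear_eq_sum_Basis[OF assms(1)] in auto)

lemma Cdiff_compose:
  fixes g :: "'b::euclidean_space \<Rightarrow> 'c::real_normed_vector"
  assumes "Cdiff k T g" "Cdiff k S f" "\<And>x. x \<in> S \<Longrightarrow> f x \<in> T"
  shows "Cdiff k S (\<lambda>x. g (f x))"
  using assms
proof (induction k arbitrary: f g)
  case 0
  then show ?case by (auto intro: continuous_on_compose2)
next
  case (Suc k)
  obtain f' where f': "\<And>x. x \<in> S \<Longrightarrow> (f has_derivative f' x) (at x within S)" "\<And>v. Cdiff k S (\<lambda>x. f' x v)"
    using Cdiff_SucE Suc.prems by blast
  obtain g' where g': "\<And>x. x \<in> T \<Longrightarrow> (g has_derivative g' x) (at x within T)" "\<And>v. Cdiff k T (\<lambda>x. g' x v)"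
    using Cdiff_SucE Suc.prems by blast
  show ?case
  proof (rule Cdiff_SucI[of _ _ "\<lambda>x v. g' (f x) (f' x v)"])
    fix x assume x: "x \<in> S"
    have "f ` S \<subseteq> T" using Suc.prems(3) by auto
    then have "(g has_derivative g' (f x)) (at (f x) within f ` S)"
      using has_derivative_subset[OF g'(1)] x by auto
    then show "((\<lambda>x. g (f x)) has_derivative (\<lambda>v. g' (f x) (f' x v))) (at x within S)"
      using diff_chain_within[OF f'(1)[OF x]] by (simp add: o_def)
  next
    fix v
    show "Cdiff k S (\<lambda>x. g' (f x) (f' x v))"
    proof (rule Cdiff_linear_application)
      show "linear (g' (f x))" if "x \<in> S" for x
        using g'(1)[OF Suc.prems(3)[OF that]] has_derivative_linear by blast
      show "Cdiff k S (\<lambda>x. g' (f x) b)" for b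
        by (rule Suc.IH[OF g'(2) Cdiff_Suc_imp[OF Suc.prems(2)] Suc.prems(3)])
    qed (rule f'(2))
  qed
qed

lemma Cdiff_inverse:
  fixes f :: "'a::real_normed_vector \<Rightarrow> real"
  assumes "Cdiff k S f" "\<And>x. x \<in> S \<Longrightarrow> f x \<noteq> 0"
  shows "Cdiff k S (\<lambda>x. inverse (f x))"
  using assms
proof (induction k arbitrary: f)
  case 0
  then show ?case by (auto intro: continuous_intros)
next
  case (Suc k)
  obtain f' where f': "\<And>x. x \<in> S \<Longrightarrow> (f has_derivative f' x) (at x within S)" "\<And>v. Cdiff k S (\<lambda>x. f' x v)"
    using Cdiff_SucE Suc.prems by blast
  show ?case
  proof (rule Cdiff_SucI[of _ _ "\<lambda>x v. - (inverse (f x) * f' x v * inverse (f x))"])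
    have "Cdiff k S (\<lambda>x. inverse (f x))"
      by (rule Suc.IH[OF Cdiff_Suc_imp[OF Suc.prems(1)] Suc.prems(2)])
    then show "Cdiff k S (\<lambda>x. - (inverse (f x) * f' x v * inverse (f x)))" for v
      by (intro Cdiff_minus Cdiff_mult f'(2))
  qed (rule Deriv.has_derivative_inverse[OF Suc.prems(2) f'(1)])
qed

lemma Cdiff_has_frechet_derivative:
  assumes "Cdiff (Suc k) S f" "x \<in> S"
  shows "(f has_derivative frechet_derivative f (at x within S)) (at x within S)"
  using assms by (metis Cdiff_SucE differentiableI frechet_derivative_works)

lemma Ck_on_imp_Cdiff: "Ck_on k S f \<Longrightarrow> Cdiff k S f"
proof (induction k arbitrary: f)
  case (Suc k)
  then show ?case
    by (intro Cdiff_SucI[of _ _ "\<lambda>x. frechet_derivative f (at x within S)"])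
      (auto simp: differentiable_on_def frechet_derivative_works)
qed simp

lemma Cdiff_imp_Ck_on:
  fixes f :: "'a::euclidean_space \<Rightarrow> 'b::real_normed_vector"
  assumes S: "convex S" "interior S \<noteq> {}" and "Cdiff k S f"
  shows "Ck_on k S f"
  using assms(3)
proof (induction k arbitrary: f)
  case (Suc k)
  obtain f' where f': "\<And>x. x \<in> S \<Longrightarrow> (f has_derivative f' x) (at x within S)" "\<And>v. Cdiff k S (\<lambda>x. f' x v)"
    using Cdiff_SucE Suc.prems by blast
  have "Ck_on k S (\<lambda>x. frechet_derivative f (at x within S) v)" for v
    by (rule Ck_on_cong[THEN iffD1, OF _ Suc.IH[OF f'(2)[of v]]])
      (simp add: frechet_derivative_within_convex[OF S f'(1)])
  then show ?case using f'(1) by (auto simp: differentiable_on_def differentiable_def)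
qed simp

lemma smooth_on_iff_Cdiff:
  fixes f :: "'a::euclidean_space \<Rightarrow> 'b::real_normed_vector"
  assumes S: "convex S" "interior S \<noteq> {}"
  shows "smooth_on S f \<longleftrightarrow> (\<forall>k. Cdiff k S f)"
  unfolding smooth_on_def by (blast intro: Cdiff_imp_Ck_on[OF S] Ck_on_imp_Cdiff)

lemma Cdiff_has_derivative:
  assumes f: "\<And>x. x \<in> S \<Longrightarrow> (f has_derivative f' x) (at x within S)" "\<And>k v. Cdiff k S (\<lambda>x. f' x v)"
  shows "Cdiff k S f"
  using Cdiff_Suc_imp[OF Cdiff_SucI[OF f]] by blast

text \<open>Derivatives are unique here, so a given one coincides with the witness in \<open>Cdiff\<close>.\<close>

lemma Cdiff_derivative:
  fixes f :: "'a::euclidean_space \<Rightarrow> 'b::real_normed_vector"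
  assumes S: "convex S" "interior S \<noteq> {}" and "Cdiff (Suc k) S f"
    and f': "\<And>x. x \<in> S \<Longrightarrow> (f has_derivative f' x) (at x within S)"
  shows "Cdiff k S (\<lambda>x. f' x v)"
proof -
  obtain g' where g': "\<And>x. x \<in> S \<Longrightarrow> (f has_derivative g' x) (at x within S)" "\<And>v. Cdiff k S (\<lambda>x. g' x v)"
    using Cdiff_SucE assms(3) by blast
  have "g' x = f' x" if "x \<in> S" for x
    using has_derivative_unique_within_convex[OF S that] f' g' that by blast
  then show ?thesis using Cdiff_cong[OF _ g'(2)[of v]] by auto
qed

text \<open>
  Smoothness is local; this is how a map that is the identity near the boundary of the disk is extended
  to the plane.
\<close>

lemma Cdiff_Un_open:
  fixes f :: "'a::euclidean_space \<Rightarrow> 'b::real_normed_vector"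
  assumes "open S" "open T" "Cdiff k S f" "Cdiff k T f"
  shows "Cdiff k (S \<union> T) f"
  using assms(3,4)
proof (induction k arbitrary: f)
  case 0
  then show ?case using continuous_on_open_Un[OF assms(1,2)] by auto
next
  case (Suc k)
  obtain f' where f': "\<And>x. x \<in> S \<Longrightarrow> (f has_derivative f' x) (at x within S)" "\<And>v. Cdiff k S (\<lambda>x. f' x v)"
    using Cdiff_SucE Suc.prems by blast
  obtain g' where g': "\<And>x. x \<in> T \<Longrightarrow> (f has_derivative g' x) (at x within T)" "\<And>v. Cdiff k T (\<lambda>x. g' x v)"
    using Cdiff_SucE Suc.prems by blast
  have at: "(f has_derivative f' x) (at x)" if "x \<in> S" for x
    using f'(1)[OF that] at_within_open[OF that assms(1)] by simp
  have at': "(f has_derivative g' x) (at x)" if "x \<in> T" for x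
    using g'(1)[OF that] at_within_open[OF that assms(2)] by simp
  define h' where "h' x = (if x \<in> S then f' x else g' x)" for x
  \<comment> \<open>On the overlap the two witnesses agree, because derivatives on open sets are unique.\<close>
  have h'_T: "h' x = g' x" if "x \<in> T" for x
  proof (cases "x \<in> S")
    case True
    then show ?thesis using has_derivative_unique[OF at[OF True] at'[OF that]] by (simp add: h'_def)
  qed (simp add: h'_def)
  have h'_S: "h' x = f' x" if "x \<in> S" for x using that by (simp add: h'_def)
  show ?case
  proof (rule Cdiff_SucI[of _ _ h'])
    show "(f has_derivative h' x) (at x within S \<union> T)" if "x \<in> S \<union> T" for x
      using at[of x] at'[of x] that by (auto simp: h'_def intro: has_derivative_at_withinI)
    show "Cdiff k (S \<union> T) (\<lambda>x. h' x v)" for v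
      by (rule Suc.IH; rule Cdiff_cong[OF _ f'(2)[of v]] Cdiff_cong[OF _ g'(2)[of v]])
        (simp_all add: h'_S h'_T)
  qed
qed

section \<open>Continuously differentiable functions on compact sets\<close>

lemma continuous_on_blinfun_of_components:
  fixes f' :: "'p::t2_space \<Rightarrow> 'a::euclidean_space \<Rightarrow> 'b::real_normed_vector"
  assumes "\<And>x. x \<in> S \<Longrightarrow> bounded_linear (f' x)" "\<And>v. continuous_on S (\<lambda>x. f' x v)"
  shows "continuous_on S (\<lambda>x. Blinfun (f' x))"
proof (rule continuous_on_blinfun_componentwise)
  fix i
  show "continuous_on S (\<lambda>x. blinfun_apply (Blinfun (f' x)) i)"
    by (rule continuous_on_eq[OF assms(2)[of i]]) (simp add: bounded_linear_Blinfun_apply[OF assms(1)])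
qed

lemma bounded_components_compact:
  fixes f' :: "'p::t2_space \<Rightarrow> 'a::euclidean_space \<Rightarrow> 'b::real_normed_vector"
  assumes "compact S" "\<And>x. x \<in> S \<Longrightarrow> bounded_linear (f' x)" "\<And>v. continuous_on S (\<lambda>x. f' x v)"
  obtains K where "K \<ge> 0" "\<And>x v. x \<in> S \<Longrightarrow> norm (f' x v) \<le> K * norm v"
proof -
  have "bounded ((\<lambda>x. Blinfun (f' x)) ` S)"
    by (intro compact_imp_bounded compact_continuous_image continuous_on_blinfun_of_components assms)
  then obtain K where K: "\<And>x. x \<in> S \<Longrightarrow> norm (Blinfun (f' x)) \<le> K"
    by (auto simp: bounded_iff)
  show ?thesis
  proof
    show "max K 0 \<ge> 0" by simp
    fix x v assume x: "x \<in> S"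
    have "norm (f' x v) = norm (blinfun_apply (Blinfun (f' x)) v)"
      by (simp add: bounded_linear_Blinfun_apply[OF assms(2)[OF x]])
    also have "\<dots> \<le> norm (Blinfun (f' x)) * norm v" by (rule norm_blinfun)
    also have "\<dots> \<le> max K 0 * norm v" using K[OF x] by (intro mult_right_mono) auto
    finally show "norm (f' x v) \<le> max K 0 * norm v" .
  qed
qed

text \<open>
  The linearization error is uniform in the base point: the derivative is uniformly continuous in
  the operator norm, and the mean value inequality applies on segments.
\<close>

lemma C1_compact_linearization:
  fixes f :: "'a::euclidean_space \<Rightarrow> 'b::real_normed_vector"
  assumes S: "compact S" "convex S"
    and f': "\<And>x. x \<in> S \<Longrightarrow> (f has_derivative f' x) (at x within S)"
    and cont: "\<And>v. continuous_on S (\<lambda>x. f' x v)"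
    and e: "e > 0"
  obtains d where "d > 0"
    "\<And>x y. x \<in> S \<Longrightarrow> y \<in> S \<Longrightarrow> norm (y - x) < d \<Longrightarrow> norm (f y - f x - f' x (y - x)) \<le> e * norm (y - x)"
proof -
  have bl: "bounded_linear (f' x)" if "x \<in> S" for x
    using f'[OF that] has_derivative_bounded_linear by blast
  have "uniformly_continuous_on S (\<lambda>x. Blinfun (f' x))"
    by (intro compact_uniformly_continuous continuous_on_blinfun_of_components bl cont S)
  then obtain d where d: "d > 0"
    "\<And>x y. x \<in> S \<Longrightarrow> y \<in> S \<Longrightarrow> dist y x < d \<Longrightarrow> dist (Blinfun (f' y)) (Blinfun (f' x)) < e"
    using e unfolding uniformly_continuous_on_def by blast
  show ?thesis
  proof (rule that[OF d(1)])
    fix x y assume x: "x \<in> S" and y: "y \<in> S" and xy: "norm (y - x) < d"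
    let ?S = "S \<inter> ball x d"
    have "norm (f y - f x - f' x (y - x)) \<le> norm (y - x) * e"
    proof (rule differentiable_bound_linearization[where S = ?S])
      fix t :: real assume t: "t \<in> {0..1}"
      have "x \<in> ?S" "y \<in> ?S" using x y xy d(1) by (auto simp: dist_norm norm_minus_commute)
      moreover have "convex ?S" using S(2) by (simp add: convex_Int)
      ultimately have "(1 - t) *\<^sub>R x + t *\<^sub>R y \<in> ?S" using t convexD_alt by fastforce
      then show "x + t *\<^sub>R (y - x) \<in> ?S" by (simp add: algebra_simps)
    next
      fix z assume z: "z \<in> ?S"
      show "(f has_derivative f' z) (at z within ?S)"
        using f' z by (auto intro: has_derivative_subset)
      have "norm (f' z v - f' x v) \<le> e * norm v" for v
      proof -
        have "norm (f' z v - f' x v) = norm (blinfun_apply (Blinfun (f' z) - Blinfun (f' x)) v)"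
          using z by (simp add: bounded_linear_Blinfun_apply[OF bl] bounded_linear_Blinfun_apply[OF bl[OF x]] blinfun.diff_left)
        also have "\<dots> \<le> norm (Blinfun (f' z) - Blinfun (f' x)) * norm v" by (rule norm_blinfun)
        also have "\<dots> \<le> e * norm v"
          using d(2)[OF x, of z] z by (intro mult_right_mono) (auto simp: dist_norm norm_minus_commute)
        finally show ?thesis .
      qed
      then show "onorm (f' z - f' x) \<le> e"
        by (intro onorm_bound) (use e in auto)
    qed (use x d(1) in auto)
    then show "norm (f y - f x - f' x (y - x)) \<le> e * norm (y - x)" by (simp add: mult.commute)
  qed
qed

lemma C1_compact_Lipschitz:
  fixes f :: "'a::euclidean_space \<Rightarrow> 'b::real_normed_vector"
  assumes S: "compact S" "convex S"
    and f': "\<And>x. x \<in> S \<Longrightarrow> (f has_derivative f' x) (at x within S)"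
    and cont: "\<And>v. continuous_on S (\<lambda>x. f' x v)"
  obtains K where "K \<ge> 0" "\<And>x y. x \<in> S \<Longrightarrow> y \<in> S \<Longrightarrow> norm (f y - f x) \<le> K * norm (y - x)"
proof -
  obtain K where K: "K \<ge> 0" "\<And>x v. x \<in> S \<Longrightarrow> norm (f' x v) \<le> K * norm v"
    using bounded_components_compact[OF S(1) has_derivative_bounded_linear[OF f'] cont] by blast
  have "onorm (f' x) \<le> K" if "x \<in> S" for x
    using K that by (intro onorm_bound) auto
  then show ?thesis
    using that[OF K(1)] differentiable_bound[OF S(2) f'] by blast
qed

text \<open>
  The Leibniz rule with the derivative of the integrand given direction by direction, the form in which
  it is supplied by \<open>Cdiff\<close>.
\<close>

lemma has_derivative_integral_param:
  fixes f :: "'a::euclidean_space \<Rightarrow> real \<Rightarrow> 'c::banach"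
  assumes U: "convex U" "x0 \<in> U"
    and f': "\<And>x t. x \<in> U \<Longrightarrow> t \<in> {0..1} \<Longrightarrow> ((\<lambda>x. f x t) has_derivative f' x t) (at x within U)"
    and int: "\<And>x. x \<in> U \<Longrightarrow> continuous_on {0..1} (f x)"
    and cont: "\<And>v. continuous_on (U \<times> {0..1}) (\<lambda>(x, t). f' x t v)"
  shows "((\<lambda>x. integral {0..1} (f x)) has_derivative (\<lambda>v. integral {0..1} (\<lambda>t. f' x0 t v))) (at x0 within U)"
proof -
  have bl: "bounded_linear (f' x t)" if "x \<in> U" "t \<in> {0..1}" for x t
    using f'[OF that] has_derivative_bounded_linear by blast
  have c: "continuous_on (U \<times> {0..1}) (\<lambda>p. Blinfun (f' (fst p) (snd p)))"
    using cont by (intro continuous_on_blinfun_of_components bl) (auto simp: case_prod_unfold)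
  have c0: "continuous_on {0..1} (\<lambda>t. Blinfun (f' x0 t))"
  proof -
    have "continuous_on {0..1} (\<lambda>t::real. (x0, t))" by (intro continuous_intros)
    then show ?thesis using continuous_on_compose2[OF c, of "{0..1}" "\<lambda>t. (x0, t)"] U(2) by auto
  qed
  have "((\<lambda>x. integral (cbox 0 1) (f x)) has_derivative integral (cbox 0 1) (\<lambda>t. Blinfun (f' x0 t))) (at x0 within U)"
  proof (rule leibniz_rule[where fx = "\<lambda>x t. Blinfun (f' x t)"])
    fix x t assume "x \<in> U" "t \<in> cbox (0::real) 1"
    then show "((\<lambda>x. f x t) has_derivative blinfun_apply (Blinfun (f' x t))) (at x within U)"
      using f' bounded_linear_Blinfun_apply[OF bl] by simp
  next
    show "f x integrable_on cbox 0 1" if "x \<in> U" for x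
      using integrable_continuous_real[OF int[OF that]] by simp
    show "continuous_on (U \<times> cbox 0 1) (\<lambda>(x, t). Blinfun (f' x t))"
      using c by (simp add: case_prod_unfold)
  qed (use U in auto)
  moreover have *: "blinfun_apply (integral (cbox 0 1) (\<lambda>t. Blinfun (f' x0 t))) v = integral {0..1} (\<lambda>t. f' x0 t v)" for v
  proof -
    have "blinfun_apply (integral (cbox 0 1) (\<lambda>t. Blinfun (f' x0 t))) v = integral {0..1} (\<lambda>t. blinfun_apply (Blinfun (f' x0 t)) v)"
      using blinfun_apply_integral[OF integrable_continuous_real[OF c0]] by (simp add: cbox_interval)
    also have "\<dots> = integral {0..1} (\<lambda>t. f' x0 t v)"
      by (intro integral_cong) (simp add: bounded_linear_Blinfun_apply[OF bl[OF U(2)]])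
    finally show ?thesis .
  qed
  moreover have "blinfun_apply (integral (cbox 0 1) (\<lambda>t. Blinfun (f' x0 t))) = (\<lambda>v. integral {0..1} (\<lambda>t. f' x0 t v))"
    by (rule ext) (rule *)
  ultimately show ?thesis by (simp add: cbox_interval)
qed

section \<open>Ordinary differential equations depending on a parameter\<close>

text \<open>
  The square of the norm is differentiable where the norm itself is not: with \<open>L = 2K + 1\<close> the
  function \<open>(|u|\<^sup>2 + e\<^sup>2) exp (- L t)\<close> is non-increasing, because \<open>2 u \<bullet> u' \<le> 2K |u|\<^sup>2 + 2 e |u|\<close> and
  \<open>2 e |u| \<le> |u|\<^sup>2 + e\<^sup>2\<close>.
\<close>

lemma gronwall:
  fixes u :: "real \<Rightarrow> 'b::real_inner"
  assumes der: "\<And>t. t \<in> {0..1} \<Longrightarrow> (u has_vector_derivative u' t) (at t within {0..1})"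
    and bound: "\<And>t. t \<in> {0..1} \<Longrightarrow> norm (u' t) \<le> K * norm (u t) + e"
    and "K \<ge> 0" "e \<ge> 0" "norm (u 0) \<le> c" "t \<in> {0..1}"
  shows "norm (u t) \<le> (c + e) * exp (K + 1)"
proof -
  define L where "L = 2 * K + 1"
  define h where "h s = (u s \<bullet> u s + e\<^sup>2) * exp (- L * s)" for s
  have L: "L \<ge> 1" using assms(3) by (simp add: L_def)
  have cont: "continuous_on {0..1} u"
    using der by (intro continuous_on_vector_derivative)
  have "h 0 \<ge> h t"
  proof (rule DERIV_nonpos_imp_decreasing_open[where f = h and a = 0 and b = t])
    fix s assume s: "0 < s" "s < t"
    have s': "s \<in> {0..1}" using s assms(6) by auto
    have d: "(u has_vector_derivative u' s) (at s)"
      using der[OF s'] at_within_Icc_at[of 0 s 1] s assms(6) by simp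
    have "((\<lambda>s. u s \<bullet> u s) has_vector_derivative u s \<bullet> u' s + u' s \<bullet> u s) (at s)"
      by (rule bounded_bilinear.has_vector_derivative[OF bounded_bilinear_inner d d])
    then have "((\<lambda>s. u s \<bullet> u s) has_real_derivative 2 * (u s \<bullet> u' s)) (at s)"
      by (simp add: has_real_derivative_iff_has_vector_derivative inner_commute)
    then have "(h has_real_derivative (2 * (u s \<bullet> u' s) - L * (u s \<bullet> u s + e\<^sup>2)) * exp (- L * s)) (at s)"
      unfolding h_def by (auto intro!: derivative_eq_intros simp: algebra_simps)
    moreover have "2 * (u s \<bullet> u' s) \<le> L * (u s \<bullet> u s + e\<^sup>2)"
    proof -
      have "u s \<bullet> u' s \<le> norm (u s) * norm (u' s)" by (rule norm_cauchy_schwarz)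
      also have "\<dots> \<le> norm (u s) * (K * norm (u s) + e)"
        using bound[OF s'] by (intro mult_left_mono) auto
      finally have "2 * (u s \<bullet> u' s) \<le> 2 * K * (norm (u s))\<^sup>2 + 2 * (norm (u s) * e)"
        by (simp add: algebra_simps power2_eq_square)
      also have "2 * (norm (u s) * e) \<le> (norm (u s))\<^sup>2 + e\<^sup>2"
        using sum_squares_bound[of "norm (u s)" e] by simp
      also have "2 * K * (norm (u s))\<^sup>2 + ((norm (u s))\<^sup>2 + e\<^sup>2) \<le> L * (norm (u s))\<^sup>2 + L * e\<^sup>2"
        using mult_right_mono[OF L, of "e\<^sup>2"] by (simp add: L_def algebra_simps)
      finally show ?thesis by (simp add: power2_norm_eq_inner algebra_simps)
    qed
    ultimately show "\<exists>y. (h has_real_derivative y) (at s) \<and> y \<le> 0"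
      by (intro exI conjI) (auto simp: mult_nonpos_nonneg)
  next
    show "continuous_on {0..t} h"
      unfolding h_def using continuous_on_subset[OF cont, of "{0..t}"] assms(6)
      by (auto intro!: continuous_intros)
  qed (use assms(6) in auto)
  then have "u t \<bullet> u t + e\<^sup>2 \<le> (u 0 \<bullet> u 0 + e\<^sup>2) * exp (L * t)"
    by (simp add: h_def exp_minus field_simps)
  also have "\<dots> \<le> (c + e)\<^sup>2 * (exp (K + 1))\<^sup>2"
  proof (intro mult_mono)
    have c: "c \<ge> 0" using order_trans[OF norm_ge_zero assms(5)] .
    have "u 0 \<bullet> u 0 \<le> c\<^sup>2" using assms(5) by (simp add: power_mono flip: power2_norm_eq_inner)
    also have "c\<^sup>2 + e\<^sup>2 \<le> (c + e)\<^sup>2" using c assms(4) by (simp add: power2_sum)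
    finally show "u 0 \<bullet> u 0 + e\<^sup>2 \<le> (c + e)\<^sup>2" by simp
    have "L * t \<le> L * 1" using L assms(6) by (intro mult_left_mono) auto
    then have "L * t \<le> 2 * (K + 1)" by (simp add: L_def)
    then show "exp (L * t) \<le> (exp (K + 1))\<^sup>2" by (simp flip: exp_double)
  qed auto
  finally have "u t \<bullet> u t + e\<^sup>2 \<le> ((c + e) * exp (K + 1))\<^sup>2"
    unfolding power_mult_distrib .
  moreover have "(norm (u t))\<^sup>2 \<le> u t \<bullet> u t + e\<^sup>2" by (simp add: power2_norm_eq_inner)
  ultimately have "(norm (u t))\<^sup>2 \<le> ((c + e) * exp (K + 1))\<^sup>2" by linarith
  moreover have "c \<ge> 0" using order_trans[OF norm_ge_zero assms(5)] .
  ultimately show ?thesis using assms(4) by (auto intro!: power2_le_imp_le[of "norm (u t)"])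
qed

text \<open>
  Picard iteration: the \<open>n\<close>-th increment is at most \<open>C K\<^sup>n t\<^sup>n / n!\<close>, which is summable, so the
  iteration converges uniformly on the whole interval to a solution of the integral equation.
\<close>

lemma linear_ode_exists:
  fixes A :: "real \<Rightarrow> 'b::euclidean_space \<Rightarrow> 'b"
  assumes lin: "\<And>t. t \<in> {0..1} \<Longrightarrow> linear (A t)"
    and A: "\<And>v. continuous_on {0..1} (\<lambda>t. A t v)" and b: "continuous_on {0..1} b"
  obtains m where "m 0 = m0"
    "\<And>t. t \<in> {0..1} \<Longrightarrow> (m has_vector_derivative A t (m t) + b t) (at t within {0..1})"
proof -
  let ?I = "{0..1::real}"
  obtain K where K: "K \<ge> 0" "\<And>t v. t \<in> ?I \<Longrightarrow> norm (A t v) \<le> K * norm v"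
    using bounded_components_compact[of ?I A] lin A by (auto simp: linear_conv_bounded_linear)
  define F where "F w s = A s (w s) + b s" for w s
  define J where "J w t = m0 + integral {0..t} (F w)" for w t
  have F: "continuous_on ?I (F w)" if "continuous_on ?I w" for w
    unfolding F_def using Cdiff_linear_application[of ?I A 0 w] lin A b that
    by (auto intro!: continuous_intros)
  have F': "F w integrable_on {0..t}" if "continuous_on ?I w" "t \<in> ?I" for w t
    using that by (intro integrable_continuous_real continuous_on_subset[OF F]) auto
  have J': "(J w has_vector_derivative F w t) (at t within ?I)" if "continuous_on ?I w" "t \<in> ?I" for w t
    unfolding J_def using integral_has_vector_derivative[OF F[OF that(1)] that(2)]
    by (auto intro!: derivative_eq_intros)
  have J: "continuous_on ?I (J w)" if "continuous_on ?I w" for w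
    using J'[OF that] by (rule continuous_on_vector_derivative)
  have contract: "norm (J w t - J w' t) \<le> integral {0..t} (\<lambda>s. K * g s)"
    if w: "continuous_on ?I w" "continuous_on ?I w'" and t: "t \<in> ?I" and g: "continuous_on ?I g"
      and le: "\<And>s. s \<in> ?I \<Longrightarrow> norm (w s - w' s) \<le> g s" for w w' g t
  proof -
    have "J w t - J w' t = integral {0..t} (\<lambda>s. F w s - F w' s)"
      using Henstock_Kurzweil_Integration.integral_diff[OF F'[OF w(1) t] F'[OF w(2) t]] by (simp add: J_def)
    also have "norm \<dots> \<le> integral {0..t} (\<lambda>s. K * g s)"
    proof (rule integral_norm_bound_integral)
      show "(\<lambda>s. F w s - F w' s) integrable_on {0..t}"
        using F' w t by (intro integrable_diff) auto
      show "(\<lambda>s. K * g s) integrable_on {0..t}"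
        using t g by (intro integrable_continuous_real continuous_intros) (auto intro: continuous_on_subset)
      fix s assume "s \<in> {0..t}"
      then have s: "s \<in> ?I" using t by auto
      have "F w s - F w' s = A s (w s - w' s)" by (simp add: F_def linear_diff[OF lin[OF s]])
      then show "norm (F w s - F w' s) \<le> K * g s"
        using K(2)[OF s, of "w s - w' s"] mult_left_mono[OF le[OF s] K(1)] by simp
    qed
    finally show ?thesis .
  qed
  define w where "w n = (J ^^ n) (\<lambda>t. m0)" for n
  have w_Suc: "w (Suc n) = J (w n)" for n by (simp add: w_def)
  have w_cont: "continuous_on ?I (w n)" for n
    by (induction n) (auto simp: w_Suc J, simp add: w_def)
  obtain C where C: "\<And>t. t \<in> ?I \<Longrightarrow> norm (w 1 t - w 0 t) \<le> C"
  proof -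
    have "bounded ((\<lambda>t. w 1 t - w 0 t) ` ?I)"
      by (intro compact_imp_bounded compact_continuous_image continuous_intros w_cont) auto
    then obtain a where "\<forall>t\<in>?I. norm (w 1 t - w 0 t) \<le> a" by (auto simp: bounded_iff)
    then show ?thesis using that by blast
  qed
  have step: "norm (w (Suc n) t - w n t) \<le> C * (K ^ n * t ^ n / fact n)" if "t \<in> ?I" for n t
    using that
  proof (induction n arbitrary: t)
    case 0
    then show ?case using C by simp
  next
    case (Suc n)
    have le: "norm (w (Suc (Suc n)) t - w (Suc n) t) \<le> integral {0..t} (\<lambda>s. K * (C * (K ^ n * s ^ n / fact n)))"
      unfolding w_Suc[of "Suc n"] w_Suc[of n]
      by (rule contract) (use w_cont J Suc in \<open>auto simp flip: w_Suc intro!: continuous_intros\<close>)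
    have "((\<lambda>s. K * (C * (K ^ n * s ^ n / fact n))) has_integral
        C * (K ^ Suc n * t ^ Suc n / fact (Suc n)) - C * (K ^ Suc n * 0 ^ Suc n / fact (Suc n))) {0..t}"
    proof (rule fundamental_theorem_of_calculus)
      show "0 \<le> t" using Suc.prems by auto
      fix s
      have "((\<lambda>s. C * (K ^ Suc n * s ^ Suc n / fact (Suc n))) has_real_derivative
          C * (K ^ Suc n * (real (Suc n) * s ^ n) / fact (Suc n))) (at s within {0..t})"
        by (rule derivative_eq_intros refl | simp)+
      also have "C * (K ^ Suc n * (real (Suc n) * s ^ n) / fact (Suc n)) = K * (C * (K ^ n * s ^ n / fact n))"
        by (simp add: fact_Suc field_simps del: of_nat_Suc)
      finally show "((\<lambda>s. C * (K ^ Suc n * s ^ Suc n / fact (Suc n))) has_vector_derivative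
          K * (C * (K ^ n * s ^ n / fact n))) (at s within {0..t})"
        by (simp add: has_real_derivative_iff_has_vector_derivative)
    qed
    from integral_unique[OF this]
    have eq: "integral {0..t} (\<lambda>s. K * (C * (K ^ n * s ^ n / fact n))) = C * (K ^ Suc n * t ^ Suc n / fact (Suc n))"
      by (rule trans) (simp only: power_0_Suc mult_zero_right mult_zero_left div_0 diff_zero)
    show ?case using le unfolding eq .
  qed
  have C0: "C \<ge> 0" using order_trans[OF norm_ge_zero C[of 0]] by simp
  define m where "m t = m0 + (\<Sum>n. w (Suc n) t - w n t)" for t
  have "uniform_limit ?I (\<lambda>n t. \<Sum>i<n. w (Suc i) t - w i t) (\<lambda>t. \<Sum>n. w (Suc n) t - w n t) sequentially"
  proof (rule Weierstrass_m_test)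
    show "norm (w (Suc n) t - w n t) \<le> C * (inverse (fact n) * K ^ n)" if "t \<in> ?I" for n t
    proof -
      have "t ^ n \<le> 1" using that by (simp add: power_le_one)
      then have "K ^ n * t ^ n / fact n \<le> inverse (fact n) * K ^ n"
        using K(1) mult_left_mono[of "t ^ n" 1 "K ^ n"] by (simp add: field_simps)
      then show ?thesis using step[OF that, of n] mult_left_mono[OF _ C0] order_trans by blast
    qed
    show "summable (\<lambda>n. C * (inverse (fact n) * K ^ n))"
      by (intro summable_mult summable_exp)
  qed
  then have "uniform_limit ?I (\<lambda>n t. m0 + (\<Sum>i<n. w (Suc i) t - w i t)) m sequentially"
    unfolding m_def by (intro uniform_limit_intros)
  moreover have "m0 + (\<Sum>i<n. w (Suc i) t - w i t) = w n t" for n t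
    by (subst sum_lessThan_telescope) (simp add: w_def)
  ultimately have lim: "uniform_limit ?I w m sequentially" by simp
  have m: "continuous_on ?I m"
    by (rule uniform_limit_theorem[OF _ lim]) (simp_all add: w_cont)
  have m_eq: "m t = J m t" if t: "t \<in> ?I" for t
  proof (rule LIMSEQ_unique)
    show "(\<lambda>n. w (Suc n) t) \<longlonglongrightarrow> m t"
      using tendsto_uniform_limitI[OF lim t] by (rule LIMSEQ_Suc)
    show "(\<lambda>n. w (Suc n) t) \<longlonglongrightarrow> J m t"
    proof (rule metric_LIMSEQ_I)
      fix r :: real assume r: "r > 0"
      then have "r / (K + 1) > 0" using K(1) by simp
      then obtain N where N: "\<And>n s. n \<ge> N \<Longrightarrow> s \<in> ?I \<Longrightarrow> dist (w n s) (m s) < r / (K + 1)"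
        using lim unfolding uniform_limit_sequentially_iff by blast
      have "dist (w (Suc n) t) (J m t) < r" if n: "n \<ge> N" for n
      proof -
        have "norm (J (w n) t - J m t) \<le> integral {0..t} (\<lambda>s. K * (r / (K + 1)))"
          using N[OF n] by (intro contract w_cont m t continuous_intros) (auto simp: dist_norm intro: less_imp_le)
        also have "\<dots> = t * (K * (r / (K + 1)))" using t by simp
        also have "\<dots> \<le> 1 * (K * (r / (K + 1)))" using t K(1) r by (intro mult_right_mono) auto
        also have "\<dots> < r" using r K(1) by (simp add: field_simps)
        finally show ?thesis by (simp add: w_Suc dist_norm)
      qed
      then show "\<exists>N. \<forall>n\<ge>N. dist (w (Suc n) t) (J m t) < r" by blast
    qed
  qed
  show ?thesis
  proof (rule that)
    show "m 0 = m0" using m_eq[of 0] by (simp add: J_def)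
    show "(m has_vector_derivative A t (m t) + b t) (at t within ?I)" if "t \<in> ?I" for t
      using has_vector_derivative_transform[OF that _ J'[OF m that]] m_eq by (simp add: F_def)
  qed
qed

text \<open>
  The difference of the solutions with parameters \<open>z\<close> and \<open>z0\<close> satisfies the Gronwall inequality, with
  an inhomogeneity that is small by uniform continuity of \<open>f\<close>.
\<close>

lemma ode_continuous_dependence:
  fixes f :: "real \<times> 'a::euclidean_space \<times> 'b::euclidean_space \<Rightarrow> 'b"
  assumes S: "compact S" and B: "compact B"
    and f: "continuous_on ({0..1} \<times> S \<times> B) f"
    and Lip: "\<And>t z x y. t \<in> {0..1} \<Longrightarrow> z \<in> S \<Longrightarrow> x \<in> B \<Longrightarrow> y \<in> B \<Longrightarrow>
      norm (f (t, z, y) - f (t, z, x)) \<le> K * norm (y - x)" and K: "K \<ge> 0"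
    and uB: "\<And>t z. t \<in> {0..1} \<Longrightarrow> z \<in> S \<Longrightarrow> u (t, z) \<in> B"
    and u: "\<And>t z. t \<in> {0..1} \<Longrightarrow> z \<in> S \<Longrightarrow>
      ((\<lambda>s. u (s, z)) has_vector_derivative f (t, z, u (t, z))) (at t within {0..1})"
    and u0: "continuous_on S (\<lambda>z. u (0, z))"
  shows "continuous_on ({0..1} \<times> S) u"
proof -
  have unif: "uniformly_continuous_on ({0..1} \<times> S \<times> B) f"
    by (intro compact_uniformly_continuous f compact_Times S B compact_Icc)
  have "\<exists>d>0. \<forall>q\<in>{0..1} \<times> S. dist q (t0, z0) < d \<longrightarrow> dist (u q) (u (t0, z0)) < e"
    if t0: "t0 \<in> {0..1}" and z0: "z0 \<in> S" and e: "e > 0" for t0 z0 e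
  proof -
    \<comment> \<open>chosen so that the Gronwall bound with initial error and inhomogeneity \<open>\<eta>\<close> is \<open>e / 2\<close>\<close>
    define \<eta> where "\<eta> = e / (4 * exp (K + 1))"
    have \<eta>: "\<eta> > 0" "(\<eta> + \<eta>) * exp (K + 1) = e / 2" using e by (simp_all add: \<eta>_def)
    obtain d1 where d1: "d1 > 0" "\<And>p q. p \<in> {0..1} \<times> S \<times> B \<Longrightarrow> q \<in> {0..1} \<times> S \<times> B \<Longrightarrow> dist q p < d1 \<Longrightarrow> dist (f q) (f p) < \<eta>"
      using uniformly_continuous_onE[OF unif \<eta>(1)] by blast
    obtain d2 where d2: "d2 > 0" "\<And>z. z \<in> S \<Longrightarrow> dist z z0 < d2 \<Longrightarrow> dist (u (0, z)) (u (0, z0)) < \<eta>"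
      using u0 \<eta>(1) z0 unfolding continuous_on_iff by blast
    have "continuous_on {0..1} (\<lambda>s. u (s, z0))"
      using u[OF _ z0] by (rule continuous_on_vector_derivative)
    then obtain d3 where d3: "d3 > 0" "\<And>t. t \<in> {0..1} \<Longrightarrow> dist t t0 < d3 \<Longrightarrow> dist (u (t, z0)) (u (t0, z0)) < e / 2"
      unfolding continuous_on_iff using t0 half_gt_zero[OF e] by blast
    have "dist (u (t, z)) (u (t0, z0)) < e"
      if t: "t \<in> {0..1}" and z: "z \<in> S" and d: "dist (t, z) (t0, z0) < min d1 (min d2 d3)" for t z
    proof -
      have dz: "dist z z0 < d1" "dist z z0 < d2" and dt: "dist t t0 < d3"
        using d dist_snd_le[of "(t, z)" "(t0, z0)"] dist_fst_le[of "(t, z)" "(t0, z0)"] by auto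
      have "norm (u (t, z) - u (t, z0)) \<le> (\<eta> + \<eta>) * exp (K + 1)"
      proof (rule gronwall[where u = "\<lambda>s. u (s, z) - u (s, z0)"
            and u' = "\<lambda>s. f (s, z, u (s, z)) - f (s, z0, u (s, z0))"])
        fix s :: real assume s: "s \<in> {0..1}"
        show "((\<lambda>s. u (s, z) - u (s, z0)) has_vector_derivative f (s, z, u (s, z)) - f (s, z0, u (s, z0))) (at s within {0..1})"
          by (intro has_vector_derivative_diff u s z z0)
        have "dist (f (s, z, u (s, z0))) (f (s, z0, u (s, z0))) < \<eta>"
          by (rule d1(2)) (use s z z0 uB dz in \<open>auto simp: dist_Pair_Pair\<close>)
        moreover have "norm (f (s, z, u (s, z)) - f (s, z, u (s, z0))) \<le> K * norm (u (s, z) - u (s, z0))"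
          by (intro Lip uB s z z0)
        ultimately show "norm (f (s, z, u (s, z)) - f (s, z0, u (s, z0))) \<le> K * norm (u (s, z) - u (s, z0)) + \<eta>"
          using norm_triangle_ineq[of "f (s, z, u (s, z)) - f (s, z, u (s, z0))" "f (s, z, u (s, z0)) - f (s, z0, u (s, z0))"]
          by (simp add: dist_norm)
      qed (use K \<eta>(1) t d2(2)[OF z dz(2)] in \<open>auto simp: dist_norm\<close>)
      then show ?thesis
        using d3(2)[OF t dt] \<eta>(2) dist_triangle[of "u (t, z)" "u (t0, z0)" "u (t, z0)"]
        by (simp add: dist_norm)
    qed
    moreover have "min d1 (min d2 d3) > 0" using d1(1) d2(1) d3(1) by simp
    ultimately show ?thesis by (intro exI[of _ "min d1 (min d2 d3)"]) auto
  qed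
  then show ?thesis by (auto simp: continuous_on_iff)
qed

text \<open>
  The only candidate for the derivative of \<open>u\<close> with respect to the parameter is the solution \<open>m\<close> of the
  variational equation, obtained by differentiating the equation for \<open>u\<close>.  The error
  \<open>u (t, z') - u (t, z) - m (t, z) (z' - z)\<close> solves the homogeneous variational equation up to the
  linearization error of \<open>f\<close>, which is uniformly of smaller order than \<open>|z' - z|\<close> since \<open>u\<close> is
  Lipschitz in the parameter; the Gronwall inequality transfers this to the error.
\<close>

lemma ode_C1_dependence:
  fixes f :: "real \<times> 'a::euclidean_space \<times> 'b::euclidean_space \<Rightarrow> 'b"
  assumes S: "compact S" "convex S" and B: "compact B" "convex B"
    and f': "\<And>p. p \<in> {0..1} \<times> S \<times> B \<Longrightarrow> (f has_derivative f' p) (at p within {0..1} \<times> S \<times> B)"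
    and f'_cont: "\<And>v. continuous_on ({0..1} \<times> S \<times> B) (\<lambda>p. f' p v)"
    and uB: "\<And>t z. t \<in> {0..1} \<Longrightarrow> z \<in> S \<Longrightarrow> u (t, z) \<in> B"
    and u: "\<And>t z. t \<in> {0..1} \<Longrightarrow> z \<in> S \<Longrightarrow>
      ((\<lambda>s. u (s, z)) has_vector_derivative f (t, z, u (t, z))) (at t within {0..1})"
    and u0': "\<And>z. z \<in> S \<Longrightarrow> ((\<lambda>z. u (0, z)) has_derivative u0' z) (at z within S)"
    and u0'_cont: "\<And>v. continuous_on S (\<lambda>z. u0' z v)"
  obtains m where
    "\<And>z v. z \<in> S \<Longrightarrow> m (0, z) v = u0' z v"
    "\<And>t z v. t \<in> {0..1} \<Longrightarrow> z \<in> S \<Longrightarrow>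
      ((\<lambda>s. m (s, z) v) has_vector_derivative f' (t, z, u (t, z)) (0, v, m (t, z) v)) (at t within {0..1})"
    "\<And>v. continuous_on ({0..1} \<times> S) (\<lambda>p. m p v)"
    "\<And>t z. t \<in> {0..1} \<Longrightarrow> z \<in> S \<Longrightarrow>
      (u has_derivative (\<lambda>(\<tau>, v). \<tau> *\<^sub>R f (t, z, u (t, z)) + m (t, z) v)) (at (t, z) within {0..1} \<times> S)"
proof -
  let ?I = "{0..1::real}" and ?D = "{0..1::real} \<times> S \<times> B"
  have D: "compact ?D" "convex ?D" by (intro compact_Times convex_Times S B compact_Icc convex_real_interval)+
  have lin: "linear (f' p)" if "p \<in> ?D" for p
    using f'[OF that] by (rule has_derivative_linear)
  have lin0: "linear (u0' z)" if "z \<in> S" for z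
    using u0'[OF that] by (rule has_derivative_linear)
  have f_cont: "continuous_on ?D f"
    using f' by (rule has_derivative_continuous_on)
  obtain K where K: "K \<ge> 0" "\<And>p v. p \<in> ?D \<Longrightarrow> norm (f' p v) \<le> K * norm v"
    using bounded_components_compact[OF D(1) has_derivative_bounded_linear[OF f'] f'_cont] by blast
  have fLip: "norm (f q - f p) \<le> K * norm (q - p)" if "p \<in> ?D" "q \<in> ?D" for p q
    by (rule differentiable_bound[OF D(2) f' _ that(2,1)]) (use K in \<open>auto intro!: onorm_bound\<close>)
  have Lip: "norm (f (t, z', y) - f (t, z, x)) \<le> K * norm (y - x) + K * norm (z' - z)"
    if "t \<in> ?I" "z \<in> S" "z' \<in> S" "x \<in> B" "y \<in> B" for t z z' x y
  proof -
    have "norm (f (t, z', y) - f (t, z, x)) \<le> K * norm (0::real, z' - z, y - x)"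
      using fLip[of "(t, z, x)" "(t, z', y)"] that by simp
    also have "\<dots> \<le> K * (norm (z' - z) + norm (y - x))"
      using K(1) norm_Pair_le[of "z' - z" "y - x"] by (intro mult_left_mono) (auto simp: norm_Pair)
    finally show ?thesis by (simp add: algebra_simps)
  qed
  have u_cont: "continuous_on (?I \<times> S) u"
  proof (rule ode_continuous_dependence[OF S(1) B(1) f_cont _ K(1) uB u])
    show "norm (f (t, z, y) - f (t, z, x)) \<le> K * norm (y - x)"
      if "t \<in> ?I" "z \<in> S" "x \<in> B" "y \<in> B" for t z x y
      using Lip[of t z z x y] that by simp
    show "continuous_on S (\<lambda>z. u (0, z))"
      using u0' by (rule has_derivative_continuous_on)
  qed
  let ?P = "\<lambda>t z. (t, z, u (t, z))"
  have P: "?P t z \<in> ?D" if "t \<in> ?I" "z \<in> S" for t z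
    using that uB by auto
  have f'P_cont: "continuous_on (?I \<times> S) (\<lambda>p. f' (?P (fst p) (snd p)) v)" for v
    by (rule continuous_on_compose2[OF f'_cont])
      (auto intro!: continuous_intros u_cont uB)
  have f'P_cont': "continuous_on ?I (\<lambda>t. f' (?P t z) v)" if "z \<in> S" for z v
  proof -
    have "continuous_on ?I (\<lambda>t. (t, z))" by (intro continuous_intros)
    then show ?thesis using continuous_on_compose2[OF f'P_cont[of v], of ?I "\<lambda>t. (t, z)"] that by auto
  qed
  have linP: "f' (?P t z) (0, v, x) = f' (?P t z) (0, 0, x) + f' (?P t z) (0, v, 0)" if "t \<in> ?I" "z \<in> S" for t z v x
    using linear_add[OF lin[OF P[OF that]], of "(0, 0, x)" "(0, v, 0)"] by simp
  have ex: "\<exists>m. m 0 = u0' z b \<and> (\<forall>t\<in>?I. (m has_vector_derivative f' (?P t z) (0, b, m t)) (at t within ?I))"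
    if z: "z \<in> S" for z b
  proof -
    have "linear (\<lambda>x::'b. (0::real, 0::'a, x))" by (rule linearI) auto
    then have "linear (\<lambda>x. f' (?P t z) (0, 0, x))" if "t \<in> ?I" for t
      by (rule linear_compose[OF _ lin[OF P[OF that z]], unfolded o_def])
    then obtain m where m: "m 0 = u0' z b"
      "\<And>t. t \<in> ?I \<Longrightarrow> (m has_vector_derivative f' (?P t z) (0, 0, m t) + f' (?P t z) (0, b, 0)) (at t within ?I)"
      using linear_ode_exists[where A = "\<lambda>t x. f' (?P t z) (0, 0, x)" and b = "\<lambda>t. f' (?P t z) (0, b, 0)" and ?m0.0 = "u0' z b", OF _ f'P_cont'[OF z] f'P_cont'[OF z]]
      by metis
    show ?thesis
    proof (intro exI[of _ m] conjI ballI)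
      show "(m has_vector_derivative f' (?P t z) (0, b, m t)) (at t within ?I)" if "t \<in> ?I" for t
        using m(2)[OF that] unfolding linP[OF that z, of b "m t"] .
    qed (rule m(1))
  qed
  \<comment> \<open>Solving for basis directions only and extending linearly makes the derivative linear by construction.\<close>
  define \<mu> where "\<mu> z b = (SOME m. m 0 = u0' z b \<and>
    (\<forall>t\<in>?I. (m has_vector_derivative f' (?P t z) (0, b, m t)) (at t within ?I)))" for z b
  have \<mu>_spec: "\<mu> z b 0 = u0' z b \<and> (\<forall>t\<in>?I. (\<mu> z b has_vector_derivative f' (?P t z) (0, b, \<mu> z b t)) (at t within ?I))"
    if "z \<in> S" for z b
    unfolding \<mu>_def
    by (rule someI_ex[of "\<lambda>m. m 0 = u0' z b \<and> (\<forall>t\<in>?I. (m has_vector_derivative f' (?P t z) (0, b, m t)) (at t within ?I))", OF ex[OF that]])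
  have \<mu>0: "\<mu> z b 0 = u0' z b" if "z \<in> S" for z b
    using \<mu>_spec[OF that] by simp
  have \<mu>: "(\<mu> z b has_vector_derivative f' (?P t z) (0, b, \<mu> z b t)) (at t within ?I)" if "z \<in> S" "t \<in> ?I" for z b t
    using \<mu>_spec[OF that(1)] that(2) by simp
  define m where "m p v = (\<Sum>b\<in>Basis. (v \<bullet> b) *\<^sub>R \<mu> (snd p) b (fst p))" for p v
  have m0: "m (0, z) v = u0' z v" if "z \<in> S" for z v
    unfolding m_def using \<mu>0[OF that] linear_eq_sum_Basis[OF lin0[OF that], of v, symmetric] by simp
  have m': "((\<lambda>s. m (s, z) v) has_vector_derivative f' (?P t z) (0, v, m (t, z) v)) (at t within ?I)"
    if t: "t \<in> ?I" and z: "z \<in> S" for t z v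
  proof -
    let ?c = "\<lambda>b. (v \<bullet> b) *\<^sub>R (0::real, b, \<mu> z b t)"
    have "((\<lambda>s. m (s, z) v) has_vector_derivative (\<Sum>b\<in>Basis. (v \<bullet> b) *\<^sub>R f' (?P t z) (0, b, \<mu> z b t))) (at t within ?I)"
      unfolding m_def by (auto intro!: derivative_eq_intros \<mu>[OF z t])
    also have "(\<Sum>b\<in>Basis. (v \<bullet> b) *\<^sub>R f' (?P t z) (0, b, \<mu> z b t)) = f' (?P t z) (\<Sum>b\<in>Basis. ?c b)"
      by (simp add: linear_sum[OF lin[OF P[OF t z]]] linear_scale[OF lin[OF P[OF t z]]] del: scaleR_Pair)
    also have "(\<Sum>b\<in>Basis. ?c b) = (0, v, m (t, z) v)"
      by (simp add: m_def sum_prod[symmetric] prod_eq_iff fst_sum snd_sum euclidean_representation)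
    finally show ?thesis .
  qed
  have m_cont: "continuous_on (?I \<times> S) (\<lambda>p. m p v)" for v
  proof -
    obtain C where C: "\<And>z. z \<in> S \<Longrightarrow> norm (u0' z v) \<le> C"
    proof -
      have "bounded ((\<lambda>z. u0' z v) ` S)"
        by (intro compact_imp_bounded compact_continuous_image u0'_cont S)
      then obtain a where "\<forall>z\<in>S. norm (u0' z v) \<le> a" by (auto simp: bounded_iff)
      then show ?thesis using that by blast
    qed
    define R where "R = (C + K * norm v) * exp (K + 1)"
    have f'v: "norm (f' (?P t z) (0, v, x)) \<le> K * norm x + K * norm v" if "t \<in> ?I" "z \<in> S" for t z x
    proof -
      have "norm (f' (?P t z) (0, v, x)) \<le> K * norm (0::real, v, x)" by (rule K(2)[OF P[OF that]])
      also have "\<dots> \<le> K * (norm v + norm x)"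
        using K(1) norm_Pair_le[of v x] by (intro mult_left_mono) (auto simp: norm_Pair)
      finally show ?thesis by (simp add: algebra_simps)
    qed
    have mR: "m (t, z) v \<in> cball 0 R" if "t \<in> ?I" "z \<in> S" for t z
      unfolding R_def mem_cball_0
      by (rule gronwall[OF m'[OF _ that(2)] f'v[OF _ that(2)] K(1)])
        (use that K C m0 in auto)
    define f2 where "f2 p = f' (?P (fst p) (fst (snd p))) (0, v, snd (snd p))" for p
    have f2: "f2 (t, z, x) = f' (?P t z) (0, v, x)" for t z x by (simp add: f2_def)
    show ?thesis
    proof (rule ode_continuous_dependence[OF S(1) compact_cball[of 0 R], of f2 K])
      have "Cdiff 0 (?I \<times> S \<times> cball 0 R) f2"
        unfolding f2_def
      proof (rule Cdiff_linear_application[where A = "\<lambda>p. f' (?P (fst p) (fst (snd p)))"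
            and w = "\<lambda>p. (0, v, snd (snd p))"])
        show "linear (f' (?P (fst p) (fst (snd p))))" if "p \<in> ?I \<times> S \<times> cball 0 R" for p :: "real \<times> 'a \<times> 'b"
          using that by (intro lin P) auto
        show "Cdiff 0 (?I \<times> S \<times> cball 0 R) (\<lambda>p::real \<times> 'a \<times> 'b. f' (?P (fst p) (fst (snd p))) b)" for b
          unfolding Cdiff.simps
          by (rule continuous_on_compose2[OF f'P_cont[of b], of _ "\<lambda>p. (fst p, fst (snd p))", simplified])
            (auto intro!: continuous_intros)
      qed (auto intro!: continuous_intros)
      then show "continuous_on (?I \<times> S \<times> cball 0 R) f2" by simp
      show "norm (f2 (t, z, y) - f2 (t, z, x)) \<le> K * norm (y - x)" if "t \<in> ?I" "z \<in> S" for t z x y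
        using K(2)[OF P[OF that], of "(0, 0, y - x)"] linear_diff[OF lin[OF P[OF that]], of "(0, v, y)" "(0, v, x)"]
        by (simp add: f2 norm_Pair)
      show "continuous_on S (\<lambda>z. m (0, z) v)"
        by (rule continuous_on_eq[OF u0'_cont]) (simp add: m0)
    qed (use K mR m' in \<open>auto simp: f2\<close>)
  qed
  have m_lin: "linear (m p)" for p
    by (rule linearI) (simp_all add: m_def inner_add_left scaleR_add_left sum.distrib scaleR_sum_right)
  obtain K0 where K0: "K0 \<ge> 0" "\<And>x y. x \<in> S \<Longrightarrow> y \<in> S \<Longrightarrow> norm (u (0, y) - u (0, x)) \<le> K0 * norm (y - x)"
    using C1_compact_Lipschitz[OF S u0' u0'_cont] by blast
  define C where "C = (K0 + K) * exp (K + 1)"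
  have C0: "C \<ge> 0" using K0(1) K(1) by (simp add: C_def)
  have uLip: "norm (u (t, z') - u (t, z)) \<le> C * norm (z' - z)" if t: "t \<in> ?I" and z: "z \<in> S" "z' \<in> S" for t z z'
  proof -
    have "norm (u (t, z') - u (t, z)) \<le> (K0 * norm (z' - z) + K * norm (z' - z)) * exp (K + 1)"
      by (rule gronwall[where u = "\<lambda>s. u (s, z') - u (s, z)" and u' = "\<lambda>s. f (?P s z') - f (?P s z)"])
        (use t z K K0 uB in \<open>auto intro!: has_vector_derivative_diff u Lip\<close>)
    then show ?thesis by (simp add: C_def algebra_simps)
  qed
  have dz: "((\<lambda>z. u (t, z)) has_derivative m (t, z)) (at z within S)" if t: "t \<in> ?I" and z: "z \<in> S" for t z
    unfolding has_derivative_within_alt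
  proof (intro conjI allI impI)
    show "bounded_linear (m (t, z))" using m_lin by (simp add: linear_conv_bounded_linear)
    fix e :: real assume e: "e > 0"
    \<comment> \<open>The initial error contributes \<open>\<eta>\<close> and the linearization error \<open>\<eta> (1 + C)\<close>, where \<open>C\<close> is the
      Lipschitz constant of \<open>u\<close>; together with the Gronwall factor this makes \<open>e\<close>.\<close>
    define \<eta> where "\<eta> = e / ((2 + C) * exp (K + 1))"
    have \<eta>: "\<eta> > 0" using e C0 by (simp add: \<eta>_def)
    have \<eta>_eq: "(\<eta> * r + \<eta> * (1 + C) * r) * exp (K + 1) = e * r" for r
    proof -
      have "(\<eta> * r + \<eta> * (1 + C) * r) * exp (K + 1) = \<eta> * ((2 + C) * exp (K + 1)) * r"
        by (simp add: algebra_simps)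
      also have "\<eta> * ((2 + C) * exp (K + 1)) = e" using C0 by (simp add: \<eta>_def)
      finally show ?thesis .
    qed
    obtain d1 where d1: "d1 > 0" "\<And>p q. p \<in> ?D \<Longrightarrow> q \<in> ?D \<Longrightarrow> norm (q - p) < d1 \<Longrightarrow> norm (f q - f p - f' p (q - p)) \<le> \<eta> * norm (q - p)"
      using C1_compact_linearization[OF D f' f'_cont \<eta>] by blast
    obtain d2 where d2: "d2 > 0" "\<And>z'. z' \<in> S \<Longrightarrow> norm (z' - z) < d2 \<Longrightarrow> norm (u (0, z') - u (0, z) - u0' z (z' - z)) \<le> \<eta> * norm (z' - z)"
      using u0'[OF z] \<eta> unfolding has_derivative_within_alt by blast
    have "norm (u (t, z') - u (t, z) - m (t, z) (z' - z)) \<le> e * norm (z' - z)"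
      if z': "z' \<in> S" and d: "norm (z' - z) < min d2 (d1 / (1 + C))" for z'
    proof -
      let ?h = "z' - z"
      have q: "norm (?P s z' - ?P s z) \<le> (1 + C) * norm ?h" if "s \<in> ?I" for s
      proof -
        have "norm (?P s z' - ?P s z) \<le> norm ?h + norm (u (s, z') - u (s, z))"
          using norm_Pair_le[of ?h "u (s, z') - u (s, z)"] by (simp add: norm_Pair)
        then show ?thesis using uLip[OF that z z'] by (simp add: algebra_simps)
      qed
      have "norm (u (t, z') - u (t, z) - m (t, z) ?h) \<le> (\<eta> * norm ?h + \<eta> * (1 + C) * norm ?h) * exp (K + 1)"
      proof (rule gronwall[where u = "\<lambda>s. u (s, z') - u (s, z) - m (s, z) ?h"
            and u' = "\<lambda>s. f (?P s z') - f (?P s z) - f' (?P s z) (0, ?h, m (s, z) ?h)"])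
        fix s assume s: "s \<in> ?I"
        show "((\<lambda>s. u (s, z') - u (s, z) - m (s, z) ?h) has_vector_derivative
            f (?P s z') - f (?P s z) - f' (?P s z) (0, ?h, m (s, z) ?h)) (at s within ?I)"
          by (intro has_vector_derivative_diff u m' s z z')
        let ?w = "u (s, z') - u (s, z) - m (s, z) ?h"
        have "norm (?P s z' - ?P s z) < d1"
          using q[OF s] d C0 by (simp add: field_simps)
        then have "norm (f (?P s z') - f (?P s z) - f' (?P s z) (?P s z' - ?P s z)) \<le> \<eta> * norm (?P s z' - ?P s z)"
          by (intro d1(2) P s z z')
        also have "\<dots> \<le> \<eta> * ((1 + C) * norm ?h)"
          using q[OF s] \<eta> by (intro mult_left_mono) auto
        finally have 1: "norm (f (?P s z') - f (?P s z) - f' (?P s z) (?P s z' - ?P s z)) \<le> \<eta> * (1 + C) * norm ?h"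
          by (simp add: algebra_simps)
        have 2: "norm (f' (?P s z) (0, 0, ?w)) \<le> K * norm ?w"
          using K(2)[OF P[OF s z], of "(0, 0, ?w)"] by (simp add: norm_Pair)
        have "f' (?P s z) (0, 0, ?w) = f' (?P s z) (?P s z' - ?P s z) - f' (?P s z) (0, ?h, m (s, z) ?h)"
          using linear_diff[OF lin[OF P[OF s z]], of "?P s z' - ?P s z" "(0, ?h, m (s, z) ?h)"] by simp
        then have "f (?P s z') - f (?P s z) - f' (?P s z) (0, ?h, m (s, z) ?h) =
            f' (?P s z) (0, 0, ?w) + (f (?P s z') - f (?P s z) - f' (?P s z) (?P s z' - ?P s z))"
          by (simp only: algebra_simps)
        then show "norm (f (?P s z') - f (?P s z) - f' (?P s z) (0, ?h, m (s, z) ?h)) \<le> K * norm ?w + \<eta> * (1 + C) * norm ?h"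
          by (rule ssubst) (rule order_trans[OF norm_triangle_ineq add_mono[OF 2 1]])
      qed (use K(1) \<eta> C0 t d2(2)[OF z'] d m0[OF z] in auto)
      then show ?thesis by (simp only: \<eta>_eq)
    qed
    moreover have "min d2 (d1 / (1 + C)) > 0" using d1(1) d2(1) C0 by simp
    ultimately show "\<exists>d>0. \<forall>z'\<in>S. norm (z' - z) < d \<longrightarrow> norm (u (t, z') - u (t, z) - m (t, z) (z' - z)) \<le> e * norm (z' - z)"
      by (intro exI[of _ "min d2 (d1 / (1 + C))"]) auto
  qed
  have m_bl: "bounded_linear (m p)" for p using m_lin by (simp add: linear_conv_bounded_linear)
  have "(u has_derivative (\<lambda>(\<tau>, v). \<tau> *\<^sub>R f (?P t z) + m (t, z) v)) (at (t, z) within ?I \<times> S)"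
    if t: "t \<in> ?I" and z: "z \<in> S" for t z
  proof -
    have "continuous_on (?I \<times> S) (\<lambda>p. Blinfun (m p))"
      by (intro continuous_on_blinfun_of_components m_bl m_cont)
    then have "continuous (at (t, z) within ?I \<times> S) (\<lambda>(t, z). Blinfun (m (t, z)))"
      using t z by (auto simp: continuous_on_eq_continuous_within case_prod_unfold)
    then have "((\<lambda>(t, z). u (t, z)) has_derivative (\<lambda>(\<tau>, v). \<tau> *\<^sub>R f (?P t z) + blinfun_apply (Blinfun (m (t, z))) v)) (at (t, z) within ?I \<times> S)"
      using u[OF t z] z S(2) dz
      by (intro has_derivative_partialsI)
        (auto simp: has_vector_derivative_def bounded_linear_Blinfun_apply[OF m_bl])
    then show ?thesis by (simp add: bounded_linear_Blinfun_apply[OF m_bl])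
  qed
  with m0 m' m_cont show ?thesis by (rule that)
qed

text \<open>
  The directional derivative \<open>m\<close> of a solution solves an equation of the same kind, whose right-hand
  side \<open>f2 (t, z, x) = f' (t, z, u (t, z)) (0, v, x)\<close> is \<open>C\<^sup>k\<close> as soon as \<open>f'\<close> and \<open>u\<close> are.  So the induction on
  the order runs over all right-hand sides simultaneously: the hypothesis is used first for \<open>u\<close> and
  then for \<open>m\<close>.  The Lipschitz bound in the last argument passes from \<open>f\<close> to \<open>f2\<close>, for which it is a
  bound on \<open>f'\<close>.
\<close>

lemma ode_Cdiff_dependence:
  fixes f :: "real \<times> 'a::euclidean_space \<times> 'b::euclidean_space \<Rightarrow> 'b"
  assumes S: "compact S" "convex S" and B: "compact B" "convex B"
    and f: "Cdiff k ({0..1} \<times> S \<times> B) f"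
    and Lip: "\<And>t z x y. t \<in> {0..1} \<Longrightarrow> z \<in> S \<Longrightarrow> x \<in> B \<Longrightarrow> y \<in> B \<Longrightarrow>
      norm (f (t, z, y) - f (t, z, x)) \<le> K * norm (y - x)" and K: "K \<ge> 0"
    and uB: "\<And>t z. t \<in> {0..1} \<Longrightarrow> z \<in> S \<Longrightarrow> u (t, z) \<in> B"
    and u: "\<And>t z. t \<in> {0..1} \<Longrightarrow> z \<in> S \<Longrightarrow>
      ((\<lambda>s. u (s, z)) has_vector_derivative f (t, z, u (t, z))) (at t within {0..1})"
    and u0: "Cdiff k S (\<lambda>z. u (0, z))"
  shows "Cdiff k ({0..1} \<times> S) u"
  using B f Lip K uB u u0
proof (induction k arbitrary: f B K u)
  case 0
  then show ?case using ode_continuous_dependence[OF S(1), of B f K u] by simp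
next
  case (Suc k)
  let ?I = "{0..1::real}" and ?D = "{0..1::real} \<times> S \<times> B"
  let ?P = "\<lambda>t z. (t, z, u (t, z))"
  obtain f' where f': "\<And>p. p \<in> ?D \<Longrightarrow> (f has_derivative f' p) (at p within ?D)" "\<And>v. Cdiff k ?D (\<lambda>p. f' p v)"
    using Cdiff_SucE Suc.prems(3) by blast
  obtain u0' where u0': "\<And>z. z \<in> S \<Longrightarrow> ((\<lambda>z. u (0, z)) has_derivative u0' z) (at z within S)" "\<And>v. Cdiff k S (\<lambda>z. u0' z v)"
    using Cdiff_SucE Suc.prems(8) by blast
  have P: "?P t z \<in> ?D" if "t \<in> ?I" "z \<in> S" for t z using that Suc.prems(6) by auto
  have lin: "linear (f' p)" if "p \<in> ?D" for p
    using f'(1)[OF that] by (rule has_derivative_linear)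
  obtain m where m0: "\<And>z v. z \<in> S \<Longrightarrow> m (0, z) v = u0' z v"
    and m': "\<And>t z v. t \<in> ?I \<Longrightarrow> z \<in> S \<Longrightarrow> ((\<lambda>s. m (s, z) v) has_vector_derivative f' (?P t z) (0, v, m (t, z) v)) (at t within ?I)"
    and m_cont: "\<And>v. continuous_on (?I \<times> S) (\<lambda>p. m p v)"
    and u': "\<And>t z. t \<in> ?I \<Longrightarrow> z \<in> S \<Longrightarrow> (u has_derivative (\<lambda>(\<tau>, v). \<tau> *\<^sub>R f (?P t z) + m (t, z) v)) (at (t, z) within ?I \<times> S)"
    using ode_C1_dependence[OF S Suc.prems(1,2) f'(1) Cdiff_continuous_on[OF f'(2)] Suc.prems(6,7) u0'(1)
        Cdiff_continuous_on[OF u0'(2)]] by blast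
  have u_k: "Cdiff k (?I \<times> S) u"
    by (rule Suc.IH[OF Suc.prems(1,2) Cdiff_Suc_imp[OF Suc.prems(3)] Suc.prems(4-7) Cdiff_Suc_imp[OF Suc.prems(8)]])
  have m_k: "Cdiff k (?I \<times> S) (\<lambda>p. m p v)" for v
  proof -
    have "bounded ((\<lambda>p. m p v) ` (?I \<times> S))"
      by (intro compact_imp_bounded compact_continuous_image m_cont compact_Times S compact_Icc)
    then obtain R where R: "\<And>p. p \<in> ?I \<times> S \<Longrightarrow> m p v \<in> cball 0 R"
      unfolding bounded_iff by (auto simp del: mem_Sigma_iff)
    obtain L where L: "L \<ge> 0" "\<And>p w. p \<in> ?D \<Longrightarrow> norm (f' p w) \<le> L * norm w"
      using bounded_components_compact[OF _ has_derivative_bounded_linear[OF f'(1)] Cdiff_continuous_on[OF f'(2)]]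
        compact_Times[OF compact_Icc compact_Times[OF S(1) Suc.prems(1)]] by blast
    define f2 where "f2 p = f' (?P (fst p) (fst (snd p))) (0, v, snd (snd p))" for p
    have f2: "f2 (t, z, x) = f' (?P t z) (0, v, x)" for t z x by (simp add: f2_def)
    show ?thesis
    proof (rule Suc.IH[where f = f2 and B = "cball 0 R" and K = L])
      show "Cdiff k (?I \<times> S \<times> cball 0 R) f2"
        unfolding f2_def
      proof (rule Cdiff_linear_application[where A = "\<lambda>p. f' (?P (fst p) (fst (snd p)))"
            and w = "\<lambda>p. (0, v, snd (snd p))"])
        show "linear (f' (?P (fst p) (fst (snd p))))" if "p \<in> ?I \<times> S \<times> cball 0 R" for p :: "real \<times> 'a \<times> 'b"
          using that by (intro lin P) auto
        show "Cdiff k (?I \<times> S \<times> cball 0 R) (\<lambda>p::real \<times> 'a \<times> 'b. f' (?P (fst p) (fst (snd p))) b)" for b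
          by (rule Cdiff_compose[OF f'(2)])
            (auto intro!: Cdiff_Pair Cdiff_fst Cdiff_snd Cdiff_ident Cdiff_compose[OF u_k] Suc.prems(6))
      qed (intro Cdiff_Pair Cdiff_snd Cdiff_ident Cdiff_const)
      show "norm (f2 (t, z, y) - f2 (t, z, x)) \<le> L * norm (y - x)" if "t \<in> ?I" "z \<in> S" for t z x y
        using L(2)[OF P[OF that], of "(0, 0, y - x)"] linear_diff[OF lin[OF P[OF that]], of "(0, v, y)" "(0, v, x)"]
        by (simp add: f2 norm_Pair)
      show "Cdiff k S (\<lambda>z. m (0, z) v)"
        by (rule Cdiff_cong[OF _ u0'(2)]) (simp add: m0)
    qed (use L R m' in \<open>auto simp: f2\<close>)
  qed
  show ?case
  proof (rule Cdiff_SucI)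
    show "(u has_derivative (\<lambda>w. fst w *\<^sub>R f (?P (fst p) (snd p)) + m p (snd w))) (at p within ?I \<times> S)"
      if "p \<in> ?I \<times> S" for p
      using u'[of "fst p" "snd p"] that by (auto simp: case_prod_unfold)
    show "Cdiff k (?I \<times> S) (\<lambda>p. fst w *\<^sub>R f (?P (fst p) (snd p)) + m p (snd w))" for w
      by (intro Cdiff_add m_k Cdiff_scaleR Cdiff_const Cdiff_compose[OF Cdiff_Suc_imp[OF Suc.prems(3)]] P Cdiff_Pair Cdiff_fst Cdiff_snd Cdiff_ident)
        (auto intro: u_k Suc.prems(6) simp del: Cdiff.simps)
  qed
qed

section \<open>Hamiltonian flows on the disk\<close>

lemma closed_disk_convex_interior:
  "convex disk" "interior disk \<noteq> {}" "convex ({0..1::real} \<times> disk)" "interior ({0..1::real} \<times> disk) \<noteq> {}"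
  by (simp_all add: convex_Times interior_Times)

lemma \<omega>0_linear_form:
  assumes "linear f" shows "f v = \<omega>0 (Complex (f \<i>) (- f 1)) v"
  using \<omega>0_representation[OF assms, of "Complex (f \<i>) (- f 1)"] by simp

lemma Cdiff_Re: "Cdiff k S f \<Longrightarrow> Cdiff k S (\<lambda>x. Re (f x))"
  and Cdiff_Im: "Cdiff k S f \<Longrightarrow> Cdiff k S (\<lambda>x. Im (f x))"
  by (rule Cdiff_linear_comp[OF bounded_linear_Re] Cdiff_linear_comp[OF bounded_linear_Im]; assumption)+

lemma Cdiff_Complex:
  assumes "Cdiff k S f" "Cdiff k S g" shows "Cdiff k S (\<lambda>x. Complex (f x) (g x))"
proof -
  have "Cdiff k S (\<lambda>x. f x *\<^sub>R 1 + g x *\<^sub>R \<i>)"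
    by (intro Cdiff_add Cdiff_scaleR Cdiff_const assms)
  then show ?thesis by (rule Cdiff_cong[rotated]) (simp add: complex_eq_iff)
qed

text \<open>
  Derivatives are taken jointly in time and space, because smoothness of \<open>H\<close> is joint smoothness;
  \<open>slice_derivative\<close> passes to a fixed time.
\<close>

locale Hamiltonian_flow =
  fixes H :: "real \<Rightarrow> complex \<Rightarrow> real" and \<phi> :: "real \<Rightarrow> complex \<Rightarrow> complex"
  assumes supported: "supported_Hamiltonian H" and flow: "is_Ham_flow H \<phi>"
begin

abbreviation (input) cylinder :: "(real \<times> complex) set" where
  "cylinder \<equiv> {0..1} \<times> disk"

definition dH :: "real \<times> complex \<Rightarrow> real \<times> complex \<Rightarrow> real" where
  "dH p = frechet_derivative (\<lambda>(t, z). H t z) (at p within cylinder)"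

definition V :: "real \<times> complex \<Rightarrow> complex" where
  "V p = Complex (dH p (0, \<i>)) (- dH p (0, 1))"

definition dV :: "real \<times> complex \<Rightarrow> real \<times> complex \<Rightarrow> complex" where
  "dV p = frechet_derivative V (at p within cylinder)"

lemma H_Cdiff: "Cdiff k cylinder (\<lambda>(t, z). H t z)"
  using supported smooth_on_iff_Cdiff[OF closed_disk_convex_interior(3,4)]
  unfolding supported_Hamiltonian_def by blast

lemma dH: "p \<in> cylinder \<Longrightarrow> ((\<lambda>(t, z). H t z) has_derivative dH p) (at p within cylinder)"
  unfolding dH_def by (rule Cdiff_has_frechet_derivative[OF H_Cdiff])

lemma dH_Cdiff: "Cdiff k cylinder (\<lambda>p. dH p v)"
  by (rule Cdiff_derivative[OF closed_disk_convex_interior(3,4) H_Cdiff dH])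

lemma V_Cdiff: "Cdiff k cylinder V"
  unfolding V_def by (intro Cdiff_Complex Cdiff_minus dH_Cdiff)

lemma dV: "p \<in> cylinder \<Longrightarrow> (V has_derivative dV p) (at p within cylinder)"
  unfolding dV_def by (rule Cdiff_has_frechet_derivative[OF V_Cdiff])

lemma dV_Cdiff: "Cdiff k cylinder (\<lambda>p. dV p v)"
  by (rule Cdiff_derivative[OF closed_disk_convex_interior(3,4) V_Cdiff dV])

lemma slice_derivative:
  assumes F: "(F has_derivative F') (at (t, z) within cylinder)" and t: "t \<in> {0..1}"
  shows "((\<lambda>z. F (t, z)) has_derivative (\<lambda>v. F' (0, v))) (at z within disk)"
proof -
  have "((\<lambda>z. (t, z)) has_derivative (\<lambda>v. (0, v))) (at z within disk)"
    by (auto intro!: derivative_eq_intros)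
  moreover have "(F has_derivative F') (at (t, z) within (\<lambda>z. (t, z)) ` disk)"
    using t by (intro has_derivative_subset[OF F]) auto
  ultimately show ?thesis using diff_chain_within by (fastforce simp: o_def)
qed

lemma H_slice:
  assumes "t \<in> {0..1}" "z \<in> disk"
  shows "(H t has_derivative (\<lambda>v. dH (t, z) (0, v))) (at z within disk)"
  using slice_derivative[OF dH, of t z] assms by simp

lemma dH_eq_\<omega>0:
  assumes "t \<in> {0..1}" "z \<in> disk"
  shows "dH (t, z) (0, v) = \<omega>0 (V (t, z)) v"
  using \<omega>0_linear_form[OF has_derivative_linear[OF H_slice[OF assms]], of v] by (simp add: V_def)

lemma Ham_vector_field_eq_V:
  assumes "t \<in> {0..1}" "z \<in> disk"
  shows "Ham_vector_field (H t) z = V (t, z)"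
proof -
  have "disk_deriv (H t) z = (\<lambda>v. dH (t, z) (0, v))"
    by (rule frechet_derivative_within_convex[OF closed_disk_convex_interior(1,2) H_slice[OF assms] assms(2)])
  then show ?thesis
    using Ham_vector_field_eq[OF differentiableI[OF H_slice[OF assms]]] by (simp add: V_def)
qed

lemma \<phi>_disk: "t \<in> {0..1} \<Longrightarrow> z \<in> disk \<Longrightarrow> \<phi> t z \<in> disk"
  and \<phi>_0: "z \<in> disk \<Longrightarrow> \<phi> 0 z = z"
  using flow by (auto simp: is_Ham_flow_def)

lemma \<phi>_ode:
  assumes "t \<in> {0..1}" "z \<in> disk"
  shows "((\<lambda>s. \<phi> s z) has_vector_derivative V (t, \<phi> t z)) (at t within {0..1})"
  using flow assms unfolding Ham_vector_field_eq_V[OF assms(1) \<phi>_disk[OF assms], symmetric] is_Ham_flow_def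
  by blast

lemma V_Lipschitz:
  obtains K where "K \<ge> 0" "\<And>t x y. t \<in> {0..1} \<Longrightarrow> x \<in> disk \<Longrightarrow> y \<in> disk \<Longrightarrow> norm (V (t, y) - V (t, x)) \<le> K * norm (y - x)"
proof -
  obtain K where "K \<ge> 0" "\<And>p q. p \<in> cylinder \<Longrightarrow> q \<in> cylinder \<Longrightarrow> norm (V q - V p) \<le> K * norm (q - p)"
    using C1_compact_Lipschitz[OF _ closed_disk_convex_interior(3) dV Cdiff_continuous_on[OF dV_Cdiff]]
      compact_Times[OF compact_Icc compact_cball] by blast
  from this(1) this(2)[of "(t, x)" "(t, y)" for t x y] show ?thesis
    by (intro that[of K]) (auto simp: norm_Pair)
qed

lemma \<phi>_Cdiff: "Cdiff k cylinder (\<lambda>p. \<phi> (fst p) (snd p))"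
proof -
  obtain K where K: "K \<ge> 0" "\<And>t x y. t \<in> {0..1} \<Longrightarrow> x \<in> disk \<Longrightarrow> y \<in> disk \<Longrightarrow> norm (V (t, y) - V (t, x)) \<le> K * norm (y - x)"
    using V_Lipschitz by blast
  show ?thesis
  proof (rule ode_Cdiff_dependence[where f = "\<lambda>p. V (fst p, snd (snd p))" and B = disk and K = K])
    show "Cdiff k ({0..1} \<times> disk \<times> disk) (\<lambda>p::real \<times> complex \<times> complex. V (fst p, snd (snd p)))"
      by (rule Cdiff_compose[OF V_Cdiff]) (auto intro!: Cdiff_Pair Cdiff_fst Cdiff_snd Cdiff_ident)
    show "Cdiff k disk (\<lambda>z. \<phi> (fst (0::real, z)) (snd (0::real, z)))"
      by (rule Cdiff_cong[OF _ Cdiff_ident]) (simp add: \<phi>_0)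
  qed (use K \<phi>_disk \<phi>_ode in auto)
qed

text \<open>
  The derivative of the flow with respect to the initial point solves the variational equation along
  the flow.
\<close>

lemma variational_solution:
  obtains m where
    "\<And>z v. z \<in> disk \<Longrightarrow> m (0, z) v = v"
    "\<And>t z v. t \<in> {0..1} \<Longrightarrow> z \<in> disk \<Longrightarrow>
      ((\<lambda>s. m (s, z) v) has_vector_derivative dV (t, \<phi> t z) (0, m (t, z) v)) (at t within {0..1})"
    "\<And>v. continuous_on cylinder (\<lambda>p. m p v)"
    "\<And>t z. t \<in> {0..1} \<Longrightarrow> z \<in> disk \<Longrightarrow> (\<phi> t has_derivative m (t, z)) (at z within disk)"
proof -
  let ?C = "{0..1} \<times> disk \<times> disk" and ?pr = "\<lambda>p::real \<times> complex \<times> complex. (fst p, snd (snd p))"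
  let ?u = "\<lambda>p. \<phi> (fst p) (snd p)"
  have f': "((\<lambda>p. V (?pr p)) has_derivative (\<lambda>w. dV (?pr p) (?pr w))) (at p within ?C)" if "p \<in> ?C" for p
  proof -
    have "(?pr has_derivative ?pr) (at p within ?C)" by (auto intro!: derivative_eq_intros)
    moreover have "(V has_derivative dV (?pr p)) (at (?pr p) within ?pr ` ?C)"
      using that by (intro has_derivative_subset[OF dV]) auto
    ultimately show ?thesis using diff_chain_within by (fastforce simp: o_def)
  qed
  have f'_cont: "continuous_on ?C (\<lambda>p. dV (?pr p) (?pr w))" for w
    by (rule continuous_on_compose2[OF Cdiff_continuous_on[OF dV_Cdiff]]) (auto intro!: continuous_intros)
  have u0: "((\<lambda>z. ?u (0, z)) has_derivative (\<lambda>v. v)) (at z within disk)" if "z \<in> disk" for z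
    using has_derivative_transform[OF that _ has_derivative_ident] \<phi>_0 by simp
  show ?thesis
  proof (rule ode_C1_dependence[OF compact_cball convex_cball compact_cball convex_cball f' f'_cont, of ?u "\<lambda>z v. v"])
    fix m
    assume m0: "\<And>z v. z \<in> disk \<Longrightarrow> m (0, z) v = v"
      and m': "\<And>t z v. t \<in> {0..1} \<Longrightarrow> z \<in> disk \<Longrightarrow>
        ((\<lambda>s. m (s, z) v) has_vector_derivative dV (?pr (t, z, ?u (t, z))) (?pr (0, v, m (t, z) v))) (at t within {0..1})"
      and m_cont: "\<And>v. continuous_on cylinder (\<lambda>p. m p v)"
      and u': "\<And>t z. t \<in> {0..1} \<Longrightarrow> z \<in> disk \<Longrightarrow>
        (?u has_derivative (\<lambda>(\<tau>, v). \<tau> *\<^sub>R V (?pr (t, z, ?u (t, z))) + m (t, z) v)) (at (t, z) within cylinder)"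
    show ?thesis
    proof (rule that[OF m0 _ m_cont])
      show "((\<lambda>s. m (s, z) v) has_vector_derivative dV (t, \<phi> t z) (0, m (t, z) v)) (at t within {0..1})"
        if "t \<in> {0..1}" "z \<in> disk" for t z v using m'[OF that] by simp
      show "(\<phi> t has_derivative m (t, z)) (at z within disk)" if "t \<in> {0..1}" "z \<in> disk" for t z
        using slice_derivative[OF u'[OF that] that(1)] by simp
    qed
  qed (use \<phi>_disk \<phi>_ode u0 in auto)
qed

text \<open>
  The support is compact in the open disk, so some boundary annulus avoids it.  There the vector field
  vanishes, the constant path is a solution, and solutions are unique by the Gronwall inequality.
\<close>

lemma support_radius:
  obtains r where "0 < r" "r < 1" "\<And>t z. t \<in> {0..1} \<Longrightarrow> z \<in> disk \<Longrightarrow> r \<le> norm z \<Longrightarrow> H t z = 0 \<and> V (t, z) = 0 \<and> \<phi> t z = z"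
proof -
  let ?X = "{(t, z). t \<in> {0..1} \<and> z \<in> disk \<and> H t z \<noteq> 0}"
  have "?X \<subseteq> cylinder" by auto
  then have "bounded ?X" by (rule bounded_subset[rotated]) (intro compact_imp_bounded compact_Times compact_Icc compact_cball)
  then have "compact (insert (0, 0) (closure ?X))" by (simp add: compact_insert)
  moreover have "continuous_on (insert (0, 0) (closure ?X)) (\<lambda>p::real \<times> complex. norm (snd p))" by (intro continuous_intros)
  ultimately obtain q where q: "q \<in> insert (0, 0) (closure ?X)"
    "\<And>p. p \<in> insert (0, 0) (closure ?X) \<Longrightarrow> norm (snd p) \<le> norm (snd q)"
    using continuous_attains_sup[of "insert (0, 0) (closure ?X)" "\<lambda>p. norm (snd p)"] by blast
  define r0 where "r0 = norm (snd q)"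
  have "snd q \<in> ball 0 1"
  proof (cases "q = (0, 0)")
    case False
    then have "q \<in> {0..1} \<times> ball 0 1" using q(1) supported unfolding supported_Hamiltonian_def by blast
    then show ?thesis by (simp add: mem_Times_iff)
  qed simp
  then have r0: "0 \<le> r0" "r0 < 1" by (simp_all add: r0_def)
  have H0: "H t z = 0" if "t \<in> {0..1}" "z \<in> disk" "r0 < norm z" for t z
  proof (rule ccontr)
    assume "H t z \<noteq> 0"
    then have "(t, z) \<in> ?X" using that by simp
    then have "(t, z) \<in> closure ?X" by (rule subsetD[OF closure_subset])
    then have "norm z \<le> r0" using q(2)[of "(t, z)"] by (simp add: r0_def)
    with that(3) show False by simp
  qed
  define r where "r = (1 + r0) / 2"
  have r: "r0 < r" "r < 1" using r0 by (simp_all add: r_def)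
  have V0: "V (t, z) = 0" if t: "t \<in> {0..1}" and z: "z \<in> disk" "r \<le> norm z" for t z
  proof -
    have "((\<lambda>z. 0) has_derivative (\<lambda>v. 0)) (at z within disk)" by simp
    then have "(H t has_derivative (\<lambda>v. 0)) (at z within disk)"
    proof (rule has_derivative_transform_within[where d = "r - r0"])
      fix y assume y: "y \<in> disk" "dist y z < r - r0"
      have "norm z \<le> norm y + dist y z" using norm_triangle_ineq[of y "z - y"] by (simp add: dist_norm norm_minus_commute)
      then show "0 = H t y" using H0[OF t y(1)] y(2) z(2) by simp
    qed (use z r in auto)
    then have "(\<lambda>v. dH (t, z) (0, v)) = (\<lambda>v. 0)"
      using has_derivative_unique_within_convex[OF closed_disk_convex_interior(1,2) z(1) H_slice[OF t z(1)]] by blast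
    then show ?thesis by (simp add: V_def fun_eq_iff zero_complex.code)
  qed
  obtain K where K: "K \<ge> 0" "\<And>t x y. t \<in> {0..1} \<Longrightarrow> x \<in> disk \<Longrightarrow> y \<in> disk \<Longrightarrow> norm (V (t, y) - V (t, x)) \<le> K * norm (y - x)"
    using V_Lipschitz by blast
  have "\<phi> t z = z" if t: "t \<in> {0..1}" and z: "z \<in> disk" "r \<le> norm z" for t z
  proof -
    have "norm (\<phi> t z - z) \<le> (0 + 0) * exp (K + 1)"
    proof (rule gronwall[where u = "\<lambda>s. \<phi> s z - z" and u' = "\<lambda>s. V (s, \<phi> s z)"])
      fix s :: real assume s: "s \<in> {0..1}"
      show "((\<lambda>s. \<phi> s z - z) has_vector_derivative V (s, \<phi> s z)) (at s within {0..1})"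
        using has_vector_derivative_diff[OF \<phi>_ode[OF s z(1)] has_vector_derivative_const] by simp
      show "norm (V (s, \<phi> s z)) \<le> K * norm (\<phi> s z - z) + 0"
        using K(2)[OF s z(1) \<phi>_disk[OF s z(1)]] V0[OF s z] by simp
    qed (use K t z \<phi>_0 in auto)
    then show ?thesis by simp
  qed
  then show ?thesis using that[of r] H0 V0 r r0 by force
qed

text \<open>
  The action integral \<open>\<integral> (\<lambda>(X\<^sub>t) + H\<^sub>t) \<circ> \<phi>\<^sub>t dt\<close> for the primitive \<open>\<lambda> = x dy\<close>.
\<close>

definition \<sigma> :: "complex \<Rightarrow> real" where
  "\<sigma> z = integral {0..1} (\<lambda>t. Re (\<phi> t z) * Im (V (t, \<phi> t z)) + H t (\<phi> t z))"

lemma continuous_on_along_flow: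
  assumes F: "continuous_on cylinder F"
  shows "continuous_on (disk \<times> {0..1}) (\<lambda>p. F (snd p, \<phi> (snd p) (fst p)))"
proof (rule continuous_on_compose2[OF F])
  have "continuous_on (disk \<times> {0..1}) (\<lambda>p. \<phi> (snd p) (fst p))"
    by (rule continuous_on_compose2[OF Cdiff_continuous_on[OF \<phi>_Cdiff], of _ "\<lambda>p. (snd p, fst p)", simplified])
      (auto intro!: continuous_intros)
  then show "continuous_on (disk \<times> {0..1}) (\<lambda>p. (snd p, \<phi> (snd p) (fst p)))"
    by (intro continuous_intros)
qed (use \<phi>_disk in auto)

text \<open>
  By Cartan's formula \<open>d/dt (\<phi>\<^sub>t\<^sup>* \<lambda>) = d ((\<lambda>(X\<^sub>t) + H\<^sub>t) \<circ> \<phi>\<^sub>t)\<close> for \<open>\<lambda> = x dy\<close>.  Concretely: the derivative of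
  the integrand in direction \<open>v\<close> is the time derivative of \<open>Re (\<phi>\<^sub>t z) * Im (D\<phi>\<^sub>t(z) v)\<close>, so the integral
  of the derivative is the difference of the values of this product at times 1 and 0.
\<close>

lemma \<sigma>_derivative:
  assumes z: "z \<in> disk" and \<psi>': "(\<phi> 1 has_derivative \<psi>') (at z within disk)"
  shows "(\<sigma> has_derivative (\<lambda>v. Re (\<phi> 1 z) * Im (\<psi>' v) - Re z * Im v)) (at z within disk)"
proof -
  obtain m where m: "\<And>z v. z \<in> disk \<Longrightarrow> m (0, z) v = v"
    "\<And>t z v. t \<in> {0..1} \<Longrightarrow> z \<in> disk \<Longrightarrow>
      ((\<lambda>s. m (s, z) v) has_vector_derivative dV (t, \<phi> t z) (0, m (t, z) v)) (at t within {0..1})"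
    "\<And>v. continuous_on cylinder (\<lambda>p. m p v)"
    "\<And>t z. t \<in> {0..1} \<Longrightarrow> z \<in> disk \<Longrightarrow> (\<phi> t has_derivative m (t, z)) (at z within disk)"
    using variational_solution by blast
  have \<psi>'_m: "\<psi>' = m (1, z)"
    using has_derivative_unique_within_convex[OF closed_disk_convex_interior(1,2) z \<psi>'] m(4)[OF _ z, of 1] by simp
  let ?g = "\<lambda>z t. Re (\<phi> t z) * Im (V (t, \<phi> t z)) + H t (\<phi> t z)"
  let ?g' = "\<lambda>z t v. (Re (\<phi> t z) * Im (dV (t, \<phi> t z) (0, m (t, z) v)) + Re (m (t, z) v) * Im (V (t, \<phi> t z)))
    + dH (t, \<phi> t z) (0, m (t, z) v)"
  have chain: "((\<lambda>z. F (t, \<phi> t z)) has_derivative (\<lambda>v. F' (0, m (t, z) v))) (at z within disk)"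
    if "(F has_derivative F') (at (t, \<phi> t z) within cylinder)" "t \<in> {0..1}" "z \<in> disk"
    for F :: "real \<times> complex \<Rightarrow> 'z::real_normed_vector" and F' t z
  proof -
    have "((\<lambda>z. F (t, z)) has_derivative (\<lambda>v. F' (0, v))) (at (\<phi> t z) within \<phi> t ` disk)"
      by (rule has_derivative_subset[OF slice_derivative[OF that(1,2)]]) (use \<phi>_disk[OF that(2)] in auto)
    from diff_chain_within[OF m(4)[OF that(2,3)] this] show ?thesis by (simp add: o_def)
  qed
  have in_cyl: "(t, \<phi> t z) \<in> cylinder" if "t \<in> {0..1}" "z \<in> disk" for t z
    using that \<phi>_disk by auto
  have "((\<lambda>z. integral {0..1} (?g z)) has_derivative (\<lambda>v. integral {0..1} (\<lambda>t. ?g' z t v))) (at z within disk)"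
  proof (rule has_derivative_integral_param[OF convex_cball z])
    fix z t assume z: "z \<in> disk" and t: "t \<in> {0..1::real}"
    have "((\<lambda>z. H t (\<phi> t z)) has_derivative (\<lambda>v. dH (t, \<phi> t z) (0, m (t, z) v))) (at z within disk)"
      using chain[OF dH[OF in_cyl[OF t z]] t z] by simp
    then show "((\<lambda>z. ?g z t) has_derivative ?g' z t) (at z within disk)"
      by (intro has_derivative_add has_derivative_mult has_derivative_Re has_derivative_Im m(4)
        chain[OF dV[OF in_cyl[OF t z]] t z] t z)
  next
    fix z :: complex assume z: "z \<in> disk"
    have *: "continuous_on (disk \<times> {0..1}) (\<lambda>p. ?g (fst p) (snd p))"
      using continuous_on_along_flow[OF Cdiff_continuous_on[OF V_Cdiff]]
        continuous_on_along_flow[OF Cdiff_continuous_on[OF H_Cdiff]]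
        continuous_on_along_flow[OF continuous_on_snd[OF continuous_on_id]]
      by (auto intro!: continuous_intros)
    have "continuous_on {0..1} (\<lambda>t::real. (z, t))" "(\<lambda>t. (z, t)) ` {0..1} \<subseteq> disk \<times> {0..1}"
      using z by (auto intro!: continuous_intros)
    from continuous_on_compose2[OF * this] show "continuous_on {0..1} (?g z)" by simp
  next
    fix v
    have m_cont: "continuous_on (disk \<times> {0..1}) (\<lambda>p. m (snd p, fst p) v)"
      by (rule continuous_on_compose2[OF m(3)]) (auto intro!: continuous_intros)
    have app: "continuous_on (disk \<times> {0..1}) (\<lambda>p. F' (snd p, \<phi> (snd p) (fst p)) (0, m (snd p, fst p) v))"
      if "\<And>v. continuous_on cylinder (\<lambda>p. F' p v)" "\<And>p. p \<in> cylinder \<Longrightarrow> linear (F' p)"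
      for F' :: "real \<times> complex \<Rightarrow> real \<times> complex \<Rightarrow> 'z::real_normed_vector"
    proof -
      have "Cdiff 0 (disk \<times> {0..1}) (\<lambda>p. F' (snd p, \<phi> (snd p) (fst p)) (0, m (snd p, fst p) v))"
      proof (rule Cdiff_linear_application[where A = "\<lambda>p. F' (snd p, \<phi> (snd p) (fst p))" and w = "\<lambda>p. (0, m (snd p, fst p) v)"])
        show "linear (F' (snd p, \<phi> (snd p) (fst p)))" if "p \<in> disk \<times> {0..1}" for p
          using that \<open>\<And>p. p \<in> cylinder \<Longrightarrow> linear (F' p)\<close> in_cyl by auto
      qed (use continuous_on_along_flow[OF that(1)] m_cont in \<open>auto intro!: continuous_intros\<close>)
      then show ?thesis by simp
    qed
    have "continuous_on (disk \<times> {0..1}) (\<lambda>p. ?g' (fst p) (snd p) v)"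
      using continuous_on_along_flow[OF Cdiff_continuous_on[OF V_Cdiff]]
        continuous_on_along_flow[OF continuous_on_snd[OF continuous_on_id]] m_cont
        app[OF Cdiff_continuous_on[OF dV_Cdiff] has_derivative_linear[OF dV]]
        app[OF Cdiff_continuous_on[OF dH_Cdiff] has_derivative_linear[OF dH]]
      by (auto intro!: continuous_intros)
    then show "continuous_on (disk \<times> {0..1}) (\<lambda>(z, t). ?g' z t v)" by (simp add: case_prod_unfold)
  qed
  moreover have "integral {0..1} (\<lambda>t. ?g' z t v) = Re (\<phi> 1 z) * Im (\<psi>' v) - Re z * Im v" for v
  proof -
    have "((\<lambda>t. ?g' z t v) has_integral Re (\<phi> 1 z) * Im (m (1, z) v) - Re (\<phi> 0 z) * Im (m (0, z) v)) {0..1}"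
    proof (rule fundamental_theorem_of_calculus)
      fix t :: real assume t: "t \<in> {0..1}"
      have "((\<lambda>t. Re (\<phi> t z) * Im (m (t, z) v)) has_vector_derivative
          Re (\<phi> t z) * Im (dV (t, \<phi> t z) (0, m (t, z) v)) + Re (V (t, \<phi> t z)) * Im (m (t, z) v)) (at t within {0..1})"
        by (intro has_vector_derivative_mult bounded_linear.has_vector_derivative[OF bounded_linear_Re]
          bounded_linear.has_vector_derivative[OF bounded_linear_Im] \<phi>_ode m(2) t z)
      also have "Re (\<phi> t z) * Im (dV (t, \<phi> t z) (0, m (t, z) v)) + Re (V (t, \<phi> t z)) * Im (m (t, z) v) = ?g' z t v"
        using dH_eq_\<omega>0[OF t \<phi>_disk[OF t z], of "m (t, z) v"] by (simp add: \<omega>0_def)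
      finally show "((\<lambda>t. Re (\<phi> t z) * Im (m (t, z) v)) has_vector_derivative ?g' z t v) (at t within {0..1})" .
    qed simp
    then show ?thesis using \<phi>_0[OF z] m(1)[OF z] by (simp add: integral_unique \<psi>'_m)
  qed
  ultimately show ?thesis by (simp add: \<sigma>_def[abs_def])
qed

end

text \<open>
  The properties of a group element on which its generating function rests.  The action function \<open>\<sigma>\<close>
  for \<open>x dy\<close> is extended to the plane by zero; near the boundary this is smooth, as \<open>\<psi>\<close> is the identity there.
\<close>

lemma Ham_c_structure:
  assumes "\<psi> \<in> Ham_c"
  obtains r \<sigma> \<psi>' where "0 < r" "r < 1" "\<And>z. r \<le> norm z \<Longrightarrow> \<psi> z = z" "\<psi> ` disk \<subseteq> disk"
    "\<And>k. Cdiff k UNIV \<psi>" "\<And>z. (\<psi> has_derivative \<psi>' z) (at z)"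
    "\<And>z. (\<sigma> has_derivative (\<lambda>v. Re (\<psi> z) * Im (\<psi>' z v) - Re z * Im v)) (at z)"
    "\<And>z. r \<le> norm z \<Longrightarrow> \<sigma> z = (0::real)"
proof -
  obtain H \<phi> where H: "supported_Hamiltonian H" "is_Ham_flow H \<phi>"
    and \<psi>: "\<And>z. z \<in> disk \<Longrightarrow> \<psi> z = \<phi> 1 z" and out: "\<And>z. z \<notin> disk \<Longrightarrow> \<psi> z = z"
    using assms by (auto simp: Ham_c_def generates_def)
  interpret Hamiltonian_flow H \<phi> by standard (fact H)+
  obtain r where r: "0 < r" "r < 1" "\<And>t z. t \<in> {0..1} \<Longrightarrow> z \<in> disk \<Longrightarrow> r \<le> norm z \<Longrightarrow> H t z = 0 \<and> V (t, z) = 0 \<and> \<phi> t z = z"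
    using support_radius by blast
  have id: "\<psi> z = z" if "r \<le> norm z" for z
    using r(3)[of 1 z] \<psi>[of z] out[of z] that by (cases "z \<in> disk") auto
  have un: "ball 0 1 \<union> - cball 0 r = (UNIV :: complex set)" using r(2) by auto
  have "Cdiff k (ball 0 1) \<psi>" for k
  proof (rule Cdiff_cong)
    show "Cdiff k (ball 0 1) (\<lambda>z. \<phi> (fst (1::real, z)) (snd (1::real, z)))"
      by (rule Cdiff_compose[OF \<phi>_Cdiff]) (auto intro!: Cdiff_Pair Cdiff_const Cdiff_ident)
  qed (use \<psi> in auto)
  moreover have "Cdiff k (- cball 0 r) \<psi>" for k
    by (rule Cdiff_cong[OF _ Cdiff_ident]) (simp add: id)
  ultimately have smooth: "Cdiff k UNIV \<psi>" for k
    using Cdiff_Un_open[of "ball 0 1" "- cball 0 r" k \<psi>] by (simp add: un open_Compl)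
  obtain \<psi>' where \<psi>': "\<And>z. (\<psi> has_derivative \<psi>' z) (at z)"
    using Cdiff_SucE[OF smooth] by (metis UNIV_I)
  define \<sigma>' where "\<sigma>' z = (if z \<in> disk then \<sigma> z else 0)" for z
  have \<sigma>'_0: "\<sigma>' z = 0" if "r \<le> norm z" for z
  proof (cases "z \<in> disk")
    case True
    have "integral {0..1} (\<lambda>t. Re (\<phi> t z) * Im (V (t, \<phi> t z)) + H t (\<phi> t z)) = integral {0..1} (\<lambda>t::real. 0::real)"
      using r(3)[OF _ True that] by (intro integral_cong) auto
    then show ?thesis using True by (simp add: \<sigma>'_def \<sigma>_def)
  qed (simp add: \<sigma>'_def)
  have "(\<sigma>' has_derivative (\<lambda>v. Re (\<psi> z) * Im (\<psi>' z v) - Re z * Im v)) (at z)" for z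
  proof (cases "norm z < 1")
    case True
    then have z: "z \<in> disk" "z \<in> ball 0 1" by auto
    have "(\<phi> 1 has_derivative \<psi>' z) (at z within disk)"
      using has_derivative_transform[OF z(1) _ has_derivative_at_withinI[OF \<psi>'[of z]]] \<psi> by simp
    from \<sigma>_derivative[OF z(1) this]
    have "(\<sigma> has_derivative (\<lambda>v. Re (\<psi> z) * Im (\<psi>' z v) - Re z * Im v)) (at z within ball 0 1)"
      using \<psi>[OF z(1)] by (auto intro: has_derivative_subset)
    then have "(\<sigma>' has_derivative (\<lambda>v. Re (\<psi> z) * Im (\<psi>' z v) - Re z * Im v)) (at z within ball 0 1)"
      by (rule has_derivative_transform[OF z(2), rotated]) (simp add: \<sigma>'_def)
    then show ?thesis using at_within_open[OF z(2) open_ball] by simp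
  next
    case False
    then have z: "z \<in> - cball 0 r" using r by auto
    have o: "open (- cball (0::complex) r)" by (simp add: open_Compl)
    have "(\<psi> has_derivative (\<lambda>v. v)) (at z)"
      by (rule has_derivative_transform_within_open[OF has_derivative_ident o z]) (simp add: id)
    then have "\<psi>' z = (\<lambda>v. v)" using has_derivative_unique[OF \<psi>'] by blast
    moreover have "(\<sigma>' has_derivative (\<lambda>v. 0)) (at z)"
      by (rule has_derivative_transform_within_open[OF has_derivative_const o z]) (simp add: \<sigma>'_0)
    ultimately show ?thesis using id[of z] z by simp
  qed
  note \<sigma>' = this
  have "\<psi> ` disk \<subseteq> disk" using \<psi> \<phi>_disk[of 1] by auto
  from that[OF r(1,2) id this smooth \<psi>' \<sigma>' \<sigma>'_0] show ?thesis .
qed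

section \<open>Independence of the action from the primitive\<close>

text \<open>
  The radial integral of \<open>\<beta>\<close> has derivative \<open>\<integral> (\<beta> (s z) v + s \<beta>' (s z) v z) ds\<close>.  For closed \<open>\<beta>\<close> the arguments
  \<open>v\<close> and \<open>z\<close> may be exchanged, and the integrand becomes the derivative of \<open>s \<beta> (s z) v\<close>.
\<close>

lemma Poincare_lemma:
  fixes \<beta> :: "'a::euclidean_space \<Rightarrow> 'a \<Rightarrow> real"
  assumes S: "convex S" "0 \<in> S" and z: "z \<in> S"
    and lin: "\<And>z. z \<in> S \<Longrightarrow> linear (\<beta> z)"
    and \<beta>': "\<And>z v. z \<in> S \<Longrightarrow> ((\<lambda>z. \<beta> z v) has_derivative (\<lambda>u. \<beta>' z u v)) (at z within S)"
    and cont: "\<And>u v. continuous_on S (\<lambda>z. \<beta>' z u v)"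
    and closed: "\<And>z u v. z \<in> S \<Longrightarrow> \<beta>' z u v = \<beta>' z v u"
  shows "((\<lambda>z. integral {0..1} (\<lambda>s. \<beta> (s *\<^sub>R z) z)) has_derivative \<beta> z) (at z within S)"
proof -
  have star: "s *\<^sub>R z \<in> S" if "z \<in> S" "s \<in> {0..1}" for s z
    using convexD_alt[OF S(1,2) that(1), of s] that(2) by simp
  have lin1: "linear (\<lambda>u. \<beta>' z u v)" if "z \<in> S" for z v
    using \<beta>'[OF that] by (rule has_derivative_linear)
  have cont_\<beta>: "continuous_on S (\<lambda>z. \<beta> z v)" for v
    using \<beta>' by (rule has_derivative_continuous_on)
  have sum1: "\<beta>' z u v = (\<Sum>b\<in>Basis. (u \<bullet> b) * \<beta>' z b v)" if "z \<in> S" for z u v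
    using linear_eq_sum_Basis[OF lin1[OF that], of u] by simp
  have sum2: "\<beta>' z u v = (\<Sum>b\<in>Basis. (v \<bullet> b) * \<beta>' z u b)" if "z \<in> S" for z u v
    by (subst closed[OF that], subst sum1[OF that]) (simp add: closed[OF that, of _ u])
  have sum\<beta>: "\<beta> z v = (\<Sum>b\<in>Basis. (v \<bullet> b) * \<beta> z b)" if "z \<in> S" for z v
    using linear_eq_sum_Basis[OF lin[OF that], of v] by simp
  have scaled: "((\<lambda>z. \<beta> (s *\<^sub>R z) v) has_derivative (\<lambda>u. \<beta>' (s *\<^sub>R z) (s *\<^sub>R u) v)) (at z within S)"
    if "z \<in> S" "s \<in> {0..1}" for z s v
  proof -
    have "((\<lambda>z. s *\<^sub>R z) has_derivative (\<lambda>u. s *\<^sub>R u)) (at z within S)" by (auto intro!: derivative_eq_intros)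
    moreover have "((\<lambda>z. \<beta> z v) has_derivative (\<lambda>u. \<beta>' (s *\<^sub>R z) u v)) (at (s *\<^sub>R z) within (\<lambda>z. s *\<^sub>R z) ` S)"
      by (rule has_derivative_subset[OF \<beta>'[OF star[OF that]]]) (use star that(2) in auto)
    ultimately show ?thesis using diff_chain_within by (fastforce simp: o_def)
  qed
  have cont_scaled: "continuous_on (S \<times> {0..1}) (\<lambda>p. h (snd p *\<^sub>R fst p))" if "continuous_on S h" for h :: "'a \<Rightarrow> real"
    by (rule continuous_on_compose2[OF that]) (auto intro!: continuous_intros star)
  \<comment> \<open>The point \<open>z\<close> occurs in both arguments of \<open>\<beta> (s z) z\<close>; expanding the second one in a basis
    reduces the differentiation to the product rule.\<close>
  let ?g = "\<lambda>z s. \<Sum>b\<in>Basis. (z \<bullet> b) * \<beta> (s *\<^sub>R z) b"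
  let ?g' = "\<lambda>z s v. \<Sum>b\<in>Basis. (z \<bullet> b) * (s * (\<Sum>c\<in>Basis. (v \<bullet> c) * \<beta>' (s *\<^sub>R z) c b)) + (v \<bullet> b) * \<beta> (s *\<^sub>R z) b"
  have "((\<lambda>z. integral {0..1} (?g z)) has_derivative (\<lambda>v. integral {0..1} (\<lambda>s. ?g' z s v))) (at z within S)"
  proof (rule has_derivative_integral_param[OF S(1) z])
    fix z s assume z: "z \<in> S" and s: "s \<in> {0..1::real}"
    have eq: "\<beta>' (s *\<^sub>R z) (s *\<^sub>R u) b = s * (\<Sum>c\<in>Basis. (u \<bullet> c) * \<beta>' (s *\<^sub>R z) c b)" for u b
      using linear_scale[OF lin1[OF star[OF z s]], of s u b] by (simp add: sum1[OF star[OF z s], of u b])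
    show "((\<lambda>z. ?g z s) has_derivative ?g' z s) (at z within S)"
      by (intro has_derivative_sum has_derivative_mult scaled[OF z s, unfolded eq]
        bounded_linear_imp_has_derivative[OF bounded_linear_inner_left])
  next
    fix z assume z: "z \<in> S"
    have "continuous_on {0..1} (\<lambda>s. \<beta> (s *\<^sub>R z) b)" for b
      by (rule continuous_on_compose2[OF cont_\<beta>]) (auto intro!: continuous_intros star z)
    then show "continuous_on {0..1} (?g z)" by (intro continuous_intros)
  next
    show "continuous_on (S \<times> {0..1}) (\<lambda>(z, s). ?g' z s v)" for v
      unfolding case_prod_unfold by (intro continuous_intros cont_scaled[OF cont] cont_scaled[OF cont_\<beta>])
  qed
  moreover have "integral {0..1} (\<lambda>s. ?g' z s v) = \<beta> z v" for v
  proof -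
    have "((\<lambda>s. ?g' z s v) has_integral 1 * \<beta> (1 *\<^sub>R z) v - 0 * \<beta> (0 *\<^sub>R z) v) {0..1}"
    proof (rule fundamental_theorem_of_calculus)
      fix s :: real assume s: "s \<in> {0..1}"
      have "((\<lambda>s. s *\<^sub>R z) has_derivative (\<lambda>h. h *\<^sub>R z)) (at s within {0..1})" by (auto intro!: derivative_eq_intros)
      moreover have "((\<lambda>z. \<beta> z v) has_derivative (\<lambda>u. \<beta>' (s *\<^sub>R z) u v)) (at (s *\<^sub>R z) within (\<lambda>s. s *\<^sub>R z) ` {0..1})"
        by (rule has_derivative_subset[OF \<beta>'[OF star[OF z s]]]) (use star z in auto)
      ultimately have "((\<lambda>s. \<beta> (s *\<^sub>R z) v) has_derivative (\<lambda>h. \<beta>' (s *\<^sub>R z) (h *\<^sub>R z) v)) (at s within {0..1})"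
        using diff_chain_within by (fastforce simp: o_def)
      then have "((\<lambda>s. \<beta> (s *\<^sub>R z) v) has_real_derivative \<beta>' (s *\<^sub>R z) z v) (at s within {0..1})"
        by (rule has_derivative_imp_has_field_derivative) (simp add: linear_scale[OF lin1[OF star[OF z s]]])
      then have "((\<lambda>s. s * \<beta> (s *\<^sub>R z) v) has_real_derivative s * \<beta>' (s *\<^sub>R z) z v + 1 * \<beta> (s *\<^sub>R z) v) (at s within {0..1})"
        using DERIV_mult'[OF DERIV_ident] by blast
      moreover have "s * \<beta>' (s *\<^sub>R z) z v + 1 * \<beta> (s *\<^sub>R z) v = ?g' z s v"
      proof -
        have "\<beta>' (s *\<^sub>R z) z v = \<beta>' (s *\<^sub>R z) v z" by (rule closed[OF star[OF z s]])
        also have "\<dots> = (\<Sum>b\<in>Basis. (z \<bullet> b) * \<beta>' (s *\<^sub>R z) v b)" by (rule sum2[OF star[OF z s]])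
        also have "\<dots> = (\<Sum>b\<in>Basis. (z \<bullet> b) * (\<Sum>c\<in>Basis. (v \<bullet> c) * \<beta>' (s *\<^sub>R z) c b))"
          by (simp only: sum1[OF star[OF z s], symmetric])
        finally show ?thesis
          using sum\<beta>[OF star[OF z s], of v] by (simp add: sum.distrib sum_distrib_left mult.left_commute)
      qed
      ultimately show "((\<lambda>s. s * \<beta> (s *\<^sub>R z) v) has_vector_derivative ?g' z s v) (at s within {0..1})"
        by (simp add: has_real_derivative_iff_has_vector_derivative)
    qed simp
    then show ?thesis by (simp add: integral_unique)
  qed
  ultimately have "((\<lambda>z. integral {0..1} (?g z)) has_derivative \<beta> z) (at z within S)" by simp
  then show ?thesis
  proof (rule has_derivative_transform[OF z, rotated])
    fix y assume "y \<in> S"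
    then show "integral {0..1} (\<lambda>s. \<beta> (s *\<^sub>R y) y) = integral {0..1} (?g y)"
      by (intro integral_cong sum\<beta> star)
  qed
qed

lemma primitive_differs_by_exact:
  assumes "primitive_of_\<omega>0 \<alpha>"
  obtains f where "\<And>k. Cdiff k disk f"
    "\<And>z. z \<in> disk \<Longrightarrow> (f has_derivative (\<lambda>v. \<alpha> z v - Re z * Im v)) (at z within disk)"
proof -
  have lin: "\<And>z. z \<in> disk \<Longrightarrow> linear (\<alpha> z)" and \<alpha>: "\<And>k v. Cdiff k disk (\<lambda>z. \<alpha> z v)"
    and ext: "\<And>z u v. z \<in> disk \<Longrightarrow> ext_deriv \<alpha> z u v = \<omega>0 u v"
    using assms smooth_on_iff_Cdiff[OF closed_disk_convex_interior(1,2)]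
    by (auto simp: primitive_of_\<omega>0_def one_form_def)
  have \<alpha>': "((\<lambda>z. \<alpha> z v) has_derivative disk_deriv (\<lambda>z. \<alpha> z v) z) (at z within disk)" if "z \<in> disk" for z v
    by (rule Cdiff_has_frechet_derivative[OF \<alpha>[of "Suc 0"] that])
  define \<beta> where "\<beta> z v = \<alpha> z v - Re z * Im v" for z v
  define \<beta>' where "\<beta>' z u v = disk_deriv (\<lambda>z. \<alpha> z v) z u - Re u * Im v" for z u v
  have "((\<lambda>z. integral {0..1} (\<lambda>s. \<beta> (s *\<^sub>R z) z)) has_derivative \<beta> z) (at z within disk)" if "z \<in> disk" for z
  proof (rule Poincare_lemma[where \<beta>' = \<beta>'])
    show "linear (\<beta> z)" if "z \<in> disk" for z
      unfolding \<beta>_def using lin[OF that]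
      by (intro linear_compose_sub) (auto intro!: linearI simp: algebra_simps)
    show "((\<lambda>z. \<beta> z v) has_derivative (\<lambda>u. \<beta>' z u v)) (at z within disk)" if "z \<in> disk" for z v
      unfolding \<beta>_def \<beta>'_def by (intro has_derivative_diff \<alpha>' that)
        (auto intro!: derivative_eq_intros)
    show "continuous_on disk (\<lambda>z. \<beta>' z u v)" for u v
      unfolding \<beta>'_def
      by (intro continuous_intros Cdiff_continuous_on[OF Cdiff_derivative[OF closed_disk_convex_interior(1,2) \<alpha>[of "Suc 0"] \<alpha>']])
    show "\<beta>' z u v = \<beta>' z v u" if "z \<in> disk" for z u v
      using ext[OF that, of u v] by (simp add: \<beta>'_def ext_deriv_def \<omega>0_def algebra_simps)
  qed (use that in auto)
  then have f: "((\<lambda>z. integral {0..1} (\<lambda>s. \<beta> (s *\<^sub>R z) z)) has_derivative (\<lambda>v. \<alpha> z v - Re z * Im v)) (at z within disk)" if "z \<in> disk" for z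
    using that by (simp add: \<beta>_def[abs_def])
  show ?thesis
  proof (rule that)
    show "Cdiff k disk (\<lambda>z. integral {0..1} (\<lambda>s. \<beta> (s *\<^sub>R z) z))" for k
      by (rule Cdiff_has_derivative[OF f])
        (auto intro!: Cdiff_diff Cdiff_mult \<alpha> Cdiff_Re Cdiff_ident Cdiff_const simp del: Cdiff.simps)
  qed (rule f)
qed

text \<open>
  If \<open>\<alpha> = x dy + df\<close>, then \<open>\<sigma> + f \<circ> \<psi> - f\<close> is the action function for \<open>\<alpha>\<close>; at a fixed point it has the
  same value as \<open>\<sigma>\<close>.
\<close>

lemma action_at_fixed_point:
  assumes \<alpha>: "primitive_of_\<omega>0 \<alpha>"
    and \<psi>: "\<psi> ` disk \<subseteq> disk" "\<And>z. norm z = 1 \<Longrightarrow> \<psi> z = z" "\<And>k. Cdiff k UNIV \<psi>" "\<And>z. (\<psi> has_derivative \<psi>' z) (at z)"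
    and \<sigma>: "\<And>z. (\<sigma> has_derivative (\<lambda>v. Re (\<psi> z) * Im (\<psi>' z v) - Re z * Im v)) (at z)"
      "\<And>z. norm z = 1 \<Longrightarrow> \<sigma> z = 0"
    and p: "p \<in> disk" "\<psi> p = p"
  shows "action \<psi> \<alpha> p = \<sigma> p"
proof -
  obtain f where f: "\<And>k. Cdiff k disk f"
    "\<And>z. z \<in> disk \<Longrightarrow> (f has_derivative (\<lambda>v. \<alpha> z v - Re z * Im v)) (at z within disk)"
    using primitive_differs_by_exact[OF \<alpha>] by blast
  define \<tau> where "\<tau> z = \<sigma> z + (f (\<psi> z) - f z)" for z
  have \<psi>_disk: "\<psi> z \<in> disk" if "z \<in> disk" for z using \<psi>(1) that by blast
  have \<psi>'_k: "Cdiff k UNIV (\<lambda>z. \<psi>' z v)" for k v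
    by (rule Cdiff_derivative[OF _ _ \<psi>(3)]) (use \<psi>(4) in auto)
  have \<psi>'_disk: "disk_deriv \<psi> z = \<psi>' z" if "z \<in> disk" for z
    by (rule frechet_derivative_within_convex[OF closed_disk_convex_interior(1,2) has_derivative_at_withinI[OF \<psi>(4)] that])
  have "Cdiff k UNIV \<sigma>" for k
    by (rule Cdiff_has_derivative) (auto intro!: \<sigma>(1) Cdiff_diff Cdiff_mult Cdiff_Re Cdiff_Im \<psi>(3) \<psi>'_k Cdiff_ident Cdiff_const simp del: Cdiff.simps)
  then have "Cdiff k disk \<sigma>" for k by (rule Cdiff_subset) simp
  moreover have "Cdiff k disk (\<lambda>z. f (\<psi> z))" for k
    by (rule Cdiff_compose[OF f(1) Cdiff_subset[OF \<psi>(3)] \<psi>_disk]) simp_all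
  ultimately have "Cdiff k disk \<tau>" for k
    unfolding \<tau>_def by (intro Cdiff_add Cdiff_diff f(1))
  then have "smooth_on disk \<tau>" using smooth_on_iff_Cdiff[OF closed_disk_convex_interior(1,2)] by blast
  moreover have "pullback \<psi> \<alpha> z v - \<alpha> z v = disk_deriv \<tau> z v" if z: "z \<in> disk" for z v
  proof -
    have "((\<lambda>z. f (\<psi> z)) has_derivative (\<lambda>v. \<alpha> (\<psi> z) (\<psi>' z v) - Re (\<psi> z) * Im (\<psi>' z v))) (at z within disk)"
      using diff_chain_within[OF has_derivative_at_withinI[OF \<psi>(4)] has_derivative_subset[OF f(2)[OF \<psi>_disk[OF z]] \<psi>(1)]]
      by (simp add: o_def)
    from has_derivative_add[OF has_derivative_at_withinI[OF \<sigma>(1)] has_derivative_diff[OF this f(2)[OF z]]]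
    have "(\<tau> has_derivative (\<lambda>v. \<alpha> (\<psi> z) (\<psi>' z v) - \<alpha> z v)) (at z within disk)"
      by (simp add: \<tau>_def[abs_def])
    from frechet_derivative_within_convex[OF closed_disk_convex_interior(1,2) this z]
    show ?thesis by (simp add: pullback_def \<psi>'_disk[OF z])
  qed
  moreover have "\<tau> z = 0" if "z \<in> sphere 0 1" for z using \<psi>(2) \<sigma>(2) that by (simp add: \<tau>_def)
  ultimately have "is_action_function \<psi> \<alpha> \<tau>" by (simp add: is_action_function_def)
  from action_eq[OF this p(1)] show ?thesis using p(2) by (simp add: \<tau>_def)
qed

section \<open>Fixed points of contractions depending on parameters\<close>

lemma contraction_fixed_point:
  fixes f :: "real \<Rightarrow> real"
  assumes "\<And>a b. \<bar>f a - f b\<bar> \<le> \<bar>a - b\<bar> / 2"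
  shows "\<exists>!x. x = f x"
proof -
  have "\<exists>!x. f x = x"
    by (rule banach_fix_type[where c = "1/2"]) (use assms in \<open>auto simp: dist_real_def\<close>)
  then show ?thesis by (simp add: eq_commute)
qed

lemma parametrized_fixed_point_bound:
  fixes f :: "'p \<times> real \<Rightarrow> real"
  assumes lip: "\<And>a b. \<bar>f (q, a) - f (q, b)\<bar> \<le> \<bar>a - b\<bar> / 2"
    and "s q = f (q, s q)" "s p = f (p, s p)"
  shows "\<bar>s q - s p\<bar> \<le> 2 * \<bar>f (q, s p) - f (p, s p)\<bar>"
proof -
  have "\<bar>s q - s p\<bar> \<le> \<bar>f (q, s q) - f (q, s p)\<bar> + \<bar>f (q, s p) - f (p, s p)\<bar>"
    using abs_triangle_ineq[of "f (q, s q) - f (q, s p)" "f (q, s p) - f (p, s p)"]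
    by (simp add: assms(2,3)[symmetric])
  also have "\<bar>f (q, s q) - f (q, s p)\<bar> \<le> \<bar>s q - s p\<bar> / 2" by (rule lip)
  finally show ?thesis by (simp add: field_simps)
qed

lemma parametrized_fixed_point_continuous:
  fixes f :: "'p::metric_space \<times> real \<Rightarrow> real"
  assumes f: "continuous_on (P \<times> UNIV) f"
    and lip: "\<And>p a b. p \<in> P \<Longrightarrow> \<bar>f (p, a) - f (p, b)\<bar> \<le> \<bar>a - b\<bar> / 2"
    and s: "\<And>p. p \<in> P \<Longrightarrow> s p = f (p, s p)"
  shows "continuous_on P s"
  unfolding continuous_on_iff
proof (intro ballI allI impI)
  fix p :: 'p and e :: real assume p: "p \<in> P" and e: "e > 0"
  have "continuous_on P (\<lambda>q. f (q, s p))"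
    by (rule continuous_on_compose2[OF f]) (auto intro!: continuous_intros)
  then obtain d where d: "d > 0" "\<And>q. q \<in> P \<Longrightarrow> dist q p < d \<Longrightarrow> dist (f (q, s p)) (f (p, s p)) < e / 2"
    using p half_gt_zero[OF e] unfolding continuous_on_iff by blast
  have "dist (s q) (s p) < e" if "q \<in> P" "dist q p < d" for q
    using parametrized_fixed_point_bound[OF lip[OF that(1)] s[OF that(1)] s[OF p]] d(2)[OF that]
    by (simp add: dist_real_def)
  then show "\<exists>d>0. \<forall>q\<in>P. dist q p < d \<longrightarrow> dist (s q) (s p) < e" using d(1) by blast
qed

lemma half_Lipschitz_derivative_le:
  fixes f :: "'p::real_normed_vector \<times> real \<Rightarrow> real"
  assumes f': "(f has_derivative f') (at (p, c) within P \<times> UNIV)" and p: "p \<in> P"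
    and lip: "\<And>a b. \<bar>f (p, a) - f (p, b)\<bar> \<le> \<bar>a - b\<bar> / 2"
  shows "f' (0, 1) \<le> 1 / 2"
proof (rule field_le_epsilon)
  fix e :: real assume "e > 0"
  then obtain d where d: "d > 0"
    "\<And>y. y \<in> P \<times> UNIV \<Longrightarrow> norm (y - (p, c)) < d \<Longrightarrow> norm (f y - f (p, c) - f' (y - (p, c))) \<le> e * norm (y - (p, c))"
    using f' unfolding has_derivative_within_alt by blast
  define h where "h = d / 2"
  have h: "h > 0" "h < d" using d(1) by (simp_all add: h_def)
  have "\<bar>f (p, c + h) - f (p, c) - f' (0, h)\<bar> \<le> e * h"
    using d(2)[of "(p, c + h)"] p h by (simp add: norm_Pair)
  then have "f' (0, h) \<le> f (p, c + h) - f (p, c) + e * h" by (simp add: abs_le_iff)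
  moreover have "f' (0, h) = h * f' (0, 1)"
    using linear_scale[OF has_derivative_linear[OF f'], of h "(0, 1)"] by simp
  moreover have "f (p, c + h) - f (p, c) \<le> h / 2"
    using order_trans[OF abs_ge_self lip[of "c + h" c]] h by simp
  ultimately have "h * f' (0, 1) \<le> h * (1 / 2 + e)" by (simp add: algebra_simps)
  then show "f' (0, 1) \<le> 1 / 2 + e" using h by simp
qed

text \<open>
  The derivative is found by differentiating \<open>s p = f (p, s p)\<close> and solving for the derivative of \<open>s\<close>,
  which is possible since the derivative of \<open>f\<close> in the last variable is at most \<open>1/2\<close>.  The parameter
  set is arbitrary; in particular it may be \<open>[0,1] \<times> \<complex>\<close>, where time has one-sided derivatives.
\<close>

lemma parametrized_fixed_point_derivative:
  fixes f :: "'p::real_normed_vector \<times> real \<Rightarrow> real"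
  assumes f': "(f has_derivative f') (at (p, s p) within P \<times> UNIV)" and p: "p \<in> P"
    and cont: "continuous_on P s"
    and lip: "\<And>a b. \<bar>f (p, a) - f (p, b)\<bar> \<le> \<bar>a - b\<bar> / 2"
    and s: "\<And>p. p \<in> P \<Longrightarrow> s p = f (p, s p)"
  shows "(s has_derivative (\<lambda>h. f' (h, 0) * inverse (1 - f' (0, 1)))) (at p within P)"
  unfolding has_derivative_within_alt
proof (intro conjI allI impI)
  have bl: "bounded_linear f'" using f' by (rule has_derivative_bounded_linear)
  have "bounded_linear (\<lambda>h. f' (h, 0))"
    by (intro bounded_linear_compose[OF bl] bounded_linear_Pair bounded_linear_ident bounded_linear_zero)
  then show "bounded_linear (\<lambda>h. f' (h, 0) * inverse (1 - f' (0, 1)))"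
    by (rule bounded_linear_compose[OF bounded_linear_mult_left])
  obtain K where K: "\<And>w. norm (f' w) \<le> norm w * K" "K > 0"
    using bounded_linear.pos_bounded[OF bl] by blast
  define D where "D = f' (0, 1)"
  have D: "1 - D \<ge> 1 / 2" using half_Lipschitz_derivative_le[OF f' p lip] by (simp add: D_def)
  fix e :: real assume e: "e > 0"
  \<comment> \<open>With \<open>e' \<le> 1/4\<close> the error term can be absorbed, which gives \<open>|q - p| + |s q - s p| \<le> (4 K + 2) |q - p|\<close>;
    the second bound then turns the error \<open>2 e' (|q - p| + |s q - s p|)\<close> into \<open>e |q - p|\<close>.\<close>
  define e' where "e' = min (1 / 4) (e / (2 * (4 * K + 2)))"
  have e': "e' > 0" "e' \<le> 1 / 4" "2 * e' * (4 * K + 2) \<le> e"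
  proof -
    have "e' \<le> e / (2 * (4 * K + 2))" by (simp add: e'_def)
    then show "2 * e' * (4 * K + 2) \<le> e" using K(2) by (simp add: field_simps)
    show "e' \<le> 1 / 4" by (simp only: e'_def min.cobounded1)
  qed (use e K(2) in \<open>simp add: e'_def\<close>)
  obtain d where d: "d > 0"
    "\<And>y. y \<in> P \<times> UNIV \<Longrightarrow> norm (y - (p, s p)) < d \<Longrightarrow> norm (f y - f (p, s p) - f' (y - (p, s p))) \<le> e' * norm (y - (p, s p))"
    using f' e'(1) unfolding has_derivative_within_alt by blast
  obtain d2 where d2: "d2 > 0" "\<And>q. q \<in> P \<Longrightarrow> dist q p < d2 \<Longrightarrow> dist (s q) (s p) < d / 2"
    using cont p half_gt_zero[OF d(1)] unfolding continuous_on_iff by blast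
  have "norm (s q - s p - f' (q - p, 0) * inverse (1 - f' (0, 1))) \<le> e * norm (q - p)"
    if q: "q \<in> P" and dq: "norm (q - p) < min d2 (d / 2)" for q
  proof -
    define \<delta> where "\<delta> = s q - s p"
    define a where "a = f' (q - p, 0)"
    define R where "R = f (q, s q) - f (p, s p) - f' (q - p, \<delta>)"
    have "\<bar>\<delta>\<bar> < d / 2" using d2(2)[OF q] dq by (simp add: dist_norm \<delta>_def)
    then have "norm (q - p, \<delta>) < d" using norm_Pair_le[of "q - p" \<delta>] dq by simp
    then have "\<bar>R\<bar> \<le> e' * norm (q - p, \<delta>)"
      using d(2)[of "(q, s q)"] q by (simp add: R_def \<delta>_def)
    also have "\<dots> \<le> e' * (norm (q - p) + \<bar>\<delta>\<bar>)"
      using e'(1) norm_Pair_le[of "q - p" \<delta>] by (intro mult_left_mono) auto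
    finally have R: "\<bar>R\<bar> \<le> e' * (norm (q - p) + \<bar>\<delta>\<bar>)" .
    have "f' (q - p, \<delta>) = a + \<delta> * D"
      using linear_add[OF bounded_linear.linear[OF bl], of "(q - p, 0)" "(0, \<delta>)"]
        linear_scale[OF bounded_linear.linear[OF bl], of \<delta> "(0, 1)"] by (simp add: a_def D_def)
    then have \<delta>_eq: "(1 - D) * \<delta> = a + R"
      using s[OF q] s[OF p] by (simp add: R_def \<delta>_def algebra_simps)
    have \<delta>_eq': "\<delta> = a * inverse (1 - D) + R * inverse (1 - D)"
    proof -
      have "\<delta> = ((1 - D) * \<delta>) * inverse (1 - D)" using D by simp
      then show ?thesis by (simp only: \<delta>_eq distrib_right)
    qed
    have inv: "0 \<le> inverse (1 - D)" "inverse (1 - D) \<le> 2"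
      using D le_imp_inverse_le[of "1 / 2" "1 - D"] by auto
    have "\<bar>R * inverse (1 - D)\<bar> \<le> \<bar>R\<bar> * 2" using inv by (simp add: abs_mult mult_left_mono)
    with R have R2: "\<bar>R * inverse (1 - D)\<bar> \<le> 2 * e' * (norm (q - p) + \<bar>\<delta>\<bar>)" by linarith
    have "\<bar>a\<bar> \<le> K * norm (q - p)" using K(1)[of "(q - p, 0)"] by (simp add: a_def norm_Pair mult.commute)
    then have "\<bar>a * inverse (1 - D)\<bar> \<le> (K * norm (q - p)) * 2"
      unfolding abs_mult using inv by (intro mult_mono) auto
    then have "\<bar>\<delta>\<bar> \<le> 2 * K * norm (q - p) + 2 * e' * (norm (q - p) + \<bar>\<delta>\<bar>)"
      using R2 \<delta>_eq' by linarith
    also have "2 * e' * (norm (q - p) + \<bar>\<delta>\<bar>) \<le> 1 / 2 * (norm (q - p) + \<bar>\<delta>\<bar>)"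
      using e'(2) by (intro mult_right_mono) auto
    finally have \<delta>: "norm (q - p) + \<bar>\<delta>\<bar> \<le> (4 * K + 2) * norm (q - p)" by (simp add: algebra_simps)
    have "norm (s q - s p - f' (q - p, 0) * inverse (1 - f' (0, 1))) = \<bar>R * inverse (1 - D)\<bar>"
      using \<delta>_eq' by (simp add: \<delta>_def[symmetric] a_def D_def)
    also have "\<dots> \<le> 2 * e' * ((4 * K + 2) * norm (q - p))"
      using R2 mult_left_mono[OF \<delta>, of "2 * e'"] e'(1) by linarith
    also have "\<dots> \<le> e * norm (q - p)"
      using mult_right_mono[OF e'(3), of "norm (q - p)"] by (simp add: mult.assoc)
    finally show ?thesis .
  qed
  moreover have "min d2 (d / 2) > 0" using d d2 by simp
  ultimately show "\<exists>d>0. \<forall>q\<in>P. norm (q - p) < d \<longrightarrow> norm (s q - s p - f' (q - p, 0) * inverse (1 - f' (0, 1))) \<le> e * norm (q - p)"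
    by blast
qed

lemma parametrized_fixed_point_Cdiff:
  fixes f :: "'p::euclidean_space \<times> real \<Rightarrow> real"
  assumes f: "Cdiff k (P \<times> UNIV) f"
    and lip: "\<And>p a b. p \<in> P \<Longrightarrow> \<bar>f (p, a) - f (p, b)\<bar> \<le> \<bar>a - b\<bar> / 2"
    and s: "\<And>p. p \<in> P \<Longrightarrow> s p = f (p, s p)"
  shows "Cdiff k P s"
  using f
proof (induction k)
  case 0
  then show ?case using parametrized_fixed_point_continuous[of P f s] lip s by simp
next
  case (Suc k)
  obtain f' where f': "\<And>x. x \<in> P \<times> UNIV \<Longrightarrow> (f has_derivative f' x) (at x within P \<times> UNIV)" "\<And>v. Cdiff k (P \<times> UNIV) (\<lambda>x. f' x v)"
    using Cdiff_SucE Suc.prems by blast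
  have s_k: "Cdiff k P s" by (rule Suc.IH[OF Cdiff_Suc_imp[OF Suc.prems]])
  have f'_k: "Cdiff k P (\<lambda>p. f' (p, s p) v)" for v
    by (rule Cdiff_compose[OF f'(2) Cdiff_Pair[OF Cdiff_ident s_k]]) simp
  show ?case
  proof (rule Cdiff_SucI)
    fix p assume p: "p \<in> P"
    show "(s has_derivative (\<lambda>h. f' (p, s p) (h, 0) * inverse (1 - f' (p, s p) (0, 1)))) (at p within P)"
      by (rule parametrized_fixed_point_derivative[OF f'(1) p Cdiff_continuous_on[OF s_k] lip[OF p] s]) (use p in auto)
  next
    fix h
    have "1 - f' (p, s p) (0, 1) \<noteq> 0" if "p \<in> P" for p
      using half_Lipschitz_derivative_le[OF f'(1) that lip[OF that], of "s p"] that by auto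
    then show "Cdiff k P (\<lambda>p. f' (p, s p) (h, 0) * inverse (1 - f' (p, s p) (0, 1)))"
      by (intro Cdiff_mult Cdiff_inverse Cdiff_diff Cdiff_const f'_k)
  qed
qed

section \<open>Symmetry of second derivatives\<close>

text \<open>
  Write \<open>W (p + s v) - W p = s \<integral> B (p + \<tau> s v) v d\<tau>\<close> and differentiate in \<open>p\<close> in the direction \<open>u\<close>: the difference
  quotient of \<open>B \<sqdot> u\<close> along \<open>v\<close> equals \<open>\<integral> B' (q + \<tau> s v) u v d\<tau>\<close>, which tends to \<open>B' q u v\<close> as \<open>s \<rightarrow> 0\<close>.
\<close>

lemma second_derivative_symmetric:
  fixes W :: "'a::euclidean_space \<Rightarrow> real"
  assumes W': "\<And>q. (W has_derivative B q) (at q)"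
    and B': "\<And>q v. ((\<lambda>q. B q v) has_derivative (\<lambda>u. B' q u v)) (at q)"
    and cont: "\<And>u v. continuous_on UNIV (\<lambda>q. B' q u v)"
  shows "B' q u v = B' q v u"
proof -
  have linB: "linear (B q)" for q using W' by (rule has_derivative_linear)
  have linB': "linear (\<lambda>u. B' q u v)" for q v using B' by (rule has_derivative_linear)
  have contB: "continuous_on UNIV (\<lambda>q. B q v)" for v
    by (rule has_derivative_continuous_on[where f' = "\<lambda>q u. B' q u v"]) (simp add: B')
  define J where "J s = integral {0..1} (\<lambda>\<tau>. B' (q + (\<tau> * s) *\<^sub>R v) u v)" for s
  have incr: "W (p + s *\<^sub>R v) - W p = s * integral {0..1} (\<lambda>\<tau>. B (p + (\<tau> * s) *\<^sub>R v) v)" for p s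
  proof -
    have "((\<lambda>\<tau>. s * B (p + (\<tau> * s) *\<^sub>R v) v) has_integral W (p + (1 * s) *\<^sub>R v) - W (p + (0 * s) *\<^sub>R v)) {0..1}"
    proof (rule fundamental_theorem_of_calculus)
      fix \<tau> :: real
      have "((\<lambda>\<tau>. p + (\<tau> * s) *\<^sub>R v) has_derivative (\<lambda>h. (h * s) *\<^sub>R v)) (at \<tau> within {0..1})"
        by (auto intro!: derivative_eq_intros)
      from diff_chain_within[OF this has_derivative_at_withinI[OF W']]
      have "((\<lambda>\<tau>. W (p + (\<tau> * s) *\<^sub>R v)) has_derivative (\<lambda>h. B (p + (\<tau> * s) *\<^sub>R v) ((h * s) *\<^sub>R v))) (at \<tau> within {0..1})"
        by (simp add: o_def)
      then show "((\<lambda>\<tau>. W (p + (\<tau> * s) *\<^sub>R v)) has_vector_derivative s * B (p + (\<tau> * s) *\<^sub>R v) v) (at \<tau> within {0..1})"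
        by (simp add: has_vector_derivative_def linear_scale[OF linB] mult.assoc)
    qed simp
    then show ?thesis by (simp add: has_integral_iff)
  qed
  have quot: "B (q + s *\<^sub>R v) u - B q u = s * J s" for s
  proof -
    have "((\<lambda>p. integral {0..1} (\<lambda>\<tau>. B (p + (\<tau> * s) *\<^sub>R v) v)) has_derivative
        (\<lambda>u. integral {0..1} (\<lambda>\<tau>. B' (q + (\<tau> * s) *\<^sub>R v) u v))) (at q within UNIV)"
    proof (rule has_derivative_integral_param)
      fix p \<tau>
      have "((\<lambda>p. p + (\<tau> * s) *\<^sub>R v) has_derivative (\<lambda>h. h)) (at p)" by (auto intro!: derivative_eq_intros)
      from diff_chain_at[OF this B']
      show "((\<lambda>p. B (p + (\<tau> * s) *\<^sub>R v) v) has_derivative (\<lambda>u. B' (p + (\<tau> * s) *\<^sub>R v) u v)) (at p within UNIV)"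
        by (simp add: o_def)
    next
      show "continuous_on {0..1} (\<lambda>\<tau>. B (p + (\<tau> * s) *\<^sub>R v) v)" for p
        by (rule continuous_on_compose2[OF contB]) (auto intro!: continuous_intros)
      show "continuous_on (UNIV \<times> {0..1}) (\<lambda>(p, \<tau>). B' (p + (\<tau> * s) *\<^sub>R v) w v)" for w
        unfolding case_prod_unfold by (rule continuous_on_compose2[OF cont]) (auto intro!: continuous_intros)
    qed auto
    from has_derivative_mult_right[OF this, of s]
    have 1: "((\<lambda>p. W (p + s *\<^sub>R v) - W p) has_derivative (\<lambda>u. s * integral {0..1} (\<lambda>\<tau>. B' (q + (\<tau> * s) *\<^sub>R v) u v))) (at q)"
      by (simp add: incr)
    have "((\<lambda>p. p + s *\<^sub>R v) has_derivative (\<lambda>h. h)) (at q)" by (auto intro!: derivative_eq_intros)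
    from diff_chain_at[OF this W'] have "((\<lambda>p. W (p + s *\<^sub>R v)) has_derivative B (q + s *\<^sub>R v)) (at q)"
      by (simp add: o_def)
    from has_derivative_unique[OF has_derivative_diff[OF this W'] 1] show ?thesis
      by (simp add: J_def fun_eq_iff)
  qed
  have J: "continuous_on UNIV J"
  proof -
    have "continuous_on (UNIV \<times> cbox 0 1) (\<lambda>p::real \<times> real. B' (q + (snd p * fst p) *\<^sub>R v) u v)"
      by (rule continuous_on_compose2[OF cont]) (auto intro!: continuous_intros)
    then have "continuous_on (UNIV \<times> cbox 0 1) (\<lambda>(s, \<tau>). B' (q + (\<tau> * s) *\<^sub>R v) u v)"
      by (simp add: case_prod_unfold)
    from integral_continuous_on_param[OF this] show ?thesis by (simp add: J_def[abs_def])
  qed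
  have "((\<lambda>s. q + s *\<^sub>R v) has_derivative (\<lambda>h. h *\<^sub>R v)) (at 0)" by (auto intro!: derivative_eq_intros)
  from diff_chain_at[OF this, of "\<lambda>q. B q u" "\<lambda>w. B' q w u"] B'[of u q]
  have "((\<lambda>s. B (q + s *\<^sub>R v) u) has_derivative (\<lambda>h. B' q (h *\<^sub>R v) u)) (at 0)" by (simp add: o_def)
  then have "((\<lambda>s. B (q + s *\<^sub>R v) u) has_real_derivative B' q v u) (at 0)"
    by (rule has_derivative_imp_has_field_derivative) (simp add: linear_scale[OF linB'])
  then have "(\<lambda>s. (B (q + s *\<^sub>R v) u - B (q + 0 *\<^sub>R v) u) / s) \<midarrow>0\<rightarrow> B' q v u"
    by (simp add: DERIV_def)
  then have "J \<midarrow>0\<rightarrow> B' q v u"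
    by (rule Lim_transform_eventually) (auto simp: eventually_at quot intro!: exI[of _ 1])
  moreover have "J \<midarrow>0\<rightarrow> J 0" using J by (simp add: continuous_on_eq_continuous_at isCont_def)
  ultimately have "B' q v u = J 0" by (rule LIM_unique)
  then show ?thesis by (simp add: J_def)
qed

section \<open>Generating functions of maps near the identity\<close>

lemma cmod_Complex_diff:
  "cmod (Complex a y - Complex b y) = \<bar>a - b\<bar>" "cmod (Complex x a - Complex x b) = \<bar>a - b\<bar>"
  by (simp_all add: cmod_def)

text \<open>
  Points of the plane are written as complex numbers \<open>x + \<i> y\<close>.  The constant \<open>1/5\<close> is chosen such that
  in the mixed coordinates the displacement is Lipschitz with constant \<open>1/4\<close>, see \<open>ac_Lipschitz\<close>; then the
  equations that define the isotopy below are contractions with constant \<open>1/2\<close>.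
\<close>

locale near_identity_map =
  fixes \<psi> :: "complex \<Rightarrow> complex" and \<psi>' :: "complex \<Rightarrow> complex \<Rightarrow> complex"
    and \<sigma> :: "complex \<Rightarrow> real" and r :: real
  assumes r: "0 < r" "r < 1"
    and id_outside: "\<And>z. r \<le> norm z \<Longrightarrow> \<psi> z = z"
    and \<psi>_Cdiff: "\<And>k. Cdiff k UNIV \<psi>"
    and \<psi>': "\<And>z. (\<psi> has_derivative \<psi>' z) (at z)"
    and near_identity: "\<And>z v. norm (\<psi>' z v - v) \<le> norm v / 5"
    and \<sigma>': "\<And>z. (\<sigma> has_derivative (\<lambda>v. Re (\<psi> z) * Im (\<psi>' z v) - Re z * Im v)) (at z)"
    and \<sigma>_outside: "\<And>z. r \<le> norm z \<Longrightarrow> \<sigma> z = 0"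
begin

lemma displacement_Lipschitz: "norm ((\<psi> z - z) - (\<psi> w - w)) \<le> norm (z - w) / 5"
proof -
  have "norm ((\<psi> z - z) - (\<psi> w - w)) \<le> 1 / 5 * norm (z - w)"
  proof (rule differentiable_bound[of UNIV "\<lambda>z. \<psi> z - z" "\<lambda>z v. \<psi>' z v - v"])
    show "((\<lambda>z. \<psi> z - z) has_derivative (\<lambda>v. \<psi>' x v - v)) (at x within UNIV)" for x
      by (intro has_derivative_diff \<psi>' has_derivative_ident)
    show "onorm (\<lambda>v. \<psi>' x v - v) \<le> 1 / 5" for x
      by (rule onorm_bound) (use near_identity in auto)
  qed auto
  then show ?thesis by simp
qed

subsection \<open>Mixed coordinates\<close>

text \<open>
  For \<open>q = X + \<i> y\<close>, the value \<open>g q\<close> is the solution \<open>x\<close> of \<open>X(x, y) = X\<close>, written as a fixed point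
  equation, and \<open>G q\<close> is the point \<open>(x, y)\<close> with mixed coordinates \<open>q\<close>.  The displacements \<open>X - x\<close> and \<open>Y - y\<close>
  as functions of \<open>q\<close> are \<open>a\<close> and \<open>c\<close>.
\<close>

definition g :: "complex \<Rightarrow> real" where
  "g q = (THE x. x = Re q - (Re (\<psi> (Complex x (Im q))) - x))"

definition G :: "complex \<Rightarrow> complex" where
  "G q = Complex (g q) (Im q)"

definition a :: "complex \<Rightarrow> real" where
  "a q = Re q - g q"

definition c :: "complex \<Rightarrow> real" where
  "c q = Im (\<psi> (G q)) - Im q"

lemma g_contraction:
  "\<bar>(Re q - (Re (\<psi> (Complex x (Im q))) - x)) - (Re q - (Re (\<psi> (Complex y (Im q))) - y))\<bar> \<le> \<bar>x - y\<bar> / 2"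
proof -
  let ?z = "Complex x (Im q)" and ?w = "Complex y (Im q)"
  have "\<bar>Re ((\<psi> ?z - ?z) - (\<psi> ?w - ?w))\<bar> \<le> norm (?z - ?w) / 5"
    using displacement_Lipschitz abs_Re_le_cmod order_trans by blast
  also have "\<dots> \<le> \<bar>x - y\<bar> / 2" by (simp add: cmod_Complex_diff)
  finally show ?thesis by (simp add: abs_minus_commute algebra_simps)
qed

lemma g_eq: "g q = Re q - (Re (\<psi> (G q)) - g q)"
  unfolding G_def g_def by (rule theI'[OF contraction_fixed_point[OF g_contraction]])

lemma g_unique: "Re (\<psi> (Complex x (Im q))) = Re q \<Longrightarrow> g q = x"
  unfolding g_def by (rule the1_equality[OF contraction_fixed_point[OF g_contraction]]) simp

lemma \<psi>_G: "\<psi> (G q) = Complex (Re q) (Im q + c q)"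
  using g_eq[of q] by (simp add: complex_eq_iff c_def)

lemma displacement_G: "\<psi> (G q) - G q = Complex (a q) (c q)"
  by (simp add: \<psi>_G a_def, simp add: G_def complex_eq_iff)

lemma g_Cdiff: "Cdiff k UNIV g"
proof (rule parametrized_fixed_point_Cdiff[where f = "\<lambda>p. Re (fst p) - (Re (\<psi> (Complex (snd p) (Im (fst p)))) - snd p)"])
  show "Cdiff k (UNIV \<times> UNIV) (\<lambda>p. Re (fst p) - (Re (\<psi> (Complex (snd p) (Im (fst p)))) - snd p))"
    by (intro Cdiff_diff Cdiff_Re Cdiff_fst Cdiff_snd Cdiff_ident Cdiff_compose[OF \<psi>_Cdiff] Cdiff_Complex Cdiff_Im UNIV_I)
qed (use g_contraction g_eq in \<open>simp_all add: G_def\<close>)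

lemma G_Cdiff: "Cdiff k UNIV G"
  unfolding G_def[abs_def] by (intro Cdiff_Complex g_Cdiff Cdiff_Im Cdiff_ident)

lemma a_Cdiff: "Cdiff k UNIV a"
  unfolding a_def[abs_def] by (intro Cdiff_diff g_Cdiff Cdiff_Re Cdiff_ident)

lemma c_Cdiff: "Cdiff k UNIV c"
  unfolding c_def[abs_def] by (intro Cdiff_diff Cdiff_Im Cdiff_compose[OF \<psi>_Cdiff G_Cdiff] Cdiff_ident UNIV_I)

text \<open>
  Since \<open>G q = q - a q\<close>, the estimate \<open>|a q - a p| \<le> |G q - G p| / 5\<close> gives \<open>|G q - G p| \<le> 5/4 |q - p|\<close>, and
  the displacement \<open>a + \<i> c\<close> is the \<open>1/5\<close>-Lipschitz displacement of \<open>\<psi>\<close> composed with \<open>G\<close>.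
\<close>

lemma ac_Lipschitz: "\<bar>a q - a p\<bar> \<le> norm (q - p) / 4" "\<bar>c q - c p\<bar> \<le> norm (q - p) / 4"
proof -
  have u: "norm (Complex (a q) (c q) - Complex (a p) (c p)) \<le> norm (G q - G p) / 5"
    using displacement_Lipschitz[of "G q" "G p"] by (simp only: displacement_G)
  have a: "\<bar>a q - a p\<bar> \<le> norm (G q - G p) / 5"
    using order_trans[OF abs_Re_le_cmod u] by simp
  have c: "\<bar>c q - c p\<bar> \<le> norm (G q - G p) / 5"
    using order_trans[OF abs_Im_le_cmod u] by simp
  have "G q - G p = (q - p) - of_real (a q - a p)" by (simp add: G_def a_def complex_eq_iff)
  then have "norm (G q - G p) \<le> norm (q - p) + \<bar>a q - a p\<bar>"
    using norm_triangle_ineq4[of "q - p" "of_real (a q - a p)"] by (simp only: norm_of_real)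
  with a have "norm (G q - G p) / 5 \<le> norm (q - p) / 4" by simp
  with a c show "\<bar>a q - a p\<bar> \<le> norm (q - p) / 4" "\<bar>c q - c p\<bar> \<le> norm (q - p) / 4" by linarith+
qed

lemma outside:
  assumes "r \<le> norm q"
  shows "G q = q" "a q = 0" "c q = 0"
proof -
  have "g q = Re q" using g_unique[of "Re q" q] id_outside[OF assms] by simp
  then show "G q = q" "a q = 0" by (simp_all add: G_def a_def)
  then show "c q = 0" using id_outside[OF assms] by (simp add: c_def)
qed

subsection \<open>The generating function\<close>

definition W :: "complex \<Rightarrow> real" where
  "W q = \<sigma> (G q) - Re q * c q"

definition da :: "complex \<Rightarrow> complex \<Rightarrow> real" where
  "da q = frechet_derivative a (at q)"

definition dc :: "complex \<Rightarrow> complex \<Rightarrow> real" where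
  "dc q = frechet_derivative c (at q)"

lemma da: "(a has_derivative da q) (at q)"
  and dc: "(c has_derivative dc q) (at q)"
  unfolding da_def dc_def
  using Cdiff_has_frechet_derivative[OF a_Cdiff[of "Suc 0"]] Cdiff_has_frechet_derivative[OF c_Cdiff[of "Suc 0"]]
  by simp_all

lemma da_Cdiff: "Cdiff k UNIV (\<lambda>q. da q v)"
  and dc_Cdiff: "Cdiff k UNIV (\<lambda>q. dc q v)"
  by (rule Cdiff_derivative[OF _ _ a_Cdiff]; use da in simp)
     (rule Cdiff_derivative[OF _ _ c_Cdiff]; use dc in simp)

text \<open>
  From \<open>d\<sigma> = X dY - x dy\<close> and \<open>d (X (Y - y)) = X dY - X dy + (Y - y) dX\<close> it follows that
  \<open>dW = (X - x) dy - (Y - y) dX\<close>.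
\<close>

lemma W': "(W has_derivative (\<lambda>v. a q * Im v - c q * Re v)) (at q)"
proof -
  obtain G' where G': "(G has_derivative G') (at q)"
    using G_Cdiff[of "Suc 0"] by (metis Cdiff_SucE UNIV_I)
  have ImG': "Im (G' v) = Im v" for v
  proof -
    have "((\<lambda>q. Im (G q)) has_derivative (\<lambda>v. Im (G' v))) (at q)" using G' by (rule has_derivative_Im)
    moreover have "((\<lambda>q. Im (G q)) has_derivative (\<lambda>v. Im v)) (at q)"
      by (auto simp: G_def intro!: derivative_eq_intros)
    ultimately show ?thesis using has_derivative_unique by (metis (no_types))
  qed
  have Im\<psi>': "Im (\<psi>' (G q) (G' v)) = Im v + dc q v" for v
  proof -
    have "((\<lambda>q. Im (\<psi> (G q))) has_derivative (\<lambda>v. Im (\<psi>' (G q) (G' v)))) (at q)"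
      using has_derivative_Im[OF diff_chain_at[OF G' \<psi>']] by (simp add: o_def)
    moreover have "((\<lambda>q. Im (\<psi> (G q))) has_derivative (\<lambda>v. Im v + dc q v)) (at q)"
      by (auto simp: \<psi>_G intro!: derivative_eq_intros dc)
    ultimately show ?thesis using has_derivative_unique by (metis (no_types))
  qed
  have "((\<lambda>q. \<sigma> (G q)) has_derivative (\<lambda>v. Re q * (Im v + dc q v) - g q * Im v)) (at q)"
    using diff_chain_at[OF G' \<sigma>'] by (simp add: o_def Im\<psi>' ImG' \<psi>_G) (simp add: G_def)
  then have "(W has_derivative (\<lambda>v. (Re q * (Im v + dc q v) - g q * Im v) - (Re q * dc q v + Re v * c q))) (at q)"
    unfolding W_def[abs_def] by (intro has_derivative_diff has_derivative_mult dc) (auto intro!: derivative_eq_intros)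
  then show ?thesis by (simp add: a_def algebra_simps)
qed

lemma W_Cdiff: "Cdiff k UNIV W"
  by (rule Cdiff_has_derivative)
    (auto intro!: W' Cdiff_diff Cdiff_mult a_Cdiff c_Cdiff Cdiff_const simp del: Cdiff.simps)

text \<open>
  Both sides are second derivatives of \<open>W\<close> up to sign: \<open>a\<close> is its derivative in direction \<open>\<i>\<close>, and
  \<open>- c\<close> the one in direction \<open>1\<close>.
\<close>

lemma mixed_partials: "dc q \<i> = - da q 1"
proof -
  have "da q 1 * Im \<i> - dc q 1 * Re \<i> = da q \<i> * Im 1 - dc q \<i> * Re 1"
  proof (rule second_derivative_symmetric[OF W', where B' = "\<lambda>q u v. da q u * Im v - dc q u * Re v"])
    show "((\<lambda>q. a q * Im v - c q * Re v) has_derivative (\<lambda>u. da q u * Im v - dc q u * Re v)) (at q)" for q v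
      by (auto intro!: derivative_eq_intros da dc)
    show "continuous_on UNIV (\<lambda>q. da q u * Im v - dc q u * Re v)" for u v
      by (intro continuous_intros Cdiff_continuous_on[OF da_Cdiff] Cdiff_continuous_on[OF dc_Cdiff])
  qed
  then show ?thesis by simp
qed

lemma W_outside: "r \<le> norm q \<Longrightarrow> W q = 0"
  by (simp add: W_def outside \<sigma>_outside)

text \<open>
  \<open>W\<close> has a minimum on the disk.  Unless \<open>W\<close> vanishes there, the minimum is a critical point in
  the interior; then both displacements are zero, so that it is a fixed point of \<open>\<psi>\<close> and the value of \<open>W\<close>
  is its action.
\<close>

lemma W_nonneg:
  assumes "\<And>p. p \<in> disk \<Longrightarrow> \<psi> p = p \<Longrightarrow> 0 \<le> \<sigma> p"
  shows "0 \<le> W q"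
proof (cases "q \<in> disk")
  case False
  then show ?thesis using W_outside[of q] r by simp
next
  case True
  have "continuous_on disk W" using Cdiff_continuous_on[OF Cdiff_subset[OF W_Cdiff]] by blast
  then obtain p where p: "p \<in> disk" "\<And>y. y \<in> disk \<Longrightarrow> W p \<le> W y"
    using continuous_attains_inf[of disk W] by auto
  have "0 \<le> W p"
  proof (cases "r \<le> norm p")
    case True
    then show ?thesis by (simp add: W_outside)
  next
    case False
    then have "p \<in> ball 0 1" using r by auto
    from differential_zero_maxmin[OF this open_ball W'] p(2)
    have "(\<lambda>v. a p * Im v - c p * Re v) = (\<lambda>v. 0)" by auto
    from fun_cong[OF this, of \<i>] fun_cong[OF this, of 1] have ac: "a p = 0" "c p = 0" by simp_all
    then have "G p = p" by (simp add: G_def a_def complex_eq_iff)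
    moreover from this have "\<psi> p = p" using \<psi>_G[of p] ac by simp
    ultimately show ?thesis using assms[OF p(1)] ac by (simp add: W_def)
  qed
  then show ?thesis using p(2)[OF True] by simp
qed

subsection \<open>The isotopy generated by the multiples of the generating function\<close>

text \<open>
  The map \<open>\<Phi> t\<close> generated by \<open>t W\<close> sends \<open>(x, y)\<close> to \<open>(X, Y)\<close> with \<open>X = x + t a (X, y)\<close> and
  \<open>Y = y + t c (X, y)\<close>.  Given \<open>(x, y)\<close>, the first equation determines \<open>X = \<xi> t (x, y)\<close>; given \<open>(X, Y)\<close>, the
  second one determines \<open>y = \<eta> t (X, Y)\<close>, and with it the value \<open>W(X, y)\<close> of the Hamiltonian \<open>H t\<close> at \<open>(X, Y)\<close>.
\<close>

definition \<eta> :: "real \<Rightarrow> complex \<Rightarrow> real" where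
  "\<eta> t z = (THE y. y = Im z - t * c (Complex (Re z) y))"

definition \<xi> :: "real \<Rightarrow> complex \<Rightarrow> real" where
  "\<xi> t z = (THE x. x = Re z + t * a (Complex x (Im z)))"

definition \<Phi> :: "real \<Rightarrow> complex \<Rightarrow> complex" where
  "\<Phi> t z = Complex (\<xi> t z) (Im z + t * c (Complex (\<xi> t z) (Im z)))"

definition H :: "real \<Rightarrow> complex \<Rightarrow> real" where
  "H t z = W (Complex (Re z) (\<eta> t z))"

lemma \<eta>_contraction:
  assumes "t \<in> {0..1}"
  shows "\<bar>(s - t * c (Complex x y)) - (s - t * c (Complex x y'))\<bar> \<le> \<bar>y - y'\<bar> / 2"
proof -
  have "\<bar>(s - t * c (Complex x y)) - (s - t * c (Complex x y'))\<bar> = t * \<bar>c (Complex x y') - c (Complex x y)\<bar>"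
    using assms abs_mult[of t "c (Complex x y') - c (Complex x y)"] by (simp add: algebra_simps)
  also have "\<dots> \<le> 1 * (\<bar>y - y'\<bar> / 4)"
    using assms ac_Lipschitz(2)[of "Complex x y'" "Complex x y"]
    by (intro mult_mono) (auto simp: cmod_Complex_diff abs_minus_commute)
  finally show ?thesis by simp
qed

lemma \<xi>_contraction:
  assumes "t \<in> {0..1}"
  shows "\<bar>(s + t * a (Complex x y)) - (s + t * a (Complex x' y))\<bar> \<le> \<bar>x - x'\<bar> / 2"
proof -
  have "\<bar>(s + t * a (Complex x y)) - (s + t * a (Complex x' y))\<bar> = t * \<bar>a (Complex x y) - a (Complex x' y)\<bar>"
    using assms abs_mult[of t "a (Complex x y) - a (Complex x' y)"] by (simp add: algebra_simps)
  also have "\<dots> \<le> 1 * (\<bar>x - x'\<bar> / 4)"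
    using assms ac_Lipschitz(1)[of "Complex x y" "Complex x' y"]
    by (intro mult_mono) (auto simp: cmod_Complex_diff)
  finally show ?thesis by simp
qed

lemma \<eta>_eq: "t \<in> {0..1} \<Longrightarrow> \<eta> t z = Im z - t * c (Complex (Re z) (\<eta> t z))"
  unfolding \<eta>_def by (rule theI'[OF contraction_fixed_point[OF \<eta>_contraction]])

lemma \<eta>_unique: "t \<in> {0..1} \<Longrightarrow> y = Im z - t * c (Complex (Re z) y) \<Longrightarrow> \<eta> t z = y"
  unfolding \<eta>_def by (rule the1_equality[OF contraction_fixed_point[OF \<eta>_contraction]])

lemma \<xi>_eq: "t \<in> {0..1} \<Longrightarrow> \<xi> t z = Re z + t * a (Complex (\<xi> t z) (Im z))"
  unfolding \<xi>_def by (rule theI'[OF contraction_fixed_point[OF \<xi>_contraction]])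

lemma \<xi>_unique: "t \<in> {0..1} \<Longrightarrow> x = Re z + t * a (Complex x (Im z)) \<Longrightarrow> \<xi> t z = x"
  unfolding \<xi>_def by (rule the1_equality[OF contraction_fixed_point[OF \<xi>_contraction]])

lemma \<eta>_\<Phi>: "t \<in> {0..1} \<Longrightarrow> \<eta> t (\<Phi> t z) = Im z"
  by (rule \<eta>_unique) (simp_all add: \<Phi>_def)

lemma \<Phi>_inj:
  assumes t: "t \<in> {0..1}" and eq: "\<Phi> t z = \<Phi> t w"
  shows "z = w"
proof -
  have Im: "Im z = Im w" using \<eta>_\<Phi>[OF t, of z] \<eta>_\<Phi>[OF t, of w] eq by simp
  have "\<xi> t z = \<xi> t w" using eq by (simp add: \<Phi>_def)
  then have "Re z = Re w" using \<xi>_eq[OF t, of z] \<xi>_eq[OF t, of w] Im by simp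
  with Im show ?thesis by (simp add: complex_eq_iff)
qed

lemma \<Phi>_outside:
  assumes t: "t \<in> {0..1}" and z: "r \<le> norm z"
  shows "\<Phi> t z = z"
proof -
  have "\<xi> t z = Re z" by (rule \<xi>_unique[OF t]) (simp add: outside[OF z])
  then show ?thesis by (simp add: \<Phi>_def outside[OF z])
qed

text \<open>
  Points outside the disk are fixed by the injective map \<open>\<Phi> t\<close>, so no other point is sent there.
\<close>

lemma \<Phi>_disk:
  assumes "t \<in> {0..1}" "z \<in> disk"
  shows "\<Phi> t z \<in> disk"
proof (rule ccontr)
  assume not: "\<Phi> t z \<notin> disk"
  then have "\<Phi> t (\<Phi> t z) = \<Phi> t z" using r by (intro \<Phi>_outside assms) auto
  with \<Phi>_inj[OF assms(1)] assms(2) not show False by metis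
qed

lemma \<Phi>_0: "\<Phi> 0 z = z"
  using \<xi>_unique[of 0 "Re z" z] by (simp add: \<Phi>_def)

lemma \<Phi>_1: "\<Phi> 1 z = \<psi> z"
proof -
  define q where "q = Complex (Re (\<psi> z)) (Im z)"
  have "g q = Re z" by (rule g_unique) (simp add: q_def)
  then have "G q = z" by (simp add: G_def q_def complex_eq_iff)
  have "\<xi> 1 z = Re (\<psi> z)"
    by (rule \<xi>_unique) (use \<open>g q = Re z\<close> in \<open>simp_all add: a_def flip: q_def, simp add: q_def\<close>)
  moreover have "Im (\<psi> z) = Im q + c q" using \<psi>_G[of q] \<open>G q = z\<close> by simp
  ultimately show ?thesis by (simp add: \<Phi>_def q_def complex_eq_iff)
qed

lemma da_real: "da q (of_real h) = h * da q 1"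
  and dc_real: "dc q (of_real h) = h * dc q 1"
proof -
  have *: "linear (da q)" "linear (dc q)" using da dc has_derivative_linear by blast+
  have "of_real h = h *\<^sub>R (1::complex)" by (simp add: scaleR_conv_of_real)
  then show "da q (of_real h) = h * da q 1" "dc q (of_real h) = h * dc q 1"
    using linear_scale[OF *(1), of h 1] linear_scale[OF *(2), of h 1] by simp_all
qed

lemma Complex_derivative:
  assumes "(f has_derivative f') F" "(h has_derivative h') F"
  shows "((\<lambda>x. Complex (f x) (h x)) has_derivative (\<lambda>v. Complex (f' v) (h' v))) F"
proof -
  have "((\<lambda>x. of_real (f x) + \<i> * of_real (h x)) has_derivative (\<lambda>v. of_real (f' v) + \<i> * of_real (h' v))) F"
    using assms by (auto intro!: derivative_eq_intros)
  then show ?thesis by (simp add: Complex_eq)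
qed

lemma \<xi>_time_derivative:
  fixes z :: complex
  assumes t: "t \<in> {0..1}"
  defines "q \<equiv> Complex (\<xi> t z) (Im z)"
  shows "((\<lambda>t. \<xi> t z) has_real_derivative a q / (1 - t * da q 1)) (at t within {0..1})"
proof -
  let ?f = "\<lambda>p. Re z + fst p * a (Complex (snd p) (Im z))"
  let ?f' = "\<lambda>p h. fst p * da (Complex (snd p) (Im z)) (of_real (snd h)) + fst h * a (Complex (snd p) (Im z))"
  have f': "(?f has_derivative ?f' p) (at p within S)" for p :: "real \<times> real" and S
  proof -
    have "((\<lambda>p::real \<times> real. Complex (snd p) (Im z)) has_derivative (\<lambda>h. of_real (snd h))) (at p within S)"
      using Complex_derivative[OF has_derivative_snd[OF has_derivative_ident] has_derivative_const]
      by (simp add: complex_of_real_def)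
    from diff_chain_within[OF this has_derivative_at_withinI[OF da]]
    have "((\<lambda>p. a (Complex (snd p) (Im z))) has_derivative (\<lambda>h. da (Complex (snd p) (Im z)) (of_real (snd h)))) (at p within S)"
      by (simp add: o_def)
    from has_derivative_add[OF has_derivative_const has_derivative_mult[OF has_derivative_fst[OF has_derivative_ident] this]]
    show ?thesis by simp
  qed
  have f_cont: "continuous_on ({0..1} \<times> UNIV) ?f" by (rule has_derivative_continuous_on[OF f'])
  have lip: "\<bar>?f (s, x) - ?f (s, y)\<bar> \<le> \<bar>x - y\<bar> / 2" if "s \<in> {0..1}" for s x y
    using \<xi>_contraction[OF that, of "Re z" x "Im z" y] by simp
  have fp: "\<xi> s z = ?f (s, \<xi> s z)" if "s \<in> {0..1}" for s using \<xi>_eq[OF that, of z] by simp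
  have "continuous_on {0..1} (\<lambda>s. \<xi> s z)"
    by (rule parametrized_fixed_point_continuous[OF f_cont lip fp])
  from parametrized_fixed_point_derivative[OF f' t this lip[OF t] fp]
  have "((\<lambda>s. \<xi> s z) has_derivative (\<lambda>h. ?f' (t, \<xi> t z) (h, 0) * inverse (1 - ?f' (t, \<xi> t z) (0, 1)))) (at t within {0..1})" .
  then show ?thesis
    by (rule has_derivative_imp_has_field_derivative)
      (simp add: q_def da_real[of _ 0, simplified] divide_inverse)
qed

lemma \<eta>_space_derivative:
  fixes z :: complex
  assumes t: "t \<in> {0..1}"
  defines "q \<equiv> Complex (Re z) (\<eta> t z)"
  shows "(\<eta> t has_derivative (\<lambda>h. (Im h - t * dc q (of_real (Re h))) / (1 + t * dc q \<i>))) (at z)"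
proof -
  let ?f = "\<lambda>p. Im (fst p) - t * c (Complex (Re (fst p)) (snd p))"
  let ?f' = "\<lambda>p h. Im (fst h) - t * dc (Complex (Re (fst p)) (snd p)) (Complex (Re (fst h)) (snd h))"
  have f': "(?f has_derivative ?f' p) (at p within S)" for p :: "complex \<times> real" and S
  proof -
    have "((\<lambda>p::complex \<times> real. Complex (Re (fst p)) (snd p)) has_derivative (\<lambda>h. Complex (Re (fst h)) (snd h))) (at p within S)"
      by (intro Complex_derivative has_derivative_Re has_derivative_fst has_derivative_snd has_derivative_ident)
    from diff_chain_within[OF this has_derivative_at_withinI[OF dc]]
    have "((\<lambda>p. c (Complex (Re (fst p)) (snd p))) has_derivative (\<lambda>h. dc (Complex (Re (fst p)) (snd p)) (Complex (Re (fst h)) (snd h)))) (at p within S)"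
      by (simp add: o_def)
    then show ?thesis
      by (intro has_derivative_diff has_derivative_mult_right has_derivative_Im has_derivative_fst has_derivative_ident)
  qed
  have f_cont: "continuous_on (UNIV \<times> UNIV) ?f" by (rule has_derivative_continuous_on[OF f'])
  have lip: "\<bar>?f (w, x) - ?f (w, y)\<bar> \<le> \<bar>x - y\<bar> / 2" for w x y
    using \<eta>_contraction[OF t, of "Im w" "Re w" x y] by simp
  have fp: "\<eta> t w = ?f (w, \<eta> t w)" for w using \<eta>_eq[OF t, of w] by simp
  have "continuous_on UNIV (\<eta> t)"
    by (rule parametrized_fixed_point_continuous[OF f_cont lip fp])
  from parametrized_fixed_point_derivative[OF f' UNIV_I this lip fp]
  have "(\<eta> t has_derivative (\<lambda>h. ?f' (z, \<eta> t z) (h, 0) * inverse (1 - ?f' (z, \<eta> t z) (0, 1)))) (at z)" .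
  moreover have "Complex (Re h) 0 = of_real (Re h)" "Complex 0 1 = \<i>" for h by (simp_all add: complex_eq_iff)
  ultimately show ?thesis by (simp add: q_def divide_inverse)
qed

lemma H_derivative:
  fixes z :: complex
  assumes t: "t \<in> {0..1}"
  defines "q \<equiv> Complex (Re z) (\<eta> t z)"
  shows "(H t has_derivative (\<lambda>h. a q * ((Im h - t * dc q (of_real (Re h))) / (1 + t * dc q \<i>)) - c q * Re h)) (at z)"
proof -
  have "((\<lambda>z. Complex (Re z) (\<eta> t z)) has_derivative
      (\<lambda>h. Complex (Re h) ((Im h - t * dc q (of_real (Re h))) / (1 + t * dc q \<i>)))) (at z)"
    unfolding q_def by (intro Complex_derivative \<eta>_space_derivative t has_derivative_Re has_derivative_ident)
  from diff_chain_at[OF this W'] show ?thesis by (simp add: o_def H_def[abs_def] q_def)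
qed

text \<open>
  With \<open>q = (X, y)\<close>, differentiating the equations of the isotopy in \<open>t\<close> gives
  \<open>X' = a / (1 - t a\<^sub>X)\<close> and \<open>Y' = c + t c\<^sub>X X'\<close>, while \<open>H\<^sub>t(X, Y) = W(X, y)\<close> has the partial derivatives
  \<open>H\<^sub>Y = a / (1 + t c\<^sub>y)\<close> and \<open>H\<^sub>X = - c - t c\<^sub>X a / (1 + t c\<^sub>y)\<close>.  By symmetry of the second derivatives of \<open>W\<close>,
  \<open>c\<^sub>y = - a\<^sub>X\<close>, so these are Hamilton's equations \<open>X' = H\<^sub>Y\<close>, \<open>Y' = - H\<^sub>X\<close>.
\<close>

lemma H_flow: "is_Ham_flow H \<Phi>"
  unfolding is_Ham_flow_def
proof (intro ballI conjI)
  fix z t assume z: "z \<in> disk" and t: "t \<in> {0..1::real}"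
  show "\<Phi> t z \<in> disk" by (rule \<Phi>_disk[OF t z])
  define q where "q = Complex (\<xi> t z) (Im z)"
  have q: "Complex (Re (\<Phi> t z)) (\<eta> t (\<Phi> t z)) = q"
    by (simp add: q_def \<eta>_\<Phi>[OF t]) (simp add: \<Phi>_def)
  define \<xi>' where "\<xi>' = a q / (1 - t * da q 1)"
  have D: "(H t has_derivative (\<lambda>h. a q * ((Im h - t * dc q (of_real (Re h))) / (1 + t * dc q \<i>)) - c q * Re h)) (at (\<Phi> t z) within disk)"
    using has_derivative_at_withinI[OF H_derivative[OF t, of "\<Phi> t z"]] by (simp only: q)
  have dd: "disk_deriv (H t) (\<Phi> t z) = (\<lambda>h. a q * ((Im h - t * dc q (of_real (Re h))) / (1 + t * dc q \<i>)) - c q * Re h)"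
    by (rule frechet_derivative_within_convex[OF closed_disk_convex_interior(1,2) D \<Phi>_disk[OF t z]])
  have X: "Ham_vector_field (H t) (\<Phi> t z) = Complex \<xi>' (c q + t * (\<xi>' * dc q 1))"
    unfolding Ham_vector_field_eq[OF differentiableI[OF D]] dd
    using dc_real[of q 0] dc_real[of q 1] by (simp add: \<xi>'_def mixed_partials)
  have \<xi>: "((\<lambda>s. \<xi> s z) has_derivative (\<lambda>h. h * \<xi>')) (at t within {0..1})"
    using \<xi>_time_derivative[OF t, of z] by (simp only: has_field_derivative_def mult_commute_abs \<xi>'_def q_def)
  have "((\<lambda>s. Complex (\<xi> s z) (Im z)) has_derivative (\<lambda>h. of_real (h * \<xi>'))) (at t within {0..1})"
    using Complex_derivative[OF \<xi> has_derivative_const] by (simp add: complex_of_real_def)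
  from diff_chain_within[OF this has_derivative_at_withinI[OF dc]]
  have "((\<lambda>s. c (Complex (\<xi> s z) (Im z))) has_derivative (\<lambda>h. dc q (of_real (h * \<xi>')))) (at t within {0..1})"
    by (simp add: o_def q_def)
  from has_derivative_add[OF has_derivative_const has_derivative_mult[OF has_derivative_ident this]]
  have "((\<lambda>s. Im z + s * c (Complex (\<xi> s z) (Im z))) has_derivative (\<lambda>h. t * dc q (of_real (h * \<xi>')) + h * c q)) (at t within {0..1})"
    by (simp add: q_def)
  from Complex_derivative[OF \<xi> this]
  have "((\<lambda>s. \<Phi> s z) has_derivative (\<lambda>h. h *\<^sub>R Complex \<xi>' (c q + t * (\<xi>' * dc q 1)))) (at t within {0..1})"
    by (simp only: \<Phi>_def[abs_def] dc_real) (simp add: algebra_simps complex_scaleR)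
  then show "((\<lambda>s. \<Phi> s z) has_vector_derivative Ham_vector_field (H t) (\<Phi> t z)) (at t within {0..1})"
    by (simp only: has_vector_derivative_def X)
qed (rule \<Phi>_0)

lemma H_Cdiff: "Cdiff k ({0..1} \<times> UNIV) (\<lambda>(t, z). H t z)"
proof -
  have "Cdiff k ({0..1} \<times> UNIV) (\<lambda>p. \<eta> (fst p) (snd p))"
  proof (rule parametrized_fixed_point_Cdiff[where f = "\<lambda>p. Im (snd (fst p)) - fst (fst p) * c (Complex (Re (snd (fst p))) (snd p))"])
    show "Cdiff k (({0..1} \<times> UNIV) \<times> UNIV) (\<lambda>p::(real \<times> complex) \<times> real. Im (snd (fst p)) - fst (fst p) * c (Complex (Re (snd (fst p))) (snd p)))"
      by (intro Cdiff_diff Cdiff_mult Cdiff_Im Cdiff_Re Cdiff_fst Cdiff_snd Cdiff_ident Cdiff_compose[OF c_Cdiff] Cdiff_Complex UNIV_I)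
    show "\<bar>(Im (snd (fst (p, x))) - fst (fst (p, x)) * c (Complex (Re (snd (fst (p, x)))) (snd (p, x))))
       - (Im (snd (fst (p, y))) - fst (fst (p, y)) * c (Complex (Re (snd (fst (p, y)))) (snd (p, y))))\<bar> \<le> \<bar>x - y\<bar> / 2"
      if "p \<in> {0..1} \<times> UNIV" for p x y
      using \<eta>_contraction[of "fst p" "Im (snd p)" "Re (snd p)" x y] that by auto
  qed (use \<eta>_eq in auto)
  then have "Cdiff k ({0..1} \<times> UNIV) (\<lambda>p. W (Complex (Re (snd p)) (\<eta> (fst p) (snd p))))"
    by (intro Cdiff_compose[OF W_Cdiff] Cdiff_Complex Cdiff_Re Cdiff_snd Cdiff_ident UNIV_I)
  then show ?thesis by (simp add: H_def case_prod_unfold)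
qed

lemma H_supported: "supported_Hamiltonian H"
  unfolding supported_Hamiltonian_def
proof
  show "smooth_on ({0..1} \<times> disk) (\<lambda>(t, z). H t z)"
    using smooth_on_iff_Cdiff[OF closed_disk_convex_interior(3,4)] Cdiff_subset[OF H_Cdiff] by blast
  have H0: "H t z = 0" if t: "t \<in> {0..1}" and z: "r \<le> norm z" for t z
  proof -
    have "\<eta> t z = Im z" by (rule \<eta>_unique[OF t]) (simp add: outside[OF z])
    then show ?thesis by (simp add: H_def W_outside[OF z])
  qed
  have "{(t, z). t \<in> {0..1} \<and> z \<in> disk \<and> H t z \<noteq> 0} \<subseteq> {0..1} \<times> cball 0 r"
    using H0 by (auto simp: not_le) (meson linorder_not_le less_imp_le)
  then have "closure {(t, z). t \<in> {0..1} \<and> z \<in> disk \<and> H t z \<noteq> 0} \<subseteq> {0..1} \<times> cball 0 r"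
    by (rule closure_minimal) (intro closed_Times closed_cball closed_atLeastAtMost)
  also have "\<dots> \<subseteq> {0..1} \<times> ball 0 1" using r by auto
  finally show "closure {(t, z). t \<in> {0..1} \<and> z \<in> disk \<and> H t z \<noteq> 0} \<subseteq> {0..1} \<times> ball 0 1" .
qed

lemma generated_by_nonneg_Hamiltonian:
  assumes "\<And>p. p \<in> disk \<Longrightarrow> \<psi> p = p \<Longrightarrow> 0 \<le> \<sigma> p"
  shows "\<exists>H. supported_Hamiltonian H \<and> (\<forall>t\<in>{0..1}. \<forall>z\<in>disk. 0 \<le> H t z) \<and> generates H \<psi>"
proof (intro exI conjI ballI)
  show "supported_Hamiltonian H" by (rule H_supported)
  show "0 \<le> H t z" for t z unfolding H_def by (rule W_nonneg[OF assms])
  show "generates H \<psi>"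
    unfolding generates_def by (intro exI[of _ \<Phi>] conjI ballI H_flow \<Phi>_1[symmetric])
qed

end

section \<open>The neighbourhood of the identity\<close>

lemma Ham_c_disk_deriv:
  assumes "\<psi> \<in> Ham_c" "z \<in> disk"
  shows "(\<psi> has_derivative disk_deriv \<psi> z) (at z within disk)"
proof -
  obtain \<psi>' where "\<And>z. (\<psi> has_derivative \<psi>' z) (at z)"
    using Ham_c_structure[OF assms(1)] by metis
  then have "(\<psi> has_derivative \<psi>' z) (at z within disk)" using has_derivative_at_withinI by blast
  then show ?thesis using differentiableI frechet_derivative_works by blast
qed

lemma C1_ball_triangle:
  assumes "\<phi> \<in> C1_ball id \<epsilon>" "\<theta> \<in> C1_ball \<phi> \<delta>"
  shows "\<theta> \<in> C1_ball id (\<epsilon> + \<delta>)"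
  unfolding C1_ball_def
proof (intro CollectI conjI ballI)
  show "\<theta> \<in> Ham_c" using assms(2) by (simp add: C1_ball_def)
  have H: "\<phi> \<in> Ham_c" "\<theta> \<in> Ham_c" using assms by (simp_all add: C1_ball_def)
  fix z :: complex assume z: "z \<in> disk"
  have d: "dist (\<phi> z) (id z) < \<epsilon>" "onorm (\<lambda>v. disk_deriv \<phi> z v - disk_deriv id z v) < \<epsilon>"
    "dist (\<theta> z) (\<phi> z) < \<delta>" "onorm (\<lambda>v. disk_deriv \<theta> z v - disk_deriv \<phi> z v) < \<delta>"
    using assms z by (simp_all add: C1_ball_def)
  show "dist (\<theta> z) (id z) < \<epsilon> + \<delta>"
    using d(1,3) dist_triangle[of "\<theta> z" "id z" "\<phi> z"] by linarith
  have bl: "bounded_linear (disk_deriv f z)" if "f \<in> Ham_c" for f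
    using has_derivative_bounded_linear[OF Ham_c_disk_deriv[OF that z]] .
  have "onorm (\<lambda>v. disk_deriv \<theta> z v - disk_deriv id z v) =
      onorm (\<lambda>v. (disk_deriv \<theta> z v - disk_deriv \<phi> z v) + (disk_deriv \<phi> z v - disk_deriv id z v))"
    by simp
  also have "\<dots> \<le> onorm (\<lambda>v. disk_deriv \<theta> z v - disk_deriv \<phi> z v) + onorm (\<lambda>v. disk_deriv \<phi> z v - disk_deriv id z v)"
    by (intro onorm_triangle bounded_linear_sub bl H id_in_Ham_c)
  also have "\<dots> < \<epsilon> + \<delta>" using d(2,4) by linarith
  finally show "onorm (\<lambda>v. disk_deriv \<theta> z v - disk_deriv id z v) < \<epsilon> + \<delta>" .
qed

text \<open>
  The union over smaller radii leaves each of its members a margin that is uniform over the disk, so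
  that the triangle inequality yields a ball around it.
\<close>

lemma openin_C1_neighbourhood: "openin C1_topology (\<Union>\<epsilon>\<in>{0<..<b}. C1_ball id \<epsilon>)"
  unfolding openin_C1_topology
proof (intro conjI ballI)
  show "(\<Union>\<epsilon>\<in>{0<..<b}. C1_ball id \<epsilon>) \<subseteq> Ham_c" by (auto simp: C1_ball_def)
  fix \<phi> assume "\<phi> \<in> (\<Union>\<epsilon>\<in>{0<..<b}. C1_ball id \<epsilon>)"
  then obtain \<epsilon> where \<epsilon>: "0 < \<epsilon>" "\<epsilon> < b" "\<phi> \<in> C1_ball id \<epsilon>" by auto
  have "C1_ball \<phi> ((b - \<epsilon>) / 2) \<subseteq> C1_ball id (\<epsilon> + (b - \<epsilon>) / 2)"
    using C1_ball_triangle[OF \<epsilon>(3)] by blast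
  moreover have "\<epsilon> + (b - \<epsilon>) / 2 \<in> {0<..<b}" using \<epsilon> by (simp add: field_simps)
  ultimately have "C1_ball \<phi> ((b - \<epsilon>) / 2) \<subseteq> (\<Union>\<epsilon>\<in>{0<..<b}. C1_ball id \<epsilon>)" by blast
  then show "\<exists>\<delta>>0. C1_ball \<phi> \<delta> \<subseteq> (\<Union>\<epsilon>\<in>{0<..<b}. C1_ball id \<epsilon>)"
    using \<epsilon> by (intro exI[of _ "(b - \<epsilon>) / 2"]) auto
qed

lemma disk_deriv_id: "z \<in> disk \<Longrightarrow> disk_deriv id z = (\<lambda>v. v)"
  by (rule frechet_derivative_within_convex[OF closed_disk_convex_interior(1,2)]) (auto simp: id_def)

theorem proposition1p12:
  shows "\<exists>\<U>. \<U> \<subseteq> Ham_c \<and> id \<in> C1_topology interior_of \<U> \<and>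
    (\<forall>\<psi>\<in>\<U>. \<forall>\<alpha>. primitive_of_\<omega>0 \<alpha> \<longrightarrow>
      (\<forall>p\<in>disk. \<psi> p = p \<longrightarrow> 0 \<le> action \<psi> \<alpha> p) \<longrightarrow>
      (\<exists>H. supported_Hamiltonian H \<and> (\<forall>t\<in>{0..1}. \<forall>z\<in>disk. 0 \<le> H t z) \<and> generates H \<psi>))"
proof (intro exI[of _ "\<Union>\<epsilon>\<in>{0<..<1/5}. C1_ball id \<epsilon>"] conjI ballI allI impI)
  let ?U = "\<Union>\<epsilon>\<in>{0<..<1/5}. C1_ball id \<epsilon>"
  show "?U \<subseteq> Ham_c" by (auto simp: C1_ball_def)
  have "onorm (\<lambda>v::complex. 0::complex) = 0" by (rule onorm_zero)
  then have "id \<in> C1_ball id (1 / 10)"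
    unfolding C1_ball_def using id_in_Ham_c by auto
  then have "id \<in> ?U" by (intro UN_I[of "1 / 10"]) auto
  then show "id \<in> C1_topology interior_of ?U"
    by (simp add: interior_of_openin openin_C1_neighbourhood)
next
  fix \<psi> \<alpha>
  assume \<psi>: "\<psi> \<in> (\<Union>\<epsilon>\<in>{0<..<1/5}. C1_ball id \<epsilon>)" and \<alpha>: "primitive_of_\<omega>0 \<alpha>"
    and action: "\<forall>p\<in>disk. \<psi> p = p \<longrightarrow> 0 \<le> action \<psi> \<alpha> p"
  have Ham: "\<psi> \<in> Ham_c" using \<psi> by (auto simp: C1_ball_def)
  have close: "onorm (\<lambda>v. disk_deriv \<psi> z v - v) < 1 / 5" if z: "z \<in> disk" for z
  proof -
    obtain \<epsilon> where "\<epsilon> < 1 / 5" "onorm (\<lambda>v. disk_deriv \<psi> z v - disk_deriv id z v) < \<epsilon>"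
      using \<psi> z by (auto simp: C1_ball_def)
    then show ?thesis by (simp add: disk_deriv_id[OF z])
  qed
  obtain r \<sigma> \<psi>' where r: "0 < r" "r < 1" and out: "\<And>z. r \<le> norm z \<Longrightarrow> \<psi> z = z" and disk: "\<psi> ` disk \<subseteq> disk"
    and smooth: "\<And>k. Cdiff k UNIV \<psi>" and \<psi>': "\<And>z. (\<psi> has_derivative \<psi>' z) (at z)"
    and \<sigma>': "\<And>z. (\<sigma> has_derivative (\<lambda>v. Re (\<psi> z) * Im (\<psi>' z v) - Re z * Im v)) (at z)"
    and \<sigma>0: "\<And>z. r \<le> norm z \<Longrightarrow> \<sigma> z = (0::real)"
    by (rule Ham_c_structure[OF Ham]) (rule that; (assumption | blast))
  have near: "norm (\<psi>' z v - v) \<le> norm v / 5" for z v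
  proof (cases "z \<in> disk")
    case True
    have eq: "disk_deriv \<psi> z = \<psi>' z"
      by (rule frechet_derivative_within_convex[OF closed_disk_convex_interior(1,2) has_derivative_at_withinI[OF \<psi>'] True])
    have "norm (\<psi>' z v - v) \<le> onorm (\<lambda>v. \<psi>' z v - v) * norm v"
      by (intro onorm[of "\<lambda>v. \<psi>' z v - v"] bounded_linear_sub has_derivative_bounded_linear[OF \<psi>'] bounded_linear_ident)
    also have "\<dots> \<le> 1 / 5 * norm v"
      using close[OF True] by (intro mult_right_mono) (auto simp: eq)
    finally show ?thesis by simp
  next
    case False
    then have z: "z \<in> - disk" by simp
    have "(\<psi> has_derivative (\<lambda>v. v)) (at z)"
      by (rule has_derivative_transform_within_open[OF has_derivative_ident _ z]) (use r in \<open>auto simp: out open_Compl\<close>)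
    then have "\<psi>' z = (\<lambda>v. v)" using has_derivative_unique[OF \<psi>'] by blast
    then show ?thesis by simp
  qed
  interpret near_identity_map \<psi> \<psi>' \<sigma> r
    by standard (fact r out smooth \<psi>' near \<sigma>' \<sigma>0)+
  show "\<exists>H. supported_Hamiltonian H \<and> (\<forall>t\<in>{0..1}. \<forall>z\<in>disk. 0 \<le> H t z) \<and> generates H \<psi>"
  proof (rule generated_by_nonneg_Hamiltonian)
    fix p assume p: "p \<in> disk" "\<psi> p = p"
    have "action \<psi> \<alpha> p = \<sigma> p"
      by (rule action_at_fixed_point[OF \<alpha> disk _ smooth \<psi>' \<sigma>' _ p]) (use out \<sigma>0 r in auto)
    then show "0 \<le> \<sigma> p" using action p by auto
  qed
qed

end
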